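(* Let $\phi$ be a conic holomorphic nondegenerate Lagrangian immersion of a complex manifold $(M,J)$, $\dim_{\mathbb{C}}M=n$, into $V=T^*\mathbb{C}^n$, inducing the Kähler metric $g$ on $M$. The immersion $\phi$ is totally complex and hence also induces the data $(\nabla,\omega)$ (connection and symplectic form) on $M$. Moreover: (i) $(M,J,\nabla,\omega)$ is a conic Kähler manifold. (ii) $\omega$ coincides with the Kähler form of $g$, i.e. $\omega=g(\cdot,J\cdot)$. (iii) The pull back via $\phi$ of the canonical coordinates $(z^1,\dots,z^n,w_1,\dots,w_n)$ of $V$ defines a conic conjugate pair of special coordinates around each point of $M$.
   Context: Kähler metrics are allowed to be indefinite. A local holomorphic $\mathbb{C}^*$-action on a complex manifold $M$ is a holomorphic map $(\lambda,p)\mapsto\varphi_\lambda(p)\in M$ defined on an open neighbourhood $W$ of $\{1\}\times M$ in $\mathbb{C}^*\times M$ such that $\varphi_1(p)=p$ for all $p$ and $\varphi_\lambda(\varphi_\mu(p))=\varphi_{\lambda\mu}(p)$ whenever both sides are defined. Equations involving $\varphi_\lambda$ are meant to hold locally, i.e. on any open set on which $\varphi_\lambda$ is defined and is a diffeomorphism onto its image. A conic complex manifold $(M,J,\nabla)$ is a complex manifold $(M,J)$ with a flat torsionfree connection $\nabla$ (on the real tangent bundle) admitting a local holomorphic $\mathbb{C}^*$-action $\varphi_\lambda$ such that locally $d\varphi_\lambda X=re^{\theta J}X=r(\cos\theta)X+r(\sin\theta)JX$ for all (local) $\nabla$-parallel vector fields $X$, where $\lambda=re^{i\theta}$, $r>0$.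 A conic Kähler manifold $(M,J,\nabla,\omega)$ is a conic complex manifold with a $\nabla$-parallel $J$-invariant symplectic form $\omega$. A real special coordinate system is a local coordinate system $(x^1,\dots,x^n,y_1,\dots,y_n)$ of $\nabla$-affine functions (functions $f$ with $\nabla df=0$) with $\omega=2\sum dx^i\wedge dy_i$. A conjugate pair of special coordinates is a pair of holomorphic local coordinate systems $z=(z^1,\dots,z^n)$, $w=(w_1,\dots,w_n)$ whose real parts $(\mathrm{Re}\,z^i,\mathrm{Re}\,w_j)$ form a real special coordinate system; it is conic if locally $(z,w)\circ\varphi_\lambda=\lambda(z,w)$. $V=T^*\mathbb{C}^n=\mathbb{C}^{2n}$ has canonical coordinates $(z^1,\dots,z^n,w_1,\dots,w_n)$, standard complex symplectic form $\Omega=\sum dz^i\wedge dw_i$, standard real structure $\tau$ (complex conjugation) with fixed point set $V^\tau=T^*\mathbb{R}^n=\mathbb{R}^{2n}$, and Hermitian form $\gamma=\sqrt{-1}\,\Omega(\cdot,\tau\cdot)$. Put $x^i=\mathrm{Re}\,z^i$, $y_i=\mathrm{Re}\,w_i$. A holomorphic immersion $\phi:M\to V$ of a connected complex $n$-fold is nondegenerate if $\phi^*\gamma$ is nondegenerate; Lagrangian if $\phi^*\Omega=0$; totally complex if $V^\tau\cap d\phi(T_pM)=0$ for all $p\in M$; conic if for every $p\in M$ and every neighbourhood $U$ of $p$ there exist neighbourhoods $U_1$ of $1\in\mathbb{C}^*$ and $U_p$ of $p$ such that $\lambda\phi(U_p)\subset\phi(U)$ for all $\lambda\in U_1$. A nondegenerate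 $\phi$ induces the Kähler metric $g=\mathrm{Re}\,\phi^*\gamma$. If $\phi$ is totally complex, the functions $x^i\circ\phi,\ y_j\circ\phi$ are local coordinates around each point of $M$; the induced connection $\nabla$ is the flat torsionfree connection for which these functions are affine, and the induced symplectic form is $\omega=2\phi^*(\sum dx^i\wedge dy_i)$.
   Formalization: In (iii), that z and w are each holomorphic coordinate systems is claimed only where dz and dw are injective or g is definite (it fails for indefinite g, e.g. φ(s,t)=((t,it),(s,is))); all other clauses of (iii) are claimed around every point. *)

theory Defs
  imports "HOL-Analysis.Analysis"
begin

text \<open>Calculus in Euclidean spaces. All predicates below are meant for open sets \<open>S\<close>; there
  \<open>Ck_on k f S\<close> says that \<open>f\<close> is k times continuously differentiable.\<close>

primrec Ck_on :: "nat \<Rightarrow> ('a::euclidean_space \<Rightarrow> 'b::euclidean_space) \<Rightarrow> 'a set \<Rightarrow> bool" where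
  "Ck_on 0 f S \<longleftrightarrow> continuous_on S f"
| "Ck_on (Suc k) f S \<longleftrightarrow> (\<forall>x\<in>S. f differentiable (at x)) \<and>
     (\<forall>v. Ck_on k (\<lambda>x. frechet_derivative f (at x) v) S)"

definition smooth_on :: "('a::euclidean_space \<Rightarrow> 'b::euclidean_space) \<Rightarrow> 'a set \<Rightarrow> bool" where
  "smooth_on f S \<longleftrightarrow> (\<forall>k. Ck_on k f S)"

text \<open>There is no library class for complex vector spaces, so holomorphic maps in several variables
  take the multiplications \<open>J1\<close>, \<open>J2\<close> by the imaginary unit on source and target as parameters:
  holomorphic means smooth with complex linear differential.\<close>

definition holo_on :: "('a::euclidean_space \<Rightarrow> 'a) \<Rightarrow> ('b::euclidean_space \<Rightarrow> 'b) \<Rightarrow>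
    ('a \<Rightarrow> 'b) \<Rightarrow> 'a set \<Rightarrow> bool" where
  "holo_on J1 J2 f S \<longleftrightarrow> smooth_on f S \<and>
     (\<forall>x\<in>S. \<forall>v. frechet_derivative f (at x) (J1 v) = J2 (frechet_derivative f (at x) v))"

definition Jn :: "complex ^ 'n \<Rightarrow> complex ^ 'n" where
  "Jn v = \<i> *s v"

definition JCn :: "complex \<times> (complex ^ 'n) \<Rightarrow> complex \<times> (complex ^ 'n)" where
  "JCn = map_prod ((*) \<i>) Jn"


section \<open>Complex manifolds\<close>

text \<open>The underlying space of a manifold is a Hausdorff second countable type \<open>'m\<close>. A chart is a
  pair of its domain and its coordinate map (whose values off the domain are irrelevant). The atlas
  need not be maximal.\<close>

type_synonym ('m, 'n) chart = "'m set \<times> ('m \<Rightarrow> complex ^ 'n)"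

definition complex_atlas ::
    "('m::{t2_space,second_countable_topology}, 'n::finite) chart set \<Rightarrow> bool" where
  "complex_atlas A \<longleftrightarrow>
     (\<forall>(U, c)\<in>A. open U \<and> open (c ` U) \<and> homeomorphism U (c ` U) c (inv_into U c)) \<and>
     (\<Union>(U, c)\<in>A. U) = UNIV \<and>
     (\<forall>(U, c)\<in>A. \<forall>(V, d)\<in>A. holo_on Jn Jn (d \<circ> inv_into U c) (c ` (U \<inter> V)))"

text \<open>The (real) tangent space at \<open>p\<close> is the type \<open>complex ^ 'n\<close>, where a vector stands for the
  tangent vector having these components in one chart around \<open>p\<close> that is selected once and for all;
  the complex structure \<open>J\<close> is then \<^const>\<open>Jn\<close> at every point. Components in any other chart are
  obtained by applying the differential \<open>tdiff\<close> of that chart.\<close>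

definition chart_at :: "('m, 'n::finite) chart set \<Rightarrow> 'm \<Rightarrow> ('m, 'n) chart" where
  "chart_at A p = (SOME c. c \<in> A \<and> p \<in> fst c)"

definition tdiff :: "('m, 'n::finite) chart set \<Rightarrow> ('m \<Rightarrow> 'b::real_normed_vector) \<Rightarrow>
    'm \<Rightarrow> complex ^ 'n \<Rightarrow> 'b" where
  "tdiff A F p v = (case chart_at A p of (U, c) \<Rightarrow>
     frechet_derivative (F \<circ> inv_into U c) (at (c p)) v)"

definition tmap :: "('m, 'n::finite) chart set \<Rightarrow> ('m \<Rightarrow> 'm) \<Rightarrow> 'm \<Rightarrow> complex ^ 'n \<Rightarrow> complex ^ 'n" where
  "tmap A F p v = tdiff A (snd (chart_at A (F p)) \<circ> F) p v"

definition smooth_fun ::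
    "('m, 'n::finite) chart set \<Rightarrow> 'm set \<Rightarrow> ('m \<Rightarrow> 'b::euclidean_space) \<Rightarrow> bool" where
  "smooth_fun A U F \<longleftrightarrow> (\<forall>(V, c)\<in>A. smooth_on (F \<circ> inv_into V c) (c ` (U \<inter> V)))"

definition holo_fun :: "('m, 'n::finite) chart set \<Rightarrow> ('b::euclidean_space \<Rightarrow> 'b) \<Rightarrow>
    'm set \<Rightarrow> ('m \<Rightarrow> 'b) \<Rightarrow> bool" where
  "holo_fun A J U F \<longleftrightarrow> (\<forall>(V, c)\<in>A. holo_on Jn J (F \<circ> inv_into V c) (c ` (U \<inter> V)))"

definition smooth_map ::
    "('m::topological_space, 'n::finite) chart set \<Rightarrow> 'm set \<Rightarrow> ('m \<Rightarrow> 'm) \<Rightarrow> bool" where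
  "smooth_map A U F \<longleftrightarrow> continuous_on U F \<and>
     (\<forall>(V, c)\<in>A. smooth_fun A (U \<inter> F -` V) (c \<circ> F))"

definition diffeo_onto_image ::
    "('m::topological_space, 'n::finite) chart set \<Rightarrow> 'm set \<Rightarrow> ('m \<Rightarrow> 'm) \<Rightarrow> bool" where
  "diffeo_onto_image A U F \<longleftrightarrow> open U \<and> open (F ` U) \<and> inj_on F U \<and>
     smooth_map A U F \<and> smooth_map A (F ` U) (inv_into U F)"

definition smooth_coords :: "('m::topological_space, 'n::finite) chart set \<Rightarrow> 'm set \<Rightarrow>
    ('m \<Rightarrow> 'e::euclidean_space) \<Rightarrow> bool" where
  "smooth_coords A U F \<longleftrightarrow> open U \<and> open (F ` U) \<and> homeomorphism U (F ` U) F (inv_into U F) \<and>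
     smooth_fun A U F \<and> (\<forall>(V, c)\<in>A. smooth_on (c \<circ> inv_into U F) (F ` (U \<inter> V)))"

definition holo_coords :: "('m::topological_space, 'n::finite) chart set \<Rightarrow> 'm set \<Rightarrow>
    ('m \<Rightarrow> complex ^ 'n) \<Rightarrow> bool" where
  "holo_coords A U z \<longleftrightarrow> open U \<and> open (z ` U) \<and> homeomorphism U (z ` U) z (inv_into U z) \<and>
     holo_fun A Jn U z \<and> (\<forall>(V, c)\<in>A. holo_on Jn Jn (c \<circ> inv_into U z) (z ` (U \<inter> V)))"


section \<open>Vector fields, connections and two-forms\<close>

text \<open>Local objects on an open set \<open>U\<close> are total functions whose values off \<open>U\<close> are irrelevant.\<close>

definition smooth_vf :: "('m, 'n::finite) chart set \<Rightarrow> 'm set \<Rightarrow> ('m \<Rightarrow> complex ^ 'n) \<Rightarrow> bool" where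
  "smooth_vf A U X \<longleftrightarrow> (\<forall>(V, c)\<in>A. smooth_fun A (U \<inter> V) (\<lambda>q. tdiff A c q (X q)))"

text \<open>The usual coordinate formula, evaluated in the chart selected at \<open>p\<close>.\<close>

definition lie_bracket :: "('m, 'n::finite) chart set \<Rightarrow> ('m \<Rightarrow> complex ^ 'n) \<Rightarrow>
    ('m \<Rightarrow> complex ^ 'n) \<Rightarrow> 'm \<Rightarrow> complex ^ 'n" where
  "lie_bracket A X Y p = (let c = snd (chart_at A p) in
     tdiff A (\<lambda>q. tdiff A c q (Y q)) p (X p) - tdiff A (\<lambda>q. tdiff A c q (X q)) p (Y p))"

text \<open>\<open>D p v Y\<close> is the covariant derivative at \<open>p\<close> of a vector field \<open>Y\<close>, smooth near \<open>p\<close>, in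
  direction \<open>v\<close>. The last clause fixes the junk value off this domain, so that equality of
  connections is equality of functions.\<close>

type_synonym ('m, 'n) conn =
  "'m \<Rightarrow> complex ^ 'n \<Rightarrow> ('m \<Rightarrow> complex ^ 'n) \<Rightarrow> complex ^ 'n"

definition connection ::
    "('m::topological_space, 'n::finite) chart set \<Rightarrow> ('m, 'n) conn \<Rightarrow> bool" where
  "connection A D \<longleftrightarrow>
     (\<forall>U Y. open U \<and> smooth_vf A U Y \<longrightarrow>
        (\<forall>p\<in>U. linear (\<lambda>v. D p v Y)) \<and>
        (\<forall>Z. smooth_vf A U Z \<longrightarrow> (\<forall>p\<in>U. \<forall>v. D p v (\<lambda>q. Y q + Z q) = D p v Y + D p v Z)) \<and>
        (\<forall>f :: 'm \<Rightarrow> real. smooth_fun A U f \<longrightarrow>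
           (\<forall>p\<in>U. \<forall>v. D p v (\<lambda>q. f q *\<^sub>R Y q) = tdiff A f p v *\<^sub>R Y p + f p *\<^sub>R D p v Y)) \<and>
        (\<forall>Z. (\<forall>q\<in>U. Z q = Y q) \<longrightarrow> (\<forall>p\<in>U. \<forall>v. D p v Z = D p v Y)) \<and>
        (\<forall>X. smooth_vf A U X \<longrightarrow> smooth_vf A U (\<lambda>p. D p (X p) Y))) \<and>
     (\<forall>p v Y. (\<nexists>U. open U \<and> p \<in> U \<and> smooth_vf A U Y) \<longrightarrow> D p v Y = 0)"

definition torsion_free ::
    "('m::topological_space, 'n::finite) chart set \<Rightarrow> ('m, 'n) conn \<Rightarrow> bool" where
  "torsion_free A D \<longleftrightarrow> (\<forall>U X Y. open U \<and> smooth_vf A U X \<and> smooth_vf A U Y \<longrightarrow>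
     (\<forall>p\<in>U. D p (X p) Y - D p (Y p) X = lie_bracket A X Y p))"

definition flat ::
    "('m::topological_space, 'n::finite) chart set \<Rightarrow> ('m, 'n) conn \<Rightarrow> bool" where
  "flat A D \<longleftrightarrow>
     (\<forall>U X Y Z. open U \<and> smooth_vf A U X \<and> smooth_vf A U Y \<and> smooth_vf A U Z \<longrightarrow>
       (\<forall>p\<in>U. D p (X p) (\<lambda>q. D q (Y q) Z) - D p (Y p) (\<lambda>q. D q (X q) Z)
          - D p (lie_bracket A X Y p) Z = 0))"

definition flat_torsion_free_connection ::
    "('m::topological_space, 'n::finite) chart set \<Rightarrow> ('m, 'n) conn \<Rightarrow> bool" where
  "flat_torsion_free_connection A D \<longleftrightarrow> connection A D \<and> flat A D \<and> torsion_free A D"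

definition parallel_vf :: "('m::topological_space, 'n::finite) chart set \<Rightarrow> ('m, 'n) conn \<Rightarrow>
    'm set \<Rightarrow> ('m \<Rightarrow> complex ^ 'n) \<Rightarrow> bool" where
  "parallel_vf A D U X \<longleftrightarrow> smooth_vf A U X \<and> (\<forall>p\<in>U. \<forall>v. D p v X = 0)"

text \<open>\<open>\<nabla>df = 0\<close>, where \<open>(\<nabla>\<^sub>v df)(Y) = v(df(Y)) - df(\<nabla>\<^sub>v Y)\<close>.\<close>

definition affine_fun :: "('m::topological_space, 'n::finite) chart set \<Rightarrow> ('m, 'n) conn \<Rightarrow>
    'm set \<Rightarrow> ('m \<Rightarrow> real) \<Rightarrow> bool" where
  "affine_fun A D U f \<longleftrightarrow> smooth_fun A U f \<and>
     (\<forall>V Y. open V \<and> V \<subseteq> U \<and> smooth_vf A V Y \<longrightarrow>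
       (\<forall>p\<in>V. \<forall>v. tdiff A (\<lambda>q. tdiff A f q (Y q)) p v - tdiff A f p (D p v Y) = 0))"

type_synonym ('m, 'n) form2 = "'m \<Rightarrow> complex ^ 'n \<Rightarrow> complex ^ 'n \<Rightarrow> real"

definition smooth_2form ::
    "('m::topological_space, 'n::finite) chart set \<Rightarrow> ('m, 'n) form2 \<Rightarrow> bool" where
  "smooth_2form A \<omega> \<longleftrightarrow> (\<forall>p. bilinear (\<omega> p) \<and> (\<forall>u. \<omega> p u u = 0)) \<and>
     (\<forall>U X Y. open U \<and> smooth_vf A U X \<and> smooth_vf A U Y \<longrightarrow>
        smooth_fun A U (\<lambda>q. \<omega> q (X q) (Y q)))"

definition closed_2form ::
    "('m::topological_space, 'n::finite) chart set \<Rightarrow> ('m, 'n) form2 \<Rightarrow> bool" where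
  "closed_2form A \<omega> \<longleftrightarrow>
     (\<forall>U X Y Z. open U \<and> smooth_vf A U X \<and> smooth_vf A U Y \<and> smooth_vf A U Z \<longrightarrow>
       (\<forall>p\<in>U. tdiff A (\<lambda>q. \<omega> q (Y q) (Z q)) p (X p)
            + tdiff A (\<lambda>q. \<omega> q (Z q) (X q)) p (Y p)
            + tdiff A (\<lambda>q. \<omega> q (X q) (Y q)) p (Z p)
            - \<omega> p (lie_bracket A X Y p) (Z p)
            - \<omega> p (lie_bracket A Y Z p) (X p)
            - \<omega> p (lie_bracket A Z X p) (Y p) = 0))"

definition symplectic_form ::
    "('m::topological_space, 'n::finite) chart set \<Rightarrow> ('m, 'n) form2 \<Rightarrow> bool" where
  "symplectic_form A \<omega> \<longleftrightarrow> smooth_2form A \<omega> \<and> closed_2form A \<omega> \<and>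
     (\<forall>p u. (\<forall>v. \<omega> p u v = 0) \<longrightarrow> u = 0)"

definition parallel_2form :: "('m::topological_space, 'n::finite) chart set \<Rightarrow> ('m, 'n) conn \<Rightarrow>
    ('m, 'n) form2 \<Rightarrow> bool" where
  "parallel_2form A D \<omega> \<longleftrightarrow>
     (\<forall>U Y Z. open U \<and> smooth_vf A U Y \<and> smooth_vf A U Z \<longrightarrow>
       (\<forall>p\<in>U. \<forall>v. tdiff A (\<lambda>q. \<omega> q (Y q) (Z q)) p v
          - \<omega> p (D p v Y) (Z p) - \<omega> p (Y p) (D p v Z) = 0))"


section \<open>Conic manifolds\<close>

text \<open>An action consists of its domain \<open>W\<close> and the map \<open>\<Phi>\<close>, irrelevant off \<open>W\<close>.\<close>

definition local_action :: "('m::topological_space, 'n::finite) chart set \<Rightarrow>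
    (complex \<times> 'm) set \<Rightarrow> (complex \<Rightarrow> 'm \<Rightarrow> 'm) \<Rightarrow> bool" where
  "local_action A W \<Phi> \<longleftrightarrow>
     open W \<and> {1} \<times> UNIV \<subseteq> W \<and> W \<subseteq> (- {0}) \<times> UNIV \<and>
     continuous_on W (\<lambda>(\<kappa>, p). \<Phi> \<kappa> p) \<and>
     (\<forall>(U, c)\<in>A. \<forall>(V, d)\<in>A. holo_on JCn Jn (\<lambda>(\<kappa>, x). d (\<Phi> \<kappa> (inv_into U c x)))
        {(\<kappa>, c p) |\<kappa> p. (\<kappa>, p) \<in> W \<and> p \<in> U \<and> \<Phi> \<kappa> p \<in> V}) \<and>
     (\<forall>p. \<Phi> 1 p = p) \<and>
     (\<forall>\<kappa> \<mu> p. (\<mu>, p) \<in> W \<and> (\<kappa>, \<Phi> \<mu> p) \<in> W \<and> (\<kappa> * \<mu>, p) \<in> W \<longrightarrow> \<Phi> \<kappa> (\<Phi> \<mu> p) = \<Phi> (\<kappa> * \<mu>) p)"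

text \<open>Open sets on which \<open>\<Phi> \<kappa>\<close> is defined and is a diffeomorphism onto its image.\<close>

definition action_domain :: "('m::topological_space, 'n::finite) chart set \<Rightarrow>
    (complex \<times> 'm) set \<Rightarrow> (complex \<Rightarrow> 'm \<Rightarrow> 'm) \<Rightarrow> complex \<Rightarrow> 'm set \<Rightarrow> bool" where
  "action_domain A W \<Phi> \<kappa> U \<longleftrightarrow> {\<kappa>} \<times> U \<subseteq> W \<and> diffeo_onto_image A U (\<Phi> \<kappa>)"

text \<open>A local parallel field \<open>X\<close> is taken on a connected open set \<open>V\<close>, which has to contain both
  points at which \<open>X\<close> is evaluated: on a disconnected \<open>V\<close> the values of \<open>X\<close> at \<open>p\<close> and at
  \<open>\<Phi> \<kappa> p\<close> could be unrelated.\<close>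

definition conic_action :: "('m::topological_space, 'n::finite) chart set \<Rightarrow> ('m, 'n) conn \<Rightarrow>
    (complex \<times> 'm) set \<Rightarrow> (complex \<Rightarrow> 'm \<Rightarrow> 'm) \<Rightarrow> bool" where
  "conic_action A D W \<Phi> \<longleftrightarrow> local_action A W \<Phi> \<and>
     (\<forall>r \<theta> U V X. r > 0 \<and> action_domain A W \<Phi> (rcis r \<theta>) U \<and>
        open V \<and> connected V \<and> U \<subseteq> V \<and> \<Phi> (rcis r \<theta>) ` U \<subseteq> V \<and> parallel_vf A D V X \<longrightarrow>
        (\<forall>p\<in>U. let q = \<Phi> (rcis r \<theta>) p in
           tmap A (\<Phi> (rcis r \<theta>)) p (X p) =
             (r * cos \<theta>) *\<^sub>R X q + (r * sin \<theta>) *\<^sub>R Jn (X q)))"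

definition conic_complex_manifold ::
    "('m::{t2_space,second_countable_topology}, 'n::finite) chart set \<Rightarrow> ('m, 'n) conn \<Rightarrow> bool" where
  "conic_complex_manifold A D \<longleftrightarrow>
     complex_atlas A \<and> flat_torsion_free_connection A D \<and> (\<exists>W \<Phi>. conic_action A D W \<Phi>)"

definition conic_kaehler_manifold ::
    "('m::{t2_space,second_countable_topology}, 'n::finite) chart set \<Rightarrow> ('m, 'n) conn \<Rightarrow>
     ('m, 'n) form2 \<Rightarrow> bool" where
  "conic_kaehler_manifold A D \<omega> \<longleftrightarrow> conic_complex_manifold A D \<and>
     symplectic_form A \<omega> \<and> parallel_2form A D \<omega> \<and> (\<forall>p u v. \<omega> p (Jn u) (Jn v) = \<omega> p u v)"


section \<open>Special coordinates\<close>

definition Re_vec :: "complex ^ 'n \<Rightarrow> real ^ 'n" where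
  "Re_vec v = (\<chi> i. Re (v $ i))"

definition real_special_coords :: "('m::topological_space, 'n::finite) chart set \<Rightarrow> ('m, 'n) conn \<Rightarrow>
    ('m, 'n) form2 \<Rightarrow> 'm set \<Rightarrow> ('m \<Rightarrow> real ^ 'n) \<Rightarrow> ('m \<Rightarrow> real ^ 'n) \<Rightarrow> bool" where
  "real_special_coords A D \<omega> U x y \<longleftrightarrow>
     smooth_coords A U (\<lambda>q. (x q, y q)) \<and>
     (\<forall>i. affine_fun A D U (\<lambda>q. x q $ i) \<and> affine_fun A D U (\<lambda>q. y q $ i)) \<and>
     (\<forall>p\<in>U. \<forall>u v. \<omega> p u v = 2 * (\<Sum>i\<in>UNIV.
        tdiff A (\<lambda>q. x q $ i) p u * tdiff A (\<lambda>q. y q $ i) p v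
        - tdiff A (\<lambda>q. x q $ i) p v * tdiff A (\<lambda>q. y q $ i) p u))"

text \<open>The requirements on a conjugate pair apart from \<open>z\<close> and \<open>w\<close> each being a coordinate system.\<close>

definition special_holo_functions :: "('m::topological_space, 'n::finite) chart set \<Rightarrow>
    ('m, 'n) conn \<Rightarrow> ('m, 'n) form2 \<Rightarrow> 'm set \<Rightarrow>
    ('m \<Rightarrow> complex ^ 'n) \<Rightarrow> ('m \<Rightarrow> complex ^ 'n) \<Rightarrow> bool" where
  "special_holo_functions A D \<omega> U z w \<longleftrightarrow> holo_fun A Jn U z \<and> holo_fun A Jn U w \<and>
     real_special_coords A D \<omega> U (Re_vec \<circ> z) (Re_vec \<circ> w)"

definition conjugate_pair :: "('m::topological_space, 'n::finite) chart set \<Rightarrow>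
    ('m, 'n) conn \<Rightarrow> ('m, 'n) form2 \<Rightarrow> 'm set \<Rightarrow>
    ('m \<Rightarrow> complex ^ 'n) \<Rightarrow> ('m \<Rightarrow> complex ^ 'n) \<Rightarrow> bool" where
  "conjugate_pair A D \<omega> U z w \<longleftrightarrow> holo_coords A U z \<and> holo_coords A U w \<and>
     real_special_coords A D \<omega> U (Re_vec \<circ> z) (Re_vec \<circ> w)"

definition conic_pair :: "('m::topological_space, 'n::finite) chart set \<Rightarrow>
    (complex \<times> 'm) set \<Rightarrow> (complex \<Rightarrow> 'm \<Rightarrow> 'm) \<Rightarrow> 'm set \<Rightarrow>
    ('m \<Rightarrow> complex ^ 'n) \<Rightarrow> ('m \<Rightarrow> complex ^ 'n) \<Rightarrow> bool" where
  "conic_pair A W \<Phi> U z w \<longleftrightarrow>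
     (\<forall>\<kappa> U'. U' \<subseteq> U \<and> action_domain A W \<Phi> \<kappa> U' \<and> \<Phi> \<kappa> ` U' \<subseteq> U \<longrightarrow>
       (\<forall>q\<in>U'. z (\<Phi> \<kappa> q) = \<kappa> *s z q \<and> w (\<Phi> \<kappa> q) = \<kappa> *s w q))"


section \<open>Immersions into the cotangent bundle of complex n-space\<close>

text \<open>The first component of \<open>V\<close> carries the coordinates \<open>z\<close>, the second one \<open>w\<close>.\<close>

type_synonym 'n V = "(complex ^ 'n) \<times> (complex ^ 'n)"

definition scaleV :: "complex \<Rightarrow> 'n::finite V \<Rightarrow> 'n V" where
  "scaleV \<kappa> = map_prod ((*s) \<kappa>) ((*s) \<kappa>)"

definition Omega :: "'n::finite V \<Rightarrow> 'n V \<Rightarrow> complex" where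
  "Omega a b = (\<Sum>i\<in>UNIV. fst a $ i * snd b $ i - fst b $ i * snd a $ i)"

definition tau :: "'n::finite V \<Rightarrow> 'n V" where
  "tau = map_prod (\<lambda>v. \<chi> i. cnj (v $ i)) (\<lambda>v. \<chi> i. cnj (v $ i))"

definition gam :: "'n::finite V \<Rightarrow> 'n V \<Rightarrow> complex" where
  "gam a b = \<i> * Omega a (tau b)"

text \<open>\<open>2 \<Sum> dx\<^sup>i \<and> dy\<^sub>i\<close> on \<open>V\<close>, where \<open>x\<close>, \<open>y\<close> are the real parts of the canonical coordinates.\<close>

definition omegaV :: "'n::finite V \<Rightarrow> 'n V \<Rightarrow> real" where
  "omegaV a b = 2 * (\<Sum>i\<in>UNIV. Re (fst a $ i) * Re (snd b $ i) - Re (fst b $ i) * Re (snd a $ i))"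

definition holomorphic_immersion ::
    "('m::topological_space, 'n::finite) chart set \<Rightarrow> ('m \<Rightarrow> 'n V) \<Rightarrow> bool" where
  "holomorphic_immersion A \<phi> \<longleftrightarrow> holo_fun A (scaleV \<i>) UNIV \<phi> \<and> (\<forall>p. inj (tdiff A \<phi> p))"

definition nondegenerate :: "('m, 'n::finite) chart set \<Rightarrow> ('m \<Rightarrow> 'n V) \<Rightarrow> bool" where
  "nondegenerate A \<phi> \<longleftrightarrow>
     (\<forall>p u. (\<forall>v. gam (tdiff A \<phi> p u) (tdiff A \<phi> p v) = 0) \<longrightarrow> u = 0)"

definition lagrangian :: "('m, 'n::finite) chart set \<Rightarrow> ('m \<Rightarrow> 'n V) \<Rightarrow> bool" where
  "lagrangian A \<phi> \<longleftrightarrow> (\<forall>p u v. Omega (tdiff A \<phi> p u) (tdiff A \<phi> p v) = 0)"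

definition totally_complex :: "('m, 'n::finite) chart set \<Rightarrow> ('m \<Rightarrow> 'n V) \<Rightarrow> bool" where
  "totally_complex A \<phi> \<longleftrightarrow> (\<forall>p. {a. tau a = a} \<inter> range (tdiff A \<phi> p) = {0})"

definition conic_immersion :: "('m::topological_space \<Rightarrow> 'n::finite V) \<Rightarrow> bool" where
  "conic_immersion \<phi> \<longleftrightarrow> (\<forall>p U. open U \<and> p \<in> U \<longrightarrow>
     (\<exists>U1 Up. open U1 \<and> 1 \<in> U1 \<and> 0 \<notin> U1 \<and> open Up \<and> p \<in> Up \<and>
        (\<forall>\<kappa>\<in>U1. scaleV \<kappa> ` \<phi> ` Up \<subseteq> \<phi> ` U)))"

definition induced_metric :: "('m, 'n::finite) chart set \<Rightarrow> ('m \<Rightarrow> 'n V) \<Rightarrow>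
    'm \<Rightarrow> complex ^ 'n \<Rightarrow> complex ^ 'n \<Rightarrow> real" where
  "induced_metric A \<phi> p u v = Re (gam (tdiff A \<phi> p u) (tdiff A \<phi> p v))"

definition induced_form :: "('m, 'n::finite) chart set \<Rightarrow> ('m \<Rightarrow> 'n V) \<Rightarrow> ('m, 'n) form2" where
  "induced_form A \<phi> p u v = omegaV (tdiff A \<phi> p u) (tdiff A \<phi> p v)"

definition is_induced_connection :: "('m::topological_space, 'n::finite) chart set \<Rightarrow>
    ('m \<Rightarrow> 'n V) \<Rightarrow> ('m, 'n) conn \<Rightarrow> bool" where
  "is_induced_connection A \<phi> D \<longleftrightarrow> flat_torsion_free_connection A D \<and>
     (\<forall>i. affine_fun A D UNIV (\<lambda>p. Re (fst (\<phi> p) $ i)) \<and>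
          affine_fun A D UNIV (\<lambda>p. Re (snd (\<phi> p) $ i)))"

definition induced_connection :: "('m::topological_space, 'n::finite) chart set \<Rightarrow>
    ('m \<Rightarrow> 'n V) \<Rightarrow> ('m, 'n) conn" where
  "induced_connection A \<phi> = (THE D. is_induced_connection A \<phi> D)"

text \<open>For indefinite \<open>g\<close> the pull backs of \<open>z\<close> and \<open>w\<close> need not be coordinate systems, even though
  their real parts together are: for the linear Lagrangian \<open>\<phi>(s,t) = (z,w) = ((t,\<i>t),(s,\<i>s))\<close> in
  complex dimension 2, \<open>\<phi>\<^sup>*\<gamma>\<close> is nondegenerate of signature (1,1). The following condition on a point
  is satisfied in particular if \<open>g\<close> is definite there.\<close>

definition regular_point :: "('m, 'n::finite) chart set \<Rightarrow> ('m \<Rightarrow> 'n V) \<Rightarrow> 'm \<Rightarrow> bool" where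
  "regular_point A \<phi> p \<longleftrightarrow> inj (tdiff A (fst \<circ> \<phi>) p) \<and> inj (tdiff A (snd \<circ> \<phi>) p)"

definition definite_at :: "('m, 'n::finite) chart set \<Rightarrow> ('m \<Rightarrow> 'n V) \<Rightarrow> 'm \<Rightarrow> bool" where
  "definite_at A \<phi> p \<longleftrightarrow> (\<forall>u. u \<noteq> 0 \<longrightarrow> induced_metric A \<phi> p u u > 0) \<or>
     (\<forall>u. u \<noteq> 0 \<longrightarrow> induced_metric A \<phi> p u u < 0)"

end

theory Submission
  imports Defs
begin

text \<open>Let \<open>F = (Re z, Re w) \<circ> \<phi>\<close>. If \<open>d\<phi> u\<close> is real then the Lagrangian condition gives
  \<open>\<gamma>(d\<phi> u, d\<phi> v) = \<i> * cnj (\<Omega> (d\<phi> u, d\<phi> v)) = 0\<close> for all \<open>v\<close>, hence \<open>u = 0\<close>; so \<open>\<phi>\<close> is totally complex and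
  \<open>F\<close> is a local diffeomorphism into \<open>\<real>\<^sup>2\<^sup>n\<close>. The frame \<open>dF\<close> turns the induced connection into the trivial one,
  \<open>dF (\<nabla>\<^sub>v Y) = d (dF Y) v\<close>, and \<open>\<omega>\<close> into a constant form. The action lifts \<open>\<kappa> \<mapsto> \<kappa> \<phi>(p)\<close> through \<open>\<phi>\<close>,
  for \<open>\<kappa>\<close> in a disc around \<open>1\<close> that is uniform for \<open>p\<close> in a small open set; convexity of the discs and
  uniqueness of lifts along segments give well-definedness and the group law.\<close>

section \<open>Calculus in Euclidean spaces\<close>

text \<open>Conicity speaks of images only: \<kappa>\<phi>(q) lies in the image of a given
  neighbourhood, but \<phi> may fail to be injective on M, so no point of M over \<kappa>\<phi>(q)
  is singled out. The point is picked inside a set \<open>U\<close> on which F is injective, and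
  picks made in different \<open>U\<close> have to be compared; this is why discs in \<kappa>
  centred at 1 and paths starting at 1 appear. F is inverted instead of \<phi> because F is a map
  between spaces of equal real dimension, so that the inverse function theorem applies. The price is
  an action that is at first only real smooth; holomorphy is recovered by differentiating \<phi>(act
  \<kappa> q) = \<kappa>\<phi>(q) and cancelling d\<phi>, which is injective and complex linear.
  Identities for the connection are proved after applying dF, where covariant derivatives become
  ordinary derivatives of vector-valued functions; flatness, vanishing torsion and closedness of
  \<omega> then all rest on the symmetry of second derivatives, in the guise of [X,Y]H = X(YH) -
  Y(XH).\<close>

abbreviation fd :: "('a::real_normed_vector \<Rightarrow> 'b::real_normed_vector) \<Rightarrow> 'a \<Rightarrow> 'a \<Rightarrow> 'b" where
  "fd f x \<equiv> frechet_derivative f (at x)"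

lemma fd_works: "f differentiable (at x) \<Longrightarrow> (f has_derivative fd f x) (at x)"
  using frechet_derivative_works by blast

lemma fd_eq: "(f has_derivative f') (at x) \<Longrightarrow> fd f x = f'"
  using frechet_derivative_at by metis

lemma fd_cong:
  assumes "open S" "x \<in> S" "\<And>y. y \<in> S \<Longrightarrow> f y = g y"
  shows "fd f x = fd g x"
proof -
  \<comment> \<open>\<open>frechet_derivative\<close> is a choice from the set of all derivatives.
    That set is the same for \<open>f\<close> and \<open>g\<close>, which settles the
    non-differentiable case as well.\<close>
  have "(f has_derivative f') (at x) \<longleftrightarrow> (g has_derivative f') (at x)" for f'
    using assms has_derivative_transform_within_open[of f f' x UNIV S g]
      has_derivative_transform_within_open[of g f' x UNIV S f] by auto
  then show ?thesis unfolding frechet_derivative_def by simp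
qed

lemma differentiable_cong_open:
  assumes "open S" "x \<in> S" "\<And>y. y \<in> S \<Longrightarrow> f y = g y" "f differentiable (at x)"
  shows "g differentiable (at x)"
  using assms unfolding differentiable_def
  by (metis has_derivative_transform_within_open)

section \<open>Closure properties of C^k maps\<close>

lemma Ck_on_subset: "Ck_on k f S \<Longrightarrow> T \<subseteq> S \<Longrightarrow> Ck_on k f T"
  by (induction k arbitrary: f) (auto intro: continuous_on_subset)

lemma Ck_on_cong:
  assumes "open S" "\<And>x. x \<in> S \<Longrightarrow> f x = g x" "Ck_on k f S"
  shows "Ck_on k g S"
  using assms(2,3)
proof (induction k arbitrary: f g)
  case 0
  then show ?case using continuous_on_cong[of S S f g] by simp
next
  case (Suc k)
  have "Ck_on k (\<lambda>x. fd g x v) S" for v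
  proof (rule Suc.IH[of "\<lambda>x. fd f x v"])
    show "fd f x v = fd g x v" if "x \<in> S" for x
      using fd_cong[OF assms(1) that, of f g] Suc.prems(1) by simp
    show "Ck_on k (\<lambda>x. fd f x v) S" using Suc.prems by simp
  qed
  then show ?case
    using Suc.prems differentiable_cong_open[OF assms(1)] by (metis Ck_on.simps(2))
qed

lemma Ck_on_local:
  assumes "\<And>x. x \<in> S \<Longrightarrow> \<exists>T. open T \<and> x \<in> T \<and> Ck_on k f T"
  shows "Ck_on k f S"
  using assms
proof (induction k arbitrary: f)
  case 0
  have "isCont f x" if "x \<in> S" for x
    using 0[OF that] continuous_on_eq_continuous_at by auto
  then show ?case by (simp add: continuous_at_imp_continuous_on)
next
  case (Suc k)
  have "\<exists>T. open T \<and> x \<in> T \<and> Ck_on k (\<lambda>x. fd f x v) T" if "x \<in> S" for x v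
    using Suc.prems[OF that] by auto
  then have "Ck_on k (\<lambda>x. fd f x v) S" for v using Suc.IH by blast
  moreover have "f differentiable (at x)" if "x \<in> S" for x
    using Suc.prems[OF that] by auto
  ultimately show ?case by simp
qed

lemma Ck_on_continuous: "Ck_on k f S \<Longrightarrow> continuous_on S f"
  by (cases k) (auto simp: differentiable_imp_continuous_within continuous_at_imp_continuous_on)

lemma Ck_on_SucD: "Ck_on (Suc k) f S \<Longrightarrow> Ck_on k f S"
proof (induction k arbitrary: f)
  case 0
  then show ?case using Ck_on_continuous[of "Suc 0" f S] by simp
next
  case (Suc k)
  then show ?case by (metis Ck_on.simps(2))
qed

text \<open>The inductive step of the closure properties below: any explicit formula for the
  derivative is accepted, so that the induction hypothesis can be applied to that formula instead of
  to \<open>frechet_derivative\<close>.\<close>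

lemma Ck_on_SucI:
  assumes "open S" "\<And>x. x \<in> S \<Longrightarrow> (f has_derivative D x) (at x)" "\<And>v. Ck_on k (\<lambda>x. D x v) S"
  shows "Ck_on (Suc k) f S"
proof -
  have "Ck_on k (\<lambda>x. fd f x v) S" for v
    by (rule Ck_on_cong[OF assms(1) _ assms(3)[of v]]) (use fd_eq[OF assms(2)] in metis)
  then show ?thesis
    unfolding Ck_on.simps(2) using assms(2) differentiableI by blast
qed

lemma Ck_on_const: "Ck_on k (\<lambda>x. c) S"
proof (induction k arbitrary: c)
  case (Suc k)
  then show ?case by simp
qed simp

lemma Ck_on_linear_compose:
  assumes "linear L" "open S" "Ck_on k f S"
  shows "Ck_on k (\<lambda>x. L (f x)) S"
  using assms(3)
proof (induction k arbitrary: f)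
  case 0
  then show ?case
    using assms(1) by (simp add: linear_continuous_on_compose)
next
  case (Suc k)
  have d: "((\<lambda>x. L (f x)) has_derivative (\<lambda>v. L (fd f x v))) (at x)" if "x \<in> S" for x
    using Suc.prems that assms(1) by (intro bounded_linear.has_derivative[of L] fd_works)
      (auto simp: linear_conv_bounded_linear)
  show ?case using Suc by (intro Ck_on_SucI[OF assms(2) d]) auto
qed

lemma Ck_on_add:
  assumes "open S" "Ck_on k f S" "Ck_on k g S"
  shows "Ck_on k (\<lambda>x. f x + g x) S"
  using assms(2,3)
proof (induction k arbitrary: f g)
  case 0
  then show ?case by (simp add: continuous_on_add)
next
  case (Suc k)
  have d: "((\<lambda>x. f x + g x) has_derivative (\<lambda>v. fd f x v + fd g x v)) (at x)" if "x \<in> S" for x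
    using Suc.prems that by (intro has_derivative_add fd_works) auto
  show ?case using Suc by (intro Ck_on_SucI[OF assms(1) d]) auto
qed

lemma Ck_on_sum:
  assumes "open S" "\<And>i. i \<in> I \<Longrightarrow> Ck_on k (f i) S"
  shows "Ck_on k (\<lambda>x. \<Sum>i\<in>I. f i x) S"
  using assms(2)
  by (induction I rule: infinite_finite_induct)
    (auto simp: Ck_on_const intro!: Ck_on_add[OF assms(1)])

lemma Ck_on_bilinear:
  assumes "bounded_bilinear h" "open S" "Ck_on k f S" "Ck_on k g S"
  shows "Ck_on k (\<lambda>x. h (f x) (g x)) S"
  using assms(3,4)
proof (induction k arbitrary: f g)
  case 0
  then show ?case using bounded_bilinear.continuous_on[OF assms(1)] by simp
next
  case (Suc k)
  have d: "((\<lambda>x. h (f x) (g x)) has_derivative (\<lambda>v. h (f x) (fd g x v) + h (fd f x v) (g x))) (at x)"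
    if "x \<in> S" for x
    using Suc.prems that by (intro bounded_bilinear.FDERIV[OF assms(1)] fd_works) auto
  show ?case
    using Suc.prems Ck_on_SucD[OF Suc.prems(1)] Ck_on_SucD[OF Suc.prems(2)]
    by (intro Ck_on_SucI[OF assms(2) d] Ck_on_add[OF assms(2)] Suc.IH) auto
qed

lemma linear_basis_expansion:
  fixes L :: "'a::euclidean_space \<Rightarrow> 'b::real_vector"
  assumes "linear L"
  shows "L u = (\<Sum>b\<in>Basis. (u \<bullet> b) *\<^sub>R L b)"
proof -
  have "L u = L (\<Sum>b\<in>Basis. (u \<bullet> b) *\<^sub>R b)" by (simp add: euclidean_representation)
  then show ?thesis using assms by (simp add: linear_sum linear_scale)
qed

text \<open>Regularity of a family of linear maps is known only for each fixed argument. Expanding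
  the varying argument in the basis turns \<open>B x (h x)\<close> into a finite sum of
  products.\<close>

lemma Ck_on_linear_family:
  fixes B :: "'c::euclidean_space \<Rightarrow> 'a::euclidean_space \<Rightarrow> 'b::euclidean_space"
  assumes "open S" "\<And>x. x \<in> S \<Longrightarrow> linear (B x)" "\<And>b. Ck_on k (\<lambda>x. B x b) S" "Ck_on k h S"
  shows "Ck_on k (\<lambda>x. B x (h x)) S"
proof (rule Ck_on_cong[OF assms(1), of "\<lambda>x. \<Sum>b\<in>Basis. (h x \<bullet> b) *\<^sub>R B x b"])
  show "Ck_on k (\<lambda>x. \<Sum>b\<in>Basis. (h x \<bullet> b) *\<^sub>R B x b) S"
    by (intro Ck_on_sum[OF assms(1)] Ck_on_bilinear[OF bounded_bilinear_scaleR assms(1)] assms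
       Ck_on_bilinear[OF bounded_bilinear_inner assms(1)] Ck_on_const)
qed (use linear_basis_expansion[OF assms(2)] in metis)

text \<open>By the chain rule the derivative is the linear family \<open>fd g (f x)\<close> applied
  to \<open>fd f x v\<close>; for a fixed argument that family is again a composition with
  \<open>f\<close>, covered by the induction hypothesis.\<close>

lemma Ck_on_compose:
  assumes "open S" "open T" "f ` S \<subseteq> T" "Ck_on k f S" "Ck_on k g T"
  shows "Ck_on k (g \<circ> f) S"
  using assms(4,5)
proof (induction k arbitrary: g)
  case 0
  then show ?case
    using assms(3) continuous_on_compose[of S f g] continuous_on_subset[of T g "f ` S"] by simp
next
  case (Suc k)
  have dg: "g differentiable (at (f x))" if "x \<in> S" for x
    using Suc.prems that assms(3) by auto
  have d: "(g \<circ> f has_derivative fd g (f x) \<circ> fd f x) (at x)" if "x \<in> S" for x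
    using Suc.prems(1) that dg[OF that] by (intro diff_chain_at fd_works) auto
  show ?case
  proof (rule Ck_on_SucI[OF assms(1) d])
    fix v
    have "Ck_on k ((\<lambda>y. fd g y b) \<circ> f) S" for b
      by (rule Suc.IH) (use Ck_on_SucD[OF Suc.prems(1)] Suc.prems(2) in simp_all)
    then have gb: "Ck_on k (\<lambda>x. fd g (f x) b) S" for b
      by (simp add: o_def)
    have "Ck_on k (\<lambda>x. fd f x v) S" using Suc.prems(1) by simp
    with gb have "Ck_on k (\<lambda>x. fd g (f x) (fd f x v)) S"
      using Ck_on_linear_family[of S "\<lambda>x. fd g (f x)"] assms(1) linear_frechet_derivative[OF dg] by blast
    then show "Ck_on k (\<lambda>x. (fd g (f x) \<circ> fd f x) v) S" by (simp add: o_def)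
  qed
qed

section \<open>Inverses of families of linear maps\<close>

text \<open>An injective linear map is bounded below by some \<open>m\<close>, and a perturbation of
  operator norm less than \<open>m / 2\<close> keeps half of that bound.\<close>

lemma linear_inverse_family_bounded:
  fixes A :: "'c::t2_space \<Rightarrow> 'a::euclidean_space \<Rightarrow> 'b::euclidean_space"
  assumes S: "open S" "x0 \<in> S" and lin: "\<And>x. x \<in> S \<Longrightarrow> linear (A x)"
    and cont: "\<And>u. continuous (at x0) (\<lambda>x. A x u)" and inj: "inj (A x0)"
  shows "\<exists>C>0. eventually (\<lambda>x. \<forall>u. norm u \<le> C * norm (A x u)) (at x0)"
proof -
  obtain m where m: "m > 0" "\<And>u. m * norm u \<le> norm (A x0 u)"
    using linear_inj_bounded_below_pos[OF lin[OF S(2)] inj] by (metis mult.commute)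
  \<comment> \<open>This finite sum dominates the operator norm of \<open>A x - A x0\<close>, and
    pointwise continuity makes it tend to 0.\<close>
  define e where "e x = (\<Sum>b\<in>Basis. norm (A x b - A x0 b))" for x
  have "((\<lambda>x. norm (A x b - A x0 b)) \<longlongrightarrow> 0) (at x0)" for b
    using cont[of b] by (simp add: continuous_at LIM_zero tendsto_norm_zero)
  then have "(e \<longlongrightarrow> 0) (at x0)"
    unfolding e_def by (intro tendsto_null_sum) auto
  then have ev: "eventually (\<lambda>x. e x < m / 2) (at x0)"
    using m(1) by (intro order_tendstoD(2)) auto
  have evS: "eventually (\<lambda>x. x \<in> S) (at x0)"
    using S by (rule eventually_at_in_open')
  have diff: "norm (A x u - A x0 u) \<le> e x * norm u" if "x \<in> S" for x u
  proof -
    have "A x u - A x0 u = (\<Sum>b\<in>Basis. (u \<bullet> b) *\<^sub>R (A x b - A x0 b))"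
      unfolding scaleR_right_diff_distrib sum_subtractf
      using linear_basis_expansion[OF lin[OF that], of u]
        linear_basis_expansion[OF lin[OF S(2)], of u] by simp
    also have "norm \<dots> \<le> (\<Sum>b\<in>Basis. norm (A x b - A x0 b) * norm u)"
    proof (rule sum_norm_le)
      fix b :: 'a assume "b \<in> Basis"
      then have "\<bar>u \<bullet> b\<bar> * norm (A x b - A x0 b) \<le> norm u * norm (A x b - A x0 b)"
        by (intro mult_right_mono Basis_le_norm) auto
      then show "norm ((u \<bullet> b) *\<^sub>R (A x b - A x0 b)) \<le> norm (A x b - A x0 b) * norm u"
        by (simp only: norm_scaleR mult.commute)
    qed
    finally show ?thesis by (simp add: e_def sum_distrib_right)
  qed
  have "norm u \<le> (2 / m) * norm (A x u)" if "e x < m / 2" "x \<in> S" for x u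
  proof -
    have "m * norm u \<le> norm (A x u) + norm (A x u - A x0 u)"
      using m(2)[of u] norm_triangle_ineq4[of "A x u" "A x u - A x0 u"] by simp
    also have "\<dots> \<le> norm (A x u) + (m / 2) * norm u"
      using diff[OF that(2), of u] that mult_right_mono[of "e x" "m / 2" "norm u"] by simp
    finally show ?thesis using m(1) by (simp add: field_simps)
  qed
  then show ?thesis using eventually_conj[OF ev evS] m(1)
    by (intro exI[of _ "2 / m"]) (auto elim: eventually_mono)
qed

text \<open>A product rule with one factor merely continuous: where \<open>k\<close> vanishes, a
  derivative of \<open>c\<close> would not contribute. It serves for inverses of linear maps before
  their differentiability is known.\<close>

lemma has_derivative_vanishing_scaleR:
  fixes k :: "'a::real_normed_vector \<Rightarrow> real" and c :: "'a \<Rightarrow> 'b::real_normed_vector"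
  assumes k: "(k has_derivative k') (at x)" "k x = 0" and c: "isCont c x"
  shows "((\<lambda>y. k y *\<^sub>R c y) has_derivative (\<lambda>v. k' v *\<^sub>R c x)) (at x)"
proof -
  interpret k': bounded_linear k' using k(1) by (rule has_derivative_bounded_linear)
  obtain K where K: "K > 0" "\<And>v. norm (k' v) \<le> norm v * K"
    using k'.pos_bounded by blast
  have "((\<lambda>y. k y *\<^sub>R (c y - c x)) has_derivative (\<lambda>v. 0)) (at x)"
    unfolding has_derivative_at_alt
  proof (intro conjI allI impI)
    fix e :: real assume e: "e > 0"
    \<comment> \<open>Tolerance 1 suffices here: with the bound \<open>K\<close> it gives |k y|
      \<le> (1 + K) |y - x|, whence the tolerance \<open>e / (1 + K)\<close> for
      \<open>c\<close>.\<close>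
    obtain d1 where d1: "d1 > 0" "\<And>y. norm (y - x) < d1 \<Longrightarrow> norm (k y - k' (y - x)) \<le> norm (y - x)"
      using k unfolding has_derivative_at_alt by (metis diff_zero mult_1 zero_less_one)
    obtain d2 where d2: "d2 > 0" "\<And>y. norm (y - x) < d2 \<Longrightarrow> norm (c y - c x) < e / (1 + K)"
      using c e K(1) unfolding isCont_def LIM_eq
      by (metis add_pos_pos divide_pos_pos norm_zero right_minus_eq zero_less_one)
    have "norm (k y *\<^sub>R (c y - c x)) \<le> e * norm (y - x)" if y: "norm (y - x) < min d1 d2" for y
    proof -
      have "norm (k y) \<le> norm (k y - k' (y - x)) + norm (k' (y - x))"
        using norm_triangle_ineq[of "k y - k' (y - x)" "k' (y - x)"] by simp
      also have "\<dots> \<le> (1 + K) * norm (y - x)"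
        using d1(2)[of y] K(2)[of "y - x"] y by (simp add: algebra_simps)
      finally have "norm (k y) * norm (c y - c x) \<le> ((1 + K) * norm (y - x)) * (e / (1 + K))"
        using d2(2)[of y] y K(1) by (intro mult_mono) auto
      also have "\<dots> = e * norm (y - x)" using K(1) by (simp add: field_simps)
      finally show ?thesis by simp
    qed
    then show "\<exists>d>0. \<forall>y. norm (y - x) < d \<longrightarrow>
        norm (k y *\<^sub>R (c y - c x) - k x *\<^sub>R (c x - c x) - 0) \<le> e * norm (y - x)"
      using d1(1) d2(1) by (intro exI[of _ "min d1 d2"]) auto
  qed simp
  moreover have "((\<lambda>y. k y *\<^sub>R c x) has_derivative (\<lambda>v. k' v *\<^sub>R c x)) (at x)"
    using k(1) by (intro derivative_eq_intros) auto
  ultimately have "((\<lambda>y. k y *\<^sub>R (c y - c x) + k y *\<^sub>R c x) has_derivative (\<lambda>v. 0 + k' v *\<^sub>R c x)) (at x)"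
    by (rule has_derivative_add)
  then show ?thesis by (simp add: algebra_simps)
qed

text \<open>Differentiating \<open>A x (B x w) = w\<close> gives \<open>d(B w) = - B (dA (B w))\<close>, which raises the order
  of differentiability of \<open>B\<close> by one.\<close>

lemma Ck_on_inverse_family:
  fixes A :: "'c::euclidean_space \<Rightarrow> 'a::euclidean_space \<Rightarrow> 'b::euclidean_space"
  assumes S: "open S" and linA: "\<And>x. x \<in> S \<Longrightarrow> linear (A x)" and linB: "\<And>x. x \<in> S \<Longrightarrow> linear (B x)"
    and BA: "\<And>x u. x \<in> S \<Longrightarrow> B x (A x u) = u" and AB: "\<And>x w. x \<in> S \<Longrightarrow> A x (B x w) = w"
    and A: "\<And>u. Ck_on k (\<lambda>x. A x u) S"
  shows "Ck_on k (\<lambda>x. B x w) S"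
proof -
  have cont: "isCont (\<lambda>x. B x w) x0" if x0: "x0 \<in> S" and cA: "\<And>u. isCont (\<lambda>x. A x u) x0" for x0 w
  proof -
    obtain C where C: "C > 0" "eventually (\<lambda>x. \<forall>u. norm u \<le> C * norm (A x u)) (at x0)"
      using linear_inverse_family_bounded[OF S x0 linA cA] BA[OF x0] by (metis injI)
    have "((\<lambda>x. A x (B x0 w) - A x0 (B x0 w)) \<longlongrightarrow> 0) (at x0)"
      using cA[of "B x0 w"] by (simp add: isCont_def LIM_zero)
    then have "((\<lambda>x. C * norm (A x (B x0 w) - A x0 (B x0 w))) \<longlongrightarrow> 0) (at x0)"
      by (intro tendsto_mult_right_zero tendsto_norm_zero)
    moreover have "eventually (\<lambda>x. norm (B x w - B x0 w) \<le> C * norm (A x (B x0 w) - A x0 (B x0 w))) (at x0)"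
      using C(2) eventually_at_in_open'[OF S x0]
    proof eventually_elim
      case (elim x)
      \<comment> \<open>The difference is estimated through its image under \<open>A x\<close>, to
        which the lower bound applies; that image involves only the fixed vector
        \<open>B x0 w\<close>.\<close>
      have "A x (B x w - B x0 w) = - (A x (B x0 w) - A x0 (B x0 w))"
        using elim(2) x0 by (simp add: linear_diff[OF linA] AB)
      then show ?case using elim(1)[rule_format, of "B x w - B x0 w"] by (metis norm_minus_cancel)
    qed
    ultimately have "((\<lambda>x. B x w - B x0 w) \<longlongrightarrow> 0) (at x0)"
      by (rule Lim_null_comparison[rotated])
    then show ?thesis by (simp add: isCont_def LIM_zero_cancel)
  qed
  have der: "((\<lambda>x. B x w) has_derivative (\<lambda>v. - B x0 (fd (\<lambda>x. A x (B x0 w)) x0 v))) (at x0)"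
    if x0: "x0 \<in> S" and dA: "\<And>u. (\<lambda>x. A x u) differentiable (at x0)" for x0 w
  proof -
    \<comment> \<open>Here \<open>h x0 = 0\<close> and \<open>B x w = B x0 w - B x (h x)\<close>.
      Expanding \<open>h x\<close> in the basis leaves products of a differentiable factor that
      vanishes at \<open>x0\<close> with a factor \<open>B x b\<close> known only to be
      continuous.\<close>
    define h where "h = (\<lambda>x. A x (B x0 w) - A x0 (B x0 w))"
    define H where "H = fd (\<lambda>x. A x (B x0 w)) x0"
    have "((\<lambda>x. A x (B x0 w) - A x0 (B x0 w)) has_derivative (\<lambda>v. H v - 0)) (at x0)"
      unfolding H_def by (rule has_derivative_diff[OF fd_works[OF dA] has_derivative_const])
    then have h: "(h has_derivative H) (at x0)"
      by (simp add: h_def)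
    have "((\<lambda>x. (h x \<bullet> b) *\<^sub>R B x b) has_derivative (\<lambda>v. (H v \<bullet> b) *\<^sub>R B x0 b)) (at x0)" for b
      using h by (intro has_derivative_vanishing_scaleR has_derivative_inner_left cont x0
          differentiable_imp_continuous_within dA) (auto simp: h_def)
    then have "((\<lambda>x. \<Sum>b\<in>Basis. (h x \<bullet> b) *\<^sub>R B x b) has_derivative
        (\<lambda>v. \<Sum>b\<in>Basis. (H v \<bullet> b) *\<^sub>R B x0 b)) (at x0)"
      by (intro has_derivative_sum)
    then have "((\<lambda>x. B x0 w - (\<Sum>b\<in>Basis. (h x \<bullet> b) *\<^sub>R B x b)) has_derivative
        (\<lambda>v. - B x0 (H v))) (at x0)"
      unfolding linear_basis_expansion[OF linB[OF x0], symmetric]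
      using has_derivative_diff[OF has_derivative_const[of "B x0 w"]] by fastforce
    moreover have "B x0 w - (\<Sum>b\<in>Basis. (h x \<bullet> b) *\<^sub>R B x b) = B x w" if "x \<in> S" for x
      using x0 that unfolding linear_basis_expansion[OF linB[OF that], symmetric]
      by (simp add: h_def AB BA linear_diff[OF linB])
    ultimately show ?thesis unfolding H_def[symmetric]
      by (rule has_derivative_transform_within_open[OF _ S x0])
  qed
  show ?thesis using A
  proof (induction k arbitrary: w)
    case 0
    have "isCont (\<lambda>x. A x u) x" if "x \<in> S" for x u
      using 0[of u] that S by (simp add: continuous_on_eq_continuous_at)
    then show ?case using cont by (auto intro: continuous_at_imp_continuous_on)
  next
    case (Suc k)
    have dA: "(\<lambda>x. A x u) differentiable (at x)" if "x \<in> S" for x u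
      using Suc.prems[of u] that by simp
    \<comment> \<open>The derivative of \<open>A\<close> in a fixed direction \<open>v\<close> is
      again a linear family in \<open>u\<close>, so that \<open>Ck_on_linear_family\<close> applies
      to it.\<close>
    define P where "P x v u = fd (\<lambda>x. A x u) x v" for x v u
    have linP: "linear (P x v)" if x: "x \<in> S" for x v
    proof (rule linearI)
      fix u1 u2
      have "fd (\<lambda>x. A x (u1 + u2)) x = fd (\<lambda>x. A x u1 + A x u2) x"
        using linear_add[OF linA] by (intro fd_cong[OF S x]) auto
      also have "\<dots> = (\<lambda>v. fd (\<lambda>x. A x u1) x v + fd (\<lambda>x. A x u2) x v)"
        using x by (intro fd_eq has_derivative_add fd_works dA)
      finally show "P x v (u1 + u2) = P x v u1 + P x v u2" by (simp add: P_def)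
    next
      fix r u
      have "fd (\<lambda>x. A x (r *\<^sub>R u)) x = fd (\<lambda>x. r *\<^sub>R A x u) x"
        using linear_scale[OF linA] by (intro fd_cong[OF S x]) auto
      also have "\<dots> = (\<lambda>v. r *\<^sub>R fd (\<lambda>x. A x u) x v)"
        using x by (intro fd_eq has_derivative_scaleR_right fd_works dA)
      finally show "P x v (r *\<^sub>R u) = r *\<^sub>R P x v u" by (simp add: P_def)
    qed
    have IH: "Ck_on k (\<lambda>x. B x w) S" for w
      using Suc.IH Suc.prems Ck_on_SucD by blast
    show ?case
    proof (rule Ck_on_SucI[OF S der])
      fix v
      have "Ck_on k (\<lambda>x. P x v u) S" for u
        using Suc.prems[of u] by (simp add: P_def)
      then have "Ck_on k (\<lambda>x. P x v (B x w)) S"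
        using Ck_on_linear_family[of S "\<lambda>x. P x v"] S linP IH by blast
      then have "Ck_on k (\<lambda>x. B x (P x v (B x w))) S"
        using Ck_on_linear_family[of S B] S linB IH by blast
      then have "Ck_on k (\<lambda>x. - B x (P x v (B x w))) S"
        by (rule Ck_on_linear_compose[OF linear_uminus S])
      then show "Ck_on k (\<lambda>x. - B x (fd (\<lambda>x'. A x' (B x w)) x v)) S" by (simp add: P_def)
    qed (use dA in auto)
  qed
qed

section \<open>Smooth maps\<close>

lemma smooth_on_subset: "smooth_on f S \<Longrightarrow> T \<subseteq> S \<Longrightarrow> smooth_on f T"
  unfolding smooth_on_def using Ck_on_subset by blast

lemma smooth_on_cong:
  "open S \<Longrightarrow> (\<And>x. x \<in> S \<Longrightarrow> f x = g x) \<Longrightarrow> smooth_on f S \<Longrightarrow> smooth_on g S"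
  unfolding smooth_on_def using Ck_on_cong by metis

lemma smooth_on_local:
  "(\<And>x. x \<in> S \<Longrightarrow> \<exists>T. open T \<and> x \<in> T \<and> smooth_on f T) \<Longrightarrow> smooth_on f S"
  unfolding smooth_on_def using Ck_on_local by meson

lemma smooth_on_continuous: "smooth_on f S \<Longrightarrow> continuous_on S f"
  unfolding smooth_on_def using Ck_on.simps(1) by blast

lemma smooth_on_differentiable: "smooth_on f S \<Longrightarrow> x \<in> S \<Longrightarrow> f differentiable (at x)"
  unfolding smooth_on_def using Ck_on.simps(2) by blast

lemma smooth_on_fd: "smooth_on f S \<Longrightarrow> smooth_on (\<lambda>x. fd f x v) S"
  unfolding smooth_on_def using Ck_on.simps(2) by blast

lemma smooth_on_const: "smooth_on (\<lambda>x. c) S"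
  unfolding smooth_on_def using Ck_on_const by blast

lemma smooth_on_linear_compose:
  "linear L \<Longrightarrow> open S \<Longrightarrow> smooth_on f S \<Longrightarrow> smooth_on (\<lambda>x. L (f x)) S"
  unfolding smooth_on_def using Ck_on_linear_compose by blast

lemma smooth_on_bilinear:
  "bounded_bilinear h \<Longrightarrow> open S \<Longrightarrow> smooth_on f S \<Longrightarrow> smooth_on g S \<Longrightarrow> smooth_on (\<lambda>x. h (f x) (g x)) S"
  unfolding smooth_on_def using Ck_on_bilinear by blast

lemma smooth_on_add:
  "open S \<Longrightarrow> smooth_on f S \<Longrightarrow> smooth_on g S \<Longrightarrow> smooth_on (\<lambda>x. f x + g x) S"
  unfolding smooth_on_def using Ck_on_add by blast

lemma smooth_on_linear_family:
  fixes B :: "'c::euclidean_space \<Rightarrow> 'a::euclidean_space \<Rightarrow> 'b::euclidean_space"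
  shows "open S \<Longrightarrow> (\<And>x. x \<in> S \<Longrightarrow> linear (B x)) \<Longrightarrow> (\<And>b. smooth_on (\<lambda>x. B x b) S) \<Longrightarrow>
    smooth_on h S \<Longrightarrow> smooth_on (\<lambda>x. B x (h x)) S"
  unfolding smooth_on_def using Ck_on_linear_family[of S B] by blast

lemma smooth_on_compose:
  "open S \<Longrightarrow> open T \<Longrightarrow> f ` S \<subseteq> T \<Longrightarrow> smooth_on f S \<Longrightarrow> smooth_on g T \<Longrightarrow> smooth_on (g \<circ> f) S"
  unfolding smooth_on_def using Ck_on_compose by blast

lemma smooth_on_ident: "smooth_on (\<lambda>x. x) S"
proof -
  have "smooth_on (\<lambda>x::'a. x) UNIV"
    unfolding smooth_on_def
  proof
    fix k show "Ck_on k (\<lambda>x::'a. x) UNIV"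
      by (cases k) (auto simp: Ck_on_const)
  qed
  then show ?thesis by (rule smooth_on_subset) simp
qed

lemma smooth_on_linear: "linear L \<Longrightarrow> smooth_on L S"
  using smooth_on_subset[OF smooth_on_linear_compose[OF _ open_UNIV smooth_on_ident]] by blast

lemma smooth_on_fd_apply:
  assumes "open S" "smooth_on f S" "smooth_on h S"
  shows "smooth_on (\<lambda>x. fd f x (h x)) S"
  using smooth_on_linear_family[where B = "fd f", OF assms(1) _ smooth_on_fd[OF assms(2)] assms(3)]
    linear_frechet_derivative[OF smooth_on_differentiable[OF assms(2)]] by blast

lemma linear_inv:
  assumes "linear f" "bij f"
  shows "linear (inv f)"
proof (rule linearI)
  have f: "f (inv f x) = x" for x using assms(2) by (simp add: bij_is_surj surj_f_inv_f)
  have eq: "x = y" if "f x = f y" for x y using assms(2) that by (metis bij_is_inj injD)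
  show "inv f (x + y) = inv f x + inv f y" for x y
    by (rule eq) (simp add: linear_add[OF assms(1)] f)
  show "inv f (r *\<^sub>R x) = r *\<^sub>R inv f x" for r x
    by (rule eq) (simp add: linear_scale[OF assms(1)] f)
qed

lemma smooth_on_inverse_family:
  fixes A :: "'c::euclidean_space \<Rightarrow> 'a::euclidean_space \<Rightarrow> 'b::euclidean_space"
  assumes S: "open S" and A: "\<And>x. x \<in> S \<Longrightarrow> linear (A x)" "\<And>x. x \<in> S \<Longrightarrow> bij (A x)"
    "\<And>u. smooth_on (\<lambda>x. A x u) S" and h: "smooth_on h S"
  shows "smooth_on (\<lambda>x. inv (A x) (h x)) S"
proof (rule smooth_on_linear_family[OF S _ _ h])
  show lin: "linear (inv (A x))" if "x \<in> S" for x
    using A(1,2)[OF that] by (rule linear_inv)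
  show "smooth_on (\<lambda>x. inv (A x) w) S" for w
    unfolding smooth_on_def
  proof
    fix k show "Ck_on k (\<lambda>x. inv (A x) w) S"
      using A(3) unfolding smooth_on_def
      by (intro Ck_on_inverse_family[OF S A(1)])
       (auto simp: lin A(2) bij_is_inj bij_is_surj surj_f_inv_f inv_f_f)
  qed
qed

section \<open>Symmetry of second derivatives\<close>

lemma DERIV_line:
  fixes f :: "'a::real_normed_vector \<Rightarrow> real"
  assumes "f differentiable (at (x + s *\<^sub>R u))"
  shows "((\<lambda>s. f (x + s *\<^sub>R u)) has_real_derivative fd f (x + s *\<^sub>R u) u) (at s)"
proof -
  have "((\<lambda>s. x + s *\<^sub>R u) has_derivative (\<lambda>t. t *\<^sub>R u)) (at s)"
    by (auto intro!: derivative_eq_intros)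
  from has_derivative_compose[OF this fd_works[OF assms]]
  have "((\<lambda>s. f (x + s *\<^sub>R u)) has_derivative (\<lambda>t. fd f (x + s *\<^sub>R u) (t *\<^sub>R u))) (at s)" .
  then show ?thesis
    unfolding has_field_derivative_def
    by (simp add: linear_scale[OF linear_frechet_derivative[OF assms]] mult_commute_abs)
qed

text \<open>The mean value theorem, applied twice to the second difference along the parallelogram
  spanned by \<open>u\<close> and \<open>v\<close>.\<close>

lemma second_difference_mvt:
  fixes f :: "'a::euclidean_space \<Rightarrow> real"
  assumes B: "\<And>s t. 0 \<le> s \<Longrightarrow> s \<le> h \<Longrightarrow> 0 \<le> t \<Longrightarrow> t \<le> h \<Longrightarrow> x + s *\<^sub>R u + t *\<^sub>R v \<in> S"
    and f: "Ck_on 2 f S" and h: "h > 0"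
  shows "\<exists>s t. 0 \<le> s \<and> s \<le> h \<and> 0 \<le> t \<and> t \<le> h \<and>
    f (x + h *\<^sub>R u + h *\<^sub>R v) - f (x + h *\<^sub>R u) - f (x + h *\<^sub>R v) + f x
      = h * h * fd (\<lambda>y. fd f y u) (x + s *\<^sub>R u + t *\<^sub>R v) v"
proof -
  have d1: "f differentiable (at y)" and d2: "(\<lambda>y. fd f y u) differentiable (at y)" if "y \<in> S" for y
    using f that by (auto simp: numeral_2_eq_2)
  define g where "g s = f ((x + h *\<^sub>R v) + s *\<^sub>R u) - f (x + s *\<^sub>R u)" for s
  have "(g has_real_derivative fd f ((x + h *\<^sub>R v) + s *\<^sub>R u) u - fd f (x + s *\<^sub>R u) u) (at s)"
    if "0 \<le> s" "s \<le> h" for s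
    unfolding g_def using B[of s h] B[of s 0] that h
    by (intro DERIV_diff DERIV_line d1) (auto simp: algebra_simps)
  from MVT2[OF h this] obtain s where s: "0 < s" "s < h"
    and gs: "g h - g 0 = h * (fd f ((x + h *\<^sub>R v) + s *\<^sub>R u) u - fd f (x + s *\<^sub>R u) u)"
    by auto
  have "((\<lambda>t. fd f ((x + s *\<^sub>R u) + t *\<^sub>R v) u) has_real_derivative
      fd (\<lambda>y. fd f y u) ((x + s *\<^sub>R u) + t *\<^sub>R v) v) (at t)" if "0 \<le> t" "t \<le> h" for t
    using B[of s t] that s by (intro DERIV_line d2) (auto simp: algebra_simps)
  from MVT2[OF h this] obtain t where t: "0 < t" "t < h"
    and gt: "fd f ((x + s *\<^sub>R u) + h *\<^sub>R v) u - fd f ((x + s *\<^sub>R u) + 0 *\<^sub>R v) u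
      = h * fd (\<lambda>y. fd f y u) ((x + s *\<^sub>R u) + t *\<^sub>R v) v"
    by auto
  have "f (x + h *\<^sub>R u + h *\<^sub>R v) - f (x + h *\<^sub>R u) - f (x + h *\<^sub>R v) + f x = g h - g 0"
    by (simp add: g_def algebra_simps)
  also have "\<dots> = h * (fd f ((x + s *\<^sub>R u) + h *\<^sub>R v) u - fd f ((x + s *\<^sub>R u) + 0 *\<^sub>R v) u)"
    using gs by (simp add: algebra_simps)
  finally show ?thesis
    unfolding gt using s t by (intro exI[of _ s] exI[of _ t]) auto
qed

text \<open>The second difference is symmetric in \<open>u\<close> and \<open>v\<close>, and by the
  mean value theorem it is \<open>h * h\<close> times either mixed derivative at a point near
  \<open>x\<close>. Continuity of both mixed derivatives excludes a gap between them at
  \<open>x\<close>.\<close>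

lemma second_derivative_symmetric_real:
  fixes f :: "'a::euclidean_space \<Rightarrow> real"
  assumes S: "open S" "x \<in> S" and f: "Ck_on 2 f S"
  shows "fd (\<lambda>y. fd f y u) x v = fd (\<lambda>y. fd f y v) x u"
proof (rule ccontr)
  define P where "P y = fd (\<lambda>y. fd f y u) y v" for y
  define Q where "Q y = fd (\<lambda>y. fd f y v) y u" for y
  define e where "e = \<bar>P x - Q x\<bar> / 2"
  assume "\<not> ?thesis"
  then have e: "e > 0" by (simp add: e_def P_def Q_def)
  have "isCont P x" "isCont Q x"
    using f S by (auto simp: numeral_2_eq_2 P_def[abs_def] Q_def[abs_def] continuous_on_eq_continuous_at)
  then have "eventually (\<lambda>y. \<bar>P y - P x\<bar> < e \<and> \<bar>Q y - Q x\<bar> < e) (nhds x)"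
    using e by (intro eventually_conj)
      (auto simp: continuous_at_eps_delta dist_real_def eventually_nhds_metric)
  then have "eventually (\<lambda>y. y \<in> S \<and> \<bar>P y - P x\<bar> < e \<and> \<bar>Q y - Q x\<bar> < e) (nhds x)"
    using eventually_conj[OF eventually_nhds_in_open[OF S]] by simp
  then obtain d where d: "d > 0"
    "\<And>y. dist y x < d \<Longrightarrow> y \<in> S \<and> \<bar>P y - P x\<bar> < e \<and> \<bar>Q y - Q x\<bar> < e"
    unfolding eventually_nhds_metric by blast
  \<comment> \<open>Chosen so that the whole parallelogram with sides \<open>h *\<^sub>R u\<close>
    and \<open>h *\<^sub>R v\<close> lies within distance \<open>d\<close> of \<open>x\<close>; the
    summand 1 keeps the denominator positive.\<close>
  define h where "h = d / (norm u + norm v + 1)"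
  have pos: "norm u + norm v + 1 > 0" by (smt (verit) norm_ge_zero)
  then have h: "h > 0" using d(1) by (simp add: h_def)
  have B: "dist (x + s *\<^sub>R u + t *\<^sub>R v) x < d" if "0 \<le> s" "s \<le> h" "0 \<le> t" "t \<le> h" for s t
  proof -
    have "norm (s *\<^sub>R u + t *\<^sub>R v) \<le> h * norm u + h * norm v"
      using that by (intro norm_triangle_le add_mono) (auto intro: mult_right_mono)
    also have "\<dots> < h * (norm u + norm v + 1)" using h by (simp add: algebra_simps)
    also have "\<dots> = d" using pos by (simp add: h_def)
    finally show ?thesis by (simp add: dist_norm algebra_simps)
  qed
  obtain s t where st: "0 \<le> s" "s \<le> h" "0 \<le> t" "t \<le> h"
    "f (x + h *\<^sub>R u + h *\<^sub>R v) - f (x + h *\<^sub>R u) - f (x + h *\<^sub>R v) + f x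
      = h * h * P (x + s *\<^sub>R u + t *\<^sub>R v)"
    using second_difference_mvt[OF _ f h, of x u v] B d(2) unfolding P_def by metis
  have B': "dist (x + s *\<^sub>R v + t *\<^sub>R u) x < d" if "0 \<le> s" "s \<le> h" "0 \<le> t" "t \<le> h" for s t
    using B[of t s] that by (simp add: algebra_simps)
  obtain s' t' where st': "0 \<le> s'" "s' \<le> h" "0 \<le> t'" "t' \<le> h"
    "f (x + h *\<^sub>R v + h *\<^sub>R u) - f (x + h *\<^sub>R v) - f (x + h *\<^sub>R u) + f x
      = h * h * Q (x + s' *\<^sub>R v + t' *\<^sub>R u)"
    using second_difference_mvt[OF _ f h, of x v u] B' d(2) unfolding Q_def by metis
  have "h * h * P (x + s *\<^sub>R u + t *\<^sub>R v) = h * h * Q (x + s' *\<^sub>R v + t' *\<^sub>R u)"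
    using st(5) st'(5) by (simp add: algebra_simps)
  then have "P (x + s *\<^sub>R u + t *\<^sub>R v) = Q (x + s' *\<^sub>R v + t' *\<^sub>R u)" using h by simp
  moreover have "\<bar>P (x + s *\<^sub>R u + t *\<^sub>R v) - P x\<bar> < e" "\<bar>Q (x + s' *\<^sub>R v + t' *\<^sub>R u) - Q x\<bar> < e"
    using d(2)[OF B[OF st(1-4)]] d(2)[OF B'[OF st'(1-4)]] by auto
  moreover have "\<bar>p - q\<bar> \<le> \<bar>r - p\<bar> + \<bar>r - q\<bar>" for p q r :: real by arith
  ultimately have "\<bar>P x - Q x\<bar> < e + e" by (smt (verit))
  then show False by (simp add: e_def)
qed

lemma second_derivative_symmetric:
  fixes f :: "'a::euclidean_space \<Rightarrow> 'b::euclidean_space"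
  assumes S: "open S" "x \<in> S" and f: "smooth_on f S"
  shows "fd (\<lambda>y. fd f y u) x v = fd (\<lambda>y. fd f y v) x u"
proof (rule euclidean_eqI)
  fix b :: 'b assume "b \<in> Basis"
  have lin: "linear (\<lambda>a. a \<bullet> b)" by (simp add: bounded_linear.linear bounded_linear_inner_left)
  have sc: "fd (\<lambda>y. g y \<bullet> b) y w = fd g y w \<bullet> b" if "smooth_on g S" "y \<in> S" for g y w
    using fd_eq[OF has_derivative_inner_left[OF fd_works[OF smooth_on_differentiable[OF that]], of b]]
    by simp
  have "fd (\<lambda>y. fd f y u) x v \<bullet> b = fd (\<lambda>y. fd (\<lambda>y. f y \<bullet> b) y u) x v" for u v
  proof -
    have "fd (\<lambda>y. fd f y u) x v \<bullet> b = fd (\<lambda>y. fd f y u \<bullet> b) x v"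
      using sc[OF smooth_on_fd[OF f] S(2)] by simp
    also have "\<dots> = fd (\<lambda>y. fd (\<lambda>y. f y \<bullet> b) y u) x v"
      using fd_cong[OF S, of "\<lambda>y. fd f y u \<bullet> b" "\<lambda>y. fd (\<lambda>y. f y \<bullet> b) y u"] sc[OF f] by simp
    finally show ?thesis .
  qed
  moreover have "Ck_on 2 (\<lambda>y. f y \<bullet> b) S"
    using smooth_on_linear_compose[OF lin S(1) f] unfolding smooth_on_def by blast
  ultimately show "fd (\<lambda>y. fd f y u) x v \<bullet> b = fd (\<lambda>y. fd f y v) x u \<bullet> b"
    using second_derivative_symmetric_real[OF S] by metis
qed

section \<open>Inverse functions\<close>

lemma linear_inj_bij:
  fixes L :: "'a::euclidean_space \<Rightarrow> 'b::euclidean_space"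
  assumes "linear L" "inj L" "DIM('a) = DIM('b)"
  shows "bij L"
proof -
  have "dim (range L) = DIM('b)"
    using dim_image_eq[OF assms(1), of UNIV] assms(2,3) by (simp add: dim_UNIV)
  then have "range L = UNIV"
    using assms(1) by (metis dim_eq_full linear_subspace_image span_eq_iff subspace_UNIV)
  then show ?thesis using assms(2) by (simp add: bij_def)
qed

text \<open>A bootstrap: the derivative of \<open>g\<close> at \<open>y\<close> is the inverse of
  \<open>fd f (g y)\<close>. If \<open>g\<close> is C^k, so is this expression, as a composition of
  a smooth inverse family with \<open>g\<close>, and \<open>g\<close> gains one order.\<close>

lemma smooth_on_inverse:
  fixes f :: "'a::euclidean_space \<Rightarrow> 'b::euclidean_space"
  assumes S: "open S" and f: "smooth_on f S" and T: "open (f ` S)"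
    and bij: "\<And>x. x \<in> S \<Longrightarrow> bij (fd f x)"
    and g: "continuous_on (f ` S) g" "\<And>x. x \<in> S \<Longrightarrow> g (f x) = x"
  shows "smooth_on g (f ` S)" and "\<And>x. x \<in> S \<Longrightarrow> (g has_derivative inv (fd f x)) (at (f x))"
proof -
  have lin: "linear (fd f x)" if "x \<in> S" for x
    using f that by (intro linear_frechet_derivative smooth_on_differentiable)
  have linv: "linear (inv (fd f x))" if "x \<in> S" for x
    using lin[OF that] bij[OF that] by (rule linear_inv)
  show d: "(g has_derivative inv (fd f x)) (at (f x))" if "x \<in> S" for x
  proof (rule has_derivative_inverse_basic[where f = f and T = "f ` S"])
    show "(f has_derivative fd f x) (at (g (f x)))"
      using g(2)[OF that] fd_works[OF smooth_on_differentiable[OF f that]] by simp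
    show "bounded_linear (inv (fd f x))"
      using linv[OF that] by (simp add: linear_conv_bounded_linear)
    show "inv (fd f x) \<circ> fd f x = id" using bij[OF that] by (simp add: bij_is_inj)
    show "continuous (at (f x)) g"
      using g(1) T that by (simp add: continuous_on_eq_continuous_at)
  qed (use T that g in auto)
  show "smooth_on g (f ` S)"
    unfolding smooth_on_def
  proof
    fix k
    show "Ck_on k g (f ` S)"
    proof (induction k)
      case (Suc k)
      have d': "(g has_derivative inv (fd f (g y))) (at y)" if "y \<in> f ` S" for y
        using d that g(2) by auto
      show ?case
      proof (rule Ck_on_SucI[OF T d'])
        fix v
        have "smooth_on (\<lambda>x. inv (fd f x) v) S"
          by (rule smooth_on_inverse_family[OF S lin bij smooth_on_fd[OF f] smooth_on_const])
        then have "Ck_on k ((\<lambda>x. inv (fd f x) v) \<circ> g) (f ` S)"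
          using Suc g(2) unfolding smooth_on_def by (intro Ck_on_compose[OF T S]) auto
        then show "Ck_on k (\<lambda>y. inv (fd f (g y)) v) (f ` S)" by (simp add: o_def)
      qed
    qed (simp add: g)
  qed
qed

lemma smooth_local_inverse:
  fixes f :: "'a::euclidean_space \<Rightarrow> 'b::euclidean_space"
  assumes S: "open S" "x0 \<in> S" and f: "smooth_on f S" and inj: "inj (fd f x0)"
    and dim: "DIM('a) = DIM('b)"
  obtains U where "open U" "x0 \<in> U" "U \<subseteq> S" "open (f ` U)" "inj_on f U"
    "continuous_on (f ` U) (inv_into U f)" "\<And>x. x \<in> U \<Longrightarrow> bij (fd f x)"
proof -
  \<comment> \<open>The inverse function theorem is applied to \<open>L \<circ> f\<close>, a map
    from an open set of the source space back into that space.\<close>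
  obtain L :: "'b \<Rightarrow> 'a" and L' where L: "linear L" "linear L'" "\<And>x. L' (L x) = x" "\<And>y. L (L' y) = y"
    using isomorphisms_UNIV_UNIV[OF dim[symmetric]] by metis
  define f' where "f' x = Blinfun (\<lambda>v. L (fd f x v))" for x
  have df: "f differentiable (at x)" if "x \<in> S" for x
    using f that by (rule smooth_on_differentiable)
  have bl: "bounded_linear (\<lambda>v. L (fd f x v))" if "x \<in> S" for x
    using linear_compose[OF linear_frechet_derivative[OF df[OF that]] L(1)]
    by (simp add: linear_conv_bounded_linear o_def)
  have ap: "blinfun_apply (f' x) = (\<lambda>v. L (fd f x v))" if "x \<in> S" for x
    unfolding f'_def using bl[OF that] by (rule bounded_linear_Blinfun_apply)
  have injL: "inj L" using L(3) by (rule inj_on_inverseI)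
  have "inj (blinfun_apply (f' x0))"
    using inj injL S(2) by (simp add: ap inj_def)
  then have b0: "bij (blinfun_apply (f' x0))"
    by (intro linear_inj_bij) (auto simp: bounded_linear.linear blinfun.bounded_linear_right)
  define g0 where "g0 = Blinfun (inv (blinfun_apply (f' x0)))"
  have "blinfun_apply g0 = inv (blinfun_apply (f' x0))"
    unfolding g0_def
    using b0 by (intro bounded_linear_Blinfun_apply)
      (metis bij_is_inj bij_is_surj blinfun.bounded_linear_right bounded_linear.linear
        inj_linear_imp_inv_linear linear_conv_bounded_linear)
  then have inv0: "g0 o\<^sub>L f' x0 = id_blinfun"
    using b0 by (intro blinfun_eqI) (simp add: bij_is_inj)
  have cont: "continuous_on S f'"
  proof (rule continuous_on_blinfun_componentwise)
    fix i :: 'a assume "i \<in> Basis"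
    have "continuous_on S (\<lambda>x. L (fd f x i))"
      by (rule smooth_on_continuous[OF smooth_on_linear_compose[OF L(1) S(1) smooth_on_fd[OF f]]])
    then show "continuous_on S (\<lambda>x. blinfun_apply (f' x) i)"
      by (rule continuous_on_eq) (simp add: ap)
  qed
  have der: "((L \<circ> f) has_derivative blinfun_apply (f' x)) (at x)" if "x \<in> S" for x
    unfolding ap[OF that] o_def
    using bounded_linear.has_derivative[OF _ fd_works[OF df[OF that]], of L] L(1)
    by (simp add: linear_conv_bounded_linear)
  obtain U V g g' where U: "open U" "U \<subseteq> S" "x0 \<in> U" "open V" and hom: "homeomorphism U V (L \<circ> f) g"
    and bij: "\<And>y. y \<in> V \<Longrightarrow> bij (blinfun_apply (f' (g y)))"
    using inverse_function_theorem[OF S(1) der cont S(2) inv0] by metis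
  have V: "V = L ` f ` U" using hom by (auto simp: homeomorphism_def)
  have gL: "g (L (f x)) = x" if "x \<in> U" for x using hom that by (simp add: homeomorphism_def)
  have "f ` U = L' ` V" using V L(3) by (simp add: image_image)
  moreover have "L' ` V = L -` V"
  proof
    show "L -` V \<subseteq> L' ` V" using L(3) by (metis image_eqI subsetI vimageD)
  qed (auto simp: L(4))
  moreover have "open (L -` V)"
    using U(4) L(1) by (intro continuous_open_vimage) (auto simp: linear_continuous_at linear_conv_bounded_linear)
  ultimately have op: "open (f ` U)" by simp
  have inj': "inj_on f U" using gL by (metis inj_onI)
  have "continuous_on (f ` U) (g \<circ> L)"
    using hom V L(1) by (intro continuous_on_compose[OF linear_continuous_on])
     (auto simp: homeomorphism_def linear_conv_bounded_linear)
  then have "continuous_on (f ` U) (inv_into U f)"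
    by (rule continuous_on_eq) (auto simp: gL inj')
  moreover have "bij (fd f x)" if "x \<in> U" for x
  proof -
    have "bij (\<lambda>v. L (fd f x v))"
      using bij[of "L (f x)"] gL[OF that] V that ap U(2) by auto
    then have "inj (fd f x)" unfolding bij_def inj_def by metis
    then show ?thesis
      using that U(2) by (intro linear_inj_bij linear_frechet_derivative df dim) auto
  qed
  ultimately show ?thesis using that[of U] U op inj' by blast
qed

text \<open>A product rule with two contributions, the second derivative of \<open>h\<close> and the
  derivative of the varying vector. It is the coordinate computation behind the Lie bracket.\<close>

lemma fd_fd_apply:
  fixes h :: "'a::euclidean_space \<Rightarrow> 'b::euclidean_space"
  assumes S: "open S" "x0 \<in> S" and h: "smooth_on h S" and y: "smooth_on y S"
  shows "fd (\<lambda>x. fd h x (y x)) x0 v = fd (\<lambda>x. fd h x (y x0)) x0 v + fd h x0 (fd y x0 v)"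
proof -
  have lin: "linear (fd h x)" if "x \<in> S" for x
    by (rule linear_frechet_derivative[OF smooth_on_differentiable[OF h that]])
  have expand: "fd (\<lambda>x. fd h x (z x)) x0 v =
      (\<Sum>b\<in>Basis. (z x0 \<bullet> b) *\<^sub>R fd (\<lambda>x. fd h x b) x0 v + (fd z x0 v \<bullet> b) *\<^sub>R fd h x0 b)"
    if z: "smooth_on z S" for z
  proof -
    have "fd (\<lambda>x. fd h x (z x)) x0 = fd (\<lambda>x. \<Sum>b\<in>Basis. (z x \<bullet> b) *\<^sub>R fd h x b) x0"
      by (rule fd_cong[OF S]) (rule linear_basis_expansion[OF lin])
    also have "\<dots> = (\<lambda>v. \<Sum>b\<in>Basis. (z x0 \<bullet> b) *\<^sub>R fd (\<lambda>x. fd h x b) x0 v + (fd z x0 v \<bullet> b) *\<^sub>R fd h x0 b)"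
      by (intro fd_eq has_derivative_sum has_derivative_scaleR has_derivative_inner_left fd_works
          smooth_on_differentiable[OF z S(2)] smooth_on_differentiable[OF smooth_on_fd[OF h] S(2)])
    finally show ?thesis by simp
  qed
  have "fd (\<lambda>x. fd h x (y x0)) x0 v = (\<Sum>b\<in>Basis. (y x0 \<bullet> b) *\<^sub>R fd (\<lambda>x. fd h x b) x0 v)"
    using expand[OF smooth_on_const[of "y x0"]] by simp
  then show ?thesis
    using expand[OF y] linear_basis_expansion[OF lin[OF S(2)], of "fd y x0 v"]
    by (simp only: sum.distrib)
qed

section \<open>Calculus on complex manifolds\<close>

locale complex_manifold =
  fixes A :: "('m::{t2_space,second_countable_topology}, 'n::finite) chart set"
  assumes atlas: "complex_atlas A"
begin

lemma chart_props:
  assumes "(V, d) \<in> A"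
  shows "open V" "open (d ` V)" "continuous_on V d" "continuous_on (d ` V) (inv_into V d)" "inj_on d V"
proof -
  have "\<forall>(V, d)\<in>A. open V \<and> open (d ` V) \<and> homeomorphism V (d ` V) d (inv_into V d)"
    using atlas unfolding complex_atlas_def by blast
  then have "open V \<and> open (d ` V) \<and> homeomorphism V (d ` V) d (inv_into V d)"
    using assms by blast
  then show "open V" "open (d ` V)" "continuous_on V d" "continuous_on (d ` V) (inv_into V d)" "inj_on d V"
    by (auto simp: homeomorphism_def intro: inj_on_inverseI)
qed

lemma chart_inv: "(V, d) \<in> A \<Longrightarrow> p \<in> V \<Longrightarrow> inv_into V d (d p) = p"
  using chart_props(5) by (simp add: inv_into_f_f)

lemma chart_transition:
  assumes "(V, d) \<in> A" "(U, c) \<in> A"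
  shows "smooth_on (d \<circ> inv_into U c) (c ` (U \<inter> V))"
    and "x \<in> c ` (U \<inter> V) \<Longrightarrow> fd (d \<circ> inv_into U c) x (Jn v) = Jn (fd (d \<circ> inv_into U c) x v)"
proof -
  have "\<forall>(U, c)\<in>A. \<forall>(V, d)\<in>A. holo_on Jn Jn (d \<circ> inv_into U c) (c ` (U \<inter> V))"
    using atlas unfolding complex_atlas_def by blast
  then have "holo_on Jn Jn (d \<circ> inv_into U c) (c ` (U \<inter> V))"
    using assms by blast
  then show "smooth_on (d \<circ> inv_into U c) (c ` (U \<inter> V))"
    and "x \<in> c ` (U \<inter> V) \<Longrightarrow> fd (d \<circ> inv_into U c) x (Jn v) = Jn (fd (d \<circ> inv_into U c) x v)"
    unfolding holo_on_def by blast+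
qed

lemma open_chart_image:
  assumes "(V, d) \<in> A" "open U" "U \<subseteq> V"
  shows "open (d ` U)"
proof -
  have "d ` U = d ` V \<inter> inv_into V d -` U"
    using assms(3) chart_inv[OF assms(1)] by (auto 4 4 simp: subset_iff)
  then show ?thesis
    using continuous_open_preimage[OF chart_props(4,2)[OF assms(1)] assms(2)] by simp
qed

lemma open_chart_image_Int: "(V, d) \<in> A \<Longrightarrow> open U \<Longrightarrow> open (d ` (U \<inter> V))"
  using open_chart_image chart_props(1) by (simp add: open_Int)

section \<open>Differentials in the selected charts\<close>

definition dom_at :: "'m \<Rightarrow> 'm set" where "dom_at p = fst (chart_at A p)"
definition coord_at :: "'m \<Rightarrow> 'm \<Rightarrow> complex ^ 'n" where "coord_at p = snd (chart_at A p)"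
definition par_at :: "'m \<Rightarrow> complex ^ 'n \<Rightarrow> 'm" where "par_at p = inv_into (dom_at p) (coord_at p)"

lemma chart_at_in: "(dom_at p, coord_at p) \<in> A" and chart_at_mem: "p \<in> dom_at p"
proof -
  have "\<exists>c. c \<in> A \<and> p \<in> fst c"
    using atlas unfolding complex_atlas_def by force
  then have "chart_at A p \<in> A \<and> p \<in> fst (chart_at A p)"
    unfolding chart_at_def by (rule someI_ex)
  then show "(dom_at p, coord_at p) \<in> A" "p \<in> dom_at p"
    by (auto simp: dom_at_def coord_at_def)
qed

lemma par_at_coord [simp]: "par_at p (coord_at p p) = p"
  unfolding par_at_def by (rule chart_inv[OF chart_at_in chart_at_mem])

lemma tdiff_eq: "tdiff A H p = fd (\<lambda>x. H (par_at p x)) (coord_at p p)"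
  by (rule ext)
    (simp add: tdiff_def par_at_def dom_at_def coord_at_def case_prod_beta o_def)

text \<open>\<open>tdiff\<close> is an arbitrary choice where the function is not differentiable.
  The condition is asked in all charts around \<open>p\<close> at once, so that using it never
  requires a change of charts.\<close>

definition mdiff :: "('m \<Rightarrow> 'b::real_normed_vector) \<Rightarrow> 'm \<Rightarrow> bool" where
  "mdiff H p \<longleftrightarrow> (\<forall>(V, d)\<in>A. p \<in> V \<longrightarrow> (H \<circ> inv_into V d) differentiable (at (d p)))"

lemma mdiff_chart:
  "mdiff H p \<Longrightarrow> (V, d) \<in> A \<Longrightarrow> p \<in> V \<Longrightarrow> (H \<circ> inv_into V d) differentiable (at (d p))"
  unfolding mdiff_def by auto

lemma has_tdiff:
  assumes "mdiff H p"
  shows "((\<lambda>x. H (par_at p x)) has_derivative tdiff A H p) (at (coord_at p p))"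
  using fd_works[OF mdiff_chart[OF assms chart_at_in chart_at_mem]]
  unfolding tdiff_eq by (simp add: par_at_def o_def)

lemma tdiffI:
  "((\<lambda>x. H (par_at p x)) has_derivative H') (at (coord_at p p)) \<Longrightarrow> tdiff A H p = H'"
  unfolding tdiff_eq by (rule fd_eq)

lemma tdiff_linear: "mdiff H p \<Longrightarrow> linear (tdiff A H p)"
  using has_tdiff has_derivative_linear by blast

lemma smooth_fun_mdiff: "smooth_fun A U H \<Longrightarrow> p \<in> U \<Longrightarrow> mdiff H p"
  unfolding smooth_fun_def mdiff_def by (fastforce intro: smooth_on_differentiable)

lemma smooth_fun_chart: "smooth_fun A U H \<Longrightarrow> (V, d) \<in> A \<Longrightarrow> smooth_on (H \<circ> inv_into V d) (d ` (U \<inter> V))"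
  unfolding smooth_fun_def by auto

lemma chart_smooth_fun: "(V, d) \<in> A \<Longrightarrow> smooth_fun A V d"
  unfolding smooth_fun_def using chart_transition(1) by (fastforce simp: Int_commute)

text \<open>The chain rule for H = (H o d^-1) o d. It expresses \<open>tdiff\<close> in an arbitrary
  chart, with \<open>tdiff A d p v\<close> as the components of the tangent vector there.\<close>

lemma tdiff_chart:
  assumes "(V, d) \<in> A" "p \<in> V" "mdiff H p"
  shows "tdiff A H p v = fd (H \<circ> inv_into V d) (d p) (tdiff A d p v)"
proof -
  have "((\<lambda>x. (H \<circ> inv_into V d) (d (par_at p x))) has_derivative
      (\<lambda>v. fd (H \<circ> inv_into V d) (d p) (tdiff A d p v))) (at (coord_at p p))"
    using has_derivative_compose[OF has_tdiff[OF smooth_fun_mdiff[OF chart_smooth_fun[OF assms(1)] assms(2)]],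
        of "H \<circ> inv_into V d"] fd_works[OF mdiff_chart[OF assms(3,1,2)]]
    by simp
  moreover have "open (coord_at p ` (V \<inter> dom_at p))"
    using open_chart_image_Int[OF chart_at_in chart_props(1)[OF assms(1)]] .
  moreover have "coord_at p p \<in> coord_at p ` (V \<inter> dom_at p)"
    using chart_at_mem assms(2) by auto
  moreover have "(H \<circ> inv_into V d) (d (par_at p x)) = H (par_at p x)"
    if "x \<in> coord_at p ` (V \<inter> dom_at p)" for x
    using that chart_inv[OF assms(1)] chart_inv[OF chart_at_in] by (auto simp: par_at_def)
  ultimately have "((\<lambda>x. H (par_at p x)) has_derivative
      (\<lambda>v. fd (H \<circ> inv_into V d) (d p) (tdiff A d p v))) (at (coord_at p p))"
    by (rule has_derivative_transform_within_open)
  then show ?thesis by (simp add: tdiffI)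
qed

text \<open>Tangent vectors at \<open>p\<close> are encoded by their components in this very
  chart.\<close>

lemma tdiff_coord_at: "tdiff A (coord_at p) p v = v"
proof -
  have "((\<lambda>x. coord_at p (par_at p x)) has_derivative (\<lambda>v. v)) (at (coord_at p p))"
  proof (rule has_derivative_transform_within_open[OF has_derivative_ident])
    show "open (coord_at p ` dom_at p)" by (rule chart_props(2)[OF chart_at_in])
    show "coord_at p p \<in> coord_at p ` dom_at p" using chart_at_mem by simp
    show "x = coord_at p (par_at p x)" if "x \<in> coord_at p ` dom_at p" for x
      using that chart_inv[OF chart_at_in] by (auto simp: par_at_def)
  qed
  then show ?thesis by (simp add: tdiffI)
qed

text \<open>The transition map back to the selected chart supplies a left inverse, and equality of
  dimensions does the rest. Complex linearity is that of the transition map.\<close>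

lemma tdiff_chart_bij:
  assumes "(V, d) \<in> A" "p \<in> V"
  shows "bij (tdiff A d p)" "tdiff A d p (Jn v) = Jn (tdiff A d p v)"
proof -
  have "inj (tdiff A d p)"
  proof (rule inj_on_inverseI)
    fix v
    have "mdiff (coord_at p) p"
      using smooth_fun_mdiff[OF chart_smooth_fun[OF chart_at_in] chart_at_mem] .
    from tdiff_chart[OF assms this, of v]
    show "fd (coord_at p \<circ> inv_into V d) (d p) (tdiff A d p v) = v"
      by (simp add: tdiff_coord_at)
  qed
  then show "bij (tdiff A d p)"
    using tdiff_linear[OF smooth_fun_mdiff[OF chart_smooth_fun[OF assms(1)] assms(2)]]
    by (intro linear_inj_bij) auto
  show "tdiff A d p (Jn v) = Jn (tdiff A d p v)"
    using chart_transition(2)[OF assms(1) chart_at_in, of "coord_at p p" p v] chart_at_mem assms(2)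
    by (simp add: tdiff_eq par_at_def o_def)
qed

lemma tdiff_cong:
  assumes "open N" "p \<in> N" "\<And>q. q \<in> N \<Longrightarrow> H q = K q"
  shows "tdiff A H p = tdiff A K p"
  unfolding tdiff_eq
proof (rule fd_cong)
  show "open (coord_at p ` (N \<inter> dom_at p))" by (rule open_chart_image_Int[OF chart_at_in assms(1)])
  show "coord_at p p \<in> coord_at p ` (N \<inter> dom_at p)" using assms(2) chart_at_mem by auto
qed (use assms(3) chart_inv[OF chart_at_in] in \<open>auto simp: par_at_def\<close>)

lemma tdiff_linear_compose:
  assumes "linear (L :: 'b::euclidean_space \<Rightarrow> 'c::real_normed_vector)" "mdiff H p"
  shows "tdiff A (\<lambda>q. L (H q)) p v = L (tdiff A H p v)"
proof -
  have "bounded_linear L" using assms(1) by (simp add: linear_conv_bounded_linear)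
  from tdiffI[OF bounded_linear.has_derivative[OF this has_tdiff[OF assms(2)]]]
  show ?thesis by simp
qed

lemma tdiff_bilinear:
  assumes "bounded_bilinear h" "mdiff H p" "mdiff K p"
  shows "tdiff A (\<lambda>q. h (H q) (K q)) p v = h (H p) (tdiff A K p v) + h (tdiff A H p v) (K p)"
  using tdiffI[OF bounded_bilinear.FDERIV[OF assms(1) has_tdiff[OF assms(2)] has_tdiff[OF assms(3)]]]
  by simp

lemma tdiff_add:
  assumes "mdiff H p" "mdiff K p"
  shows "tdiff A (\<lambda>q. H q + K q) p v = tdiff A H p v + tdiff A K p v"
  using tdiffI[OF has_derivative_add[OF has_tdiff[OF assms(1)] has_tdiff[OF assms(2)]]] by simp

section \<open>Smooth and holomorphic functions\<close>

lemma smooth_fun_subset: "smooth_fun A U H \<Longrightarrow> T \<subseteq> U \<Longrightarrow> smooth_fun A T H"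
  unfolding smooth_fun_def by (fast elim: smooth_on_subset)

lemma smooth_fun_cong:
  assumes "open U" "\<And>q. q \<in> U \<Longrightarrow> H q = K q" "smooth_fun A U H"
  shows "smooth_fun A U K"
  unfolding smooth_fun_def
proof (intro ballI, unfold split_paired_all, intro case_prodI)
  fix V d assume V: "(V, d) \<in> A"
  show "smooth_on (K \<circ> inv_into V d) (d ` (U \<inter> V))"
    by (rule smooth_on_cong[OF open_chart_image_Int[OF V assms(1)] _ smooth_fun_chart[OF assms(3) V]])
      (use assms(2) chart_inv[OF V] in auto)
qed

lemma smooth_funI:
  assumes "\<And>V d. (V, d) \<in> A \<Longrightarrow> smooth_on (\<lambda>x. H (inv_into V d x)) (d ` (U \<inter> V))"
  shows "smooth_fun A U H"
  using assms unfolding smooth_fun_def by (auto simp: o_def)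

lemma smooth_funD:
  "smooth_fun A U H \<Longrightarrow> (V, d) \<in> A \<Longrightarrow> smooth_on (\<lambda>x. H (inv_into V d x)) (d ` (U \<inter> V))"
  using smooth_fun_chart by (auto simp: o_def)

lemma smooth_fun_linear_compose:
  "open U \<Longrightarrow> linear L \<Longrightarrow> smooth_fun A U H \<Longrightarrow> smooth_fun A U (\<lambda>q. L (H q))"
  by (rule smooth_funI, rule smooth_on_linear_compose)
    (auto intro: open_chart_image_Int smooth_funD)

lemma smooth_fun_bilinear:
  "bounded_bilinear h \<Longrightarrow> open U \<Longrightarrow> smooth_fun A U H \<Longrightarrow> smooth_fun A U K \<Longrightarrow>
    smooth_fun A U (\<lambda>q. h (H q) (K q))"
  by (rule smooth_funI, rule smooth_on_bilinear)
    (auto intro: open_chart_image_Int smooth_funD)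

lemma smooth_fun_add:
  "open U \<Longrightarrow> smooth_fun A U H \<Longrightarrow> smooth_fun A U K \<Longrightarrow> smooth_fun A U (\<lambda>q. H q + K q)"
  by (rule smooth_funI, rule smooth_on_add)
    (auto intro: open_chart_image_Int smooth_funD)

lemma smooth_fun_continuous:
  assumes "open U" "smooth_fun A U H"
  shows "continuous_on U H"
proof (rule continuous_at_imp_continuous_on, rule ballI)
  fix p assume p: "p \<in> U"
  let ?N = "U \<inter> dom_at p"
  have "continuous_on ?N ((\<lambda>x. H (inv_into (dom_at p) (coord_at p) x)) \<circ> coord_at p)"
    by (rule continuous_on_compose[OF continuous_on_subset[OF chart_props(3)[OF chart_at_in]]
          smooth_on_continuous[OF smooth_funD[OF assms(2) chart_at_in]]]) auto
  then have "continuous_on ?N H"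
    by (rule continuous_on_eq) (simp add: chart_inv[OF chart_at_in])
  moreover have "open ?N" "p \<in> ?N"
    using assms(1) chart_props(1)[OF chart_at_in] p chart_at_mem by auto
  ultimately show "isCont H p" using continuous_on_eq_continuous_at by blast
qed

lemma tdiff_compose:
  assumes "mdiff H p" "g differentiable (at (H p))"
  shows "tdiff A (\<lambda>q. g (H q)) p v = fd g (H p) (tdiff A H p v)"
  using tdiffI[OF has_derivative_compose[OF has_tdiff[OF assms(1)]], of g] fd_works[OF assms(2)]
  by simp

text \<open>Complex linearity of \<open>tdiff\<close> concerns a single chart at each point; it
  passes to every other chart because chart differentials are bijective and commute with
  \<open>Jn\<close>.\<close>

lemma holo_funI:
  assumes H: "smooth_fun A U H" and J: "\<And>q v. q \<in> U \<Longrightarrow> tdiff A H q (Jn v) = J (tdiff A H q v)"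
  shows "holo_fun A J U H"
  unfolding holo_fun_def holo_on_def
proof (intro ballI, unfold split_paired_all, intro case_prodI conjI ballI allI)
  fix V c assume V: "(V, c) \<in> A"
  show "smooth_on (H \<circ> inv_into V c) (c ` (U \<inter> V))" by (rule smooth_fun_chart[OF H V])
  fix x v assume "x \<in> c ` (U \<inter> V)"
  then obtain q where q: "q \<in> U" "q \<in> V" "x = c q" by auto
  obtain u where v: "v = tdiff A c q u"
    using tdiff_chart_bij(1)[OF V q(2)] by (metis bij_pointE)
  note fd = tdiff_chart[OF V q(2) smooth_fun_mdiff[OF H q(1)], symmetric]
  show "fd (H \<circ> inv_into V c) x (Jn v) = J (fd (H \<circ> inv_into V c) x v)"
    unfolding v tdiff_chart_bij(2)[OF V q(2), symmetric] q(3) fd by (rule J[OF q(1)])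
qed

lemma holo_funD:
  assumes "holo_fun A J U H"
  shows "smooth_fun A U H" and "q \<in> U \<Longrightarrow> tdiff A H q (Jn v) = J (tdiff A H q v)"
proof -
  have h: "holo_on Jn J (H \<circ> inv_into V c) (c ` (U \<inter> V))" if "(V, c) \<in> A" for V c
    using assms that unfolding holo_fun_def by blast
  then show "smooth_fun A U H" unfolding smooth_fun_def holo_on_def by blast
  assume "q \<in> U"
  then show "tdiff A H q (Jn v) = J (tdiff A H q v)"
    using h[OF chart_at_in, of q] chart_at_mem[of q]
    unfolding tdiff_eq par_at_def holo_on_def by (simp add: o_def)
qed

section \<open>Vector fields and the Lie bracket\<close>

lemma smooth_vfD:
  "smooth_vf A U X \<Longrightarrow> (V, d) \<in> A \<Longrightarrow> smooth_fun A (U \<inter> V) (\<lambda>q. tdiff A d q (X q))"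
  unfolding smooth_vf_def by auto

lemma smooth_vf_chart:
  "smooth_vf A U X \<Longrightarrow> (V, d) \<in> A \<Longrightarrow>
    smooth_on (\<lambda>x. tdiff A d (inv_into V d x) (X (inv_into V d x))) (d ` (U \<inter> V))"
  using smooth_funD[OF smooth_vfD] by fastforce

lemma tdiff_vf_chart:
  assumes "(V, d) \<in> A" "x \<in> d ` (U \<inter> V)" "smooth_fun A U H"
  shows "tdiff A H (inv_into V d x) u =
    fd (\<lambda>x. H (inv_into V d x)) x (tdiff A d (inv_into V d x) u)"
proof -
  obtain p where p: "p \<in> U" "p \<in> V" "x = d p" using assms(2) by auto
  then show ?thesis
    using tdiff_chart[OF assms(1) p(2) smooth_fun_mdiff[OF assms(3) p(1)]] chart_inv[OF assms(1)]
    by (simp add: o_def)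
qed

lemma smooth_fun_tdiff:
  assumes "open U" "smooth_fun A U H" "smooth_vf A U X"
  shows "smooth_fun A U (\<lambda>q. tdiff A H q (X q))"
proof (rule smooth_funI)
  fix V d assume V: "(V, d) \<in> A"
  have o: "open (d ` (U \<inter> V))" by (rule open_chart_image_Int[OF V assms(1)])
  show "smooth_on (\<lambda>x. tdiff A H (inv_into V d x) (X (inv_into V d x))) (d ` (U \<inter> V))"
    by (rule smooth_on_cong[OF o _
        smooth_on_fd_apply[OF o smooth_funD[OF assms(2) V] smooth_vf_chart[OF assms(3) V]]])
      (simp add: tdiff_vf_chart[OF V _ assms(2)])
qed

text \<open>The coordinate formula for the bracket agrees with \<open>[X, Y]H = X(YH) - Y(XH)\<close>; this is where the
  symmetry of second derivatives enters.\<close>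

lemma tdiff_lie_bracket:
  assumes U: "open U" "p \<in> U" and H: "smooth_fun A U (H :: 'm \<Rightarrow> 'b::euclidean_space)"
    and X: "smooth_vf A U X" and Y: "smooth_vf A U Y"
  shows "tdiff A H p (lie_bracket A X Y p) =
    tdiff A (\<lambda>q. tdiff A H q (Y q)) p (X p) - tdiff A (\<lambda>q. tdiff A H q (X q)) p (Y p)"
proof -
  let ?c = "coord_at p" and ?S = "coord_at p ` (U \<inter> dom_at p)"
  define h where "h x = H (par_at p x)" for x
  define cv where "cv Z x = tdiff A ?c (par_at p x) (Z (par_at p x))" for Z :: "'m \<Rightarrow> complex ^ 'n" and x
  have S: "open ?S" "?c p \<in> ?S"
    using open_chart_image_Int[OF chart_at_in U(1)] U(2) chart_at_mem by auto
  have h: "smooth_on h ?S"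
    using smooth_funD[OF H chart_at_in] by (simp add: h_def[abs_def] par_at_def)
  have cv: "smooth_on (cv Z) ?S" if "smooth_vf A U Z" for Z
    using smooth_vf_chart[OF that chart_at_in] by (simp add: cv_def[abs_def] par_at_def)
  have cv0: "cv Z (?c p) = Z p" for Z
    by (simp add: cv_def tdiff_coord_at)
  have lin: "linear (fd h (?c p))"
    using linear_frechet_derivative[OF smooth_on_differentiable[OF h S(2)]] .
  \<comment> \<open>In the coordinates at \<open>p\<close> the second derivative of \<open>h\<close>
    splits off. It is symmetric in the two directions and cancels in the difference; the other terms
    make up the bracket.\<close>
  have *: "tdiff A (\<lambda>q. tdiff A H q (Z q)) p v = fd (\<lambda>x. fd h x (Z p)) (?c p) v + fd h (?c p) (fd (cv Z) (?c p) v)"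
    if Z: "smooth_vf A U Z" for Z v
  proof -
    have "tdiff A (\<lambda>q. tdiff A H q (Z q)) p = fd (\<lambda>x. fd h x (cv Z x)) (?c p)"
      unfolding tdiff_eq[of "\<lambda>q. tdiff A H q (Z q)"]
      by (rule fd_cong[OF S])
        (simp add: tdiff_vf_chart[OF chart_at_in _ H] h_def[abs_def] cv_def par_at_def)
    then show ?thesis using fd_fd_apply[OF S h cv[OF Z]] by (simp add: cv0)
  qed
  have br: "lie_bracket A X Y p = fd (cv Y) (?c p) (X p) - fd (cv X) (?c p) (Y p)"
    by (simp add: lie_bracket_def Let_def tdiff_eq[of _ p] cv_def[abs_def] coord_at_def[symmetric])
  have "tdiff A H p = fd h (?c p)" by (simp add: tdiff_eq h_def[abs_def])
  then show ?thesis
    using second_derivative_symmetric[OF S h, of "X p" "Y p"]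
    by (simp add: br linear_diff[OF lin] *[OF X] *[OF Y])
qed

section \<open>Local diffeomorphisms and coordinate systems\<close>

text \<open>Asks for a continuous inverse and bijective differentials; smoothness of the inverse is
  then a consequence, see \<open>diffeo_dom_inverse\<close>. In this form the notion passes easily
  to smaller open sets.\<close>

definition diffeo_dom :: "('m \<Rightarrow> 'b::euclidean_space) \<Rightarrow> 'm set \<Rightarrow> bool" where
  "diffeo_dom H U \<longleftrightarrow> open U \<and> inj_on H U \<and> open (H ` U) \<and> continuous_on (H ` U) (inv_into U H) \<and>
     smooth_fun A U H \<and> (\<forall>q\<in>U. bij (tdiff A H q))"

lemma inv_into_subset_eq: "inj_on H U \<Longrightarrow> T \<subseteq> U \<Longrightarrow> y \<in> H ` T \<Longrightarrow> inv_into T H y = inv_into U H y"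
  by (metis f_inv_into_f inj_on_subset inv_into_f_eq inv_into_into subsetD)

text \<open>The image of \<open>T\<close> is the preimage of \<open>T\<close> under the continuous
  inverse, hence open.\<close>

lemma diffeo_dom_subset:
  assumes "diffeo_dom H U" "open T" "T \<subseteq> U"
  shows "diffeo_dom H T"
proof -
  have H: "open U" "inj_on H U" "open (H ` U)" "continuous_on (H ` U) (inv_into U H)"
    "smooth_fun A U H" "\<And>q. q \<in> U \<Longrightarrow> bij (tdiff A H q)"
    using assms(1) by (auto simp: diffeo_dom_def)
  have "H ` T = H ` U \<inter> inv_into U H -` T"
    using assms(3) H(2) by (auto 4 4 simp: subset_iff)
  then have "open (H ` T)"
    using continuous_open_preimage[OF H(4,3) assms(2)] by simp
  moreover have "continuous_on (H ` T) (inv_into T H)"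
    by (rule continuous_on_eq[OF continuous_on_subset[OF H(4) image_mono[OF assms(3)]]])
      (simp add: inv_into_subset_eq[OF H(2) assms(3)])
  ultimately show ?thesis
    using assms(2,3) H inj_on_subset smooth_fun_subset unfolding diffeo_dom_def by blast
qed

lemma diffeo_dom_exists:
  fixes H :: "'m \<Rightarrow> 'b::euclidean_space"
  assumes H: "smooth_fun A UNIV H" and inj: "inj (tdiff A H p)"
    and dim: "DIM(complex ^ 'n) = DIM('b)"
  shows "\<exists>U. p \<in> U \<and> diffeo_dom H U"
proof -
  let ?V = "dom_at p" and ?c = "coord_at p" and ?f = "\<lambda>x. H (par_at p x)"
  have f: "smooth_on ?f (?c ` ?V)"
    using smooth_funD[OF H chart_at_in] by (simp add: par_at_def)
  have "inj (fd ?f (?c p))" using inj by (simp add: tdiff_eq)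
  then obtain S where S: "open S" "?c p \<in> S" "S \<subseteq> ?c ` ?V" "open (?f ` S)" "inj_on ?f S"
    "continuous_on (?f ` S) (inv_into S ?f)" "\<And>x. x \<in> S \<Longrightarrow> bij (fd ?f x)"
    using smooth_local_inverse[OF chart_props(2)[OF chart_at_in] _ f _ dim, of "?c p"] chart_at_mem
    by auto
  define U where "U = par_at p ` S"
  have cU: "?c (par_at p x) = x" if "x \<in> S" for x
    using that S(3) by (metis f_inv_into_f par_at_def subsetD)
  have UV: "U \<subseteq> ?V" using S(3) by (auto simp: U_def par_at_def intro: inv_into_into)
  have U: "U = ?V \<inter> ?c -` S"
    using UV cU chart_inv[OF chart_at_in] by (auto simp: U_def par_at_def image_iff) metis
  have HU: "H ` U = ?f ` S" by (simp add: U_def image_image)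
  have inj': "inj_on H U"
  proof (rule inj_onI)
    fix q r assume "q \<in> U" "r \<in> U" "H q = H r"
    then show "q = r" using inj_onD[OF S(5)] unfolding U_def by blast
  qed
  have "continuous_on (?f ` S) (par_at p \<circ> inv_into S ?f)"
  proof (intro continuous_on_compose S(6))
    show "continuous_on (inv_into S ?f ` ?f ` S) (par_at p)"
      using continuous_on_subset[OF chart_props(4)[OF chart_at_in] S(3)] S(5)
      by (simp add: par_at_def[abs_def])
  qed
  moreover have "(par_at p \<circ> inv_into S ?f) y = inv_into U H y" if "y \<in> ?f ` S" for y
  proof -
    obtain x where x: "x \<in> S" "y = ?f x" using \<open>y \<in> ?f ` S\<close> by blast
    have "inv_into S ?f y = x" unfolding x(2) by (rule inv_into_f_f[OF S(5) x(1)])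
    then show ?thesis using x inj' by (simp add: U_def)
  qed
  ultimately have "continuous_on (?f ` S) (inv_into U H)" by (rule continuous_on_eq)
  moreover have "bij (tdiff A H q)" if q: "q \<in> U" for q
  proof -
    have "tdiff A H q = fd ?f (?c q) \<circ> tdiff A ?c q"
      using tdiff_chart[OF chart_at_in _ smooth_fun_mdiff[OF H], of q p] q UV
      by (auto simp: fun_eq_iff par_at_def o_def)
    moreover have "bij (fd ?f (?c q))" using q U S(7) by auto
    ultimately show ?thesis using tdiff_chart_bij(1)[OF chart_at_in, of q p] q UV
      by (auto intro: bij_comp)
  qed
  moreover have "open U"
    using continuous_open_preimage[OF chart_props(3,1)[OF chart_at_in] S(1)] U by simp
  moreover have "p \<in> U" using U S(2) chart_at_mem by auto
  ultimately show ?thesis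
    using inj' S(4) HU smooth_fun_subset[OF H] unfolding diffeo_dom_def by auto
qed

text \<open>In a chart \<open>c\<close> near \<open>q\<close>, K o H^-1 = (K o c^-1) o (c o H^-1),
  and c o H^-1 is inverse to the Euclidean map H o c^-1, to which \<open>smooth_on_inverse\<close>
  applies.\<close>

lemma diffeo_dom_inverse:
  fixes K :: "'m \<Rightarrow> 'c::euclidean_space"
  assumes U: "diffeo_dom H U" and K: "smooth_fun A U K"
  shows "smooth_on (K \<circ> inv_into U H) (H ` U)"
    and "q \<in> U \<Longrightarrow> ((K \<circ> inv_into U H) has_derivative (\<lambda>v. tdiff A K q (inv (tdiff A H q) v))) (at (H q))"
proof -
  have H: "open U" "inj_on H U" "open (H ` U)" "continuous_on (H ` U) (inv_into U H)"
    "smooth_fun A U H" "\<And>q. q \<in> U \<Longrightarrow> bij (tdiff A H q)"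
    using U by (auto simp: diffeo_dom_def)
  have *: "\<exists>T. open T \<and> H q \<in> T \<and> smooth_on (K \<circ> inv_into U H) T \<and>
    ((K \<circ> inv_into U H) has_derivative (\<lambda>v. tdiff A K q (inv (tdiff A H q) v))) (at (H q))"
    if q: "q \<in> U" for q
  proof -
    define V where "V = dom_at q"
    define c where "c = coord_at q"
    have V: "(V, c) \<in> A" "q \<in> V" using chart_at_in chart_at_mem by (auto simp: V_def c_def)
    let ?S = "c ` (U \<inter> V)" and ?f = "\<lambda>x. H (inv_into V c x)" and ?k = "\<lambda>x. K (inv_into V c x)"
    let ?g = "\<lambda>y. c (inv_into U H y)"
    have S: "open ?S" by (rule open_chart_image_Int[OF V(1) H(1)])
    have f: "smooth_on ?f ?S" and k: "smooth_on ?k ?S"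
      using smooth_funD[OF H(5) V(1)] smooth_funD[OF K V(1)] .
    have fS: "?f ` ?S = H ` (U \<inter> V)"
      by (auto simp: image_image chart_inv[OF V(1)] intro!: image_eqI)
    have T: "open (?f ` ?S)"
      unfolding fS using diffeo_dom_subset[OF U, of "U \<inter> V"] H(1) chart_props(1)[OF V(1)]
      by (auto simp: diffeo_dom_def)
    have tH: "tdiff A H r = fd ?f (c r) \<circ> tdiff A c r" if "r \<in> U \<inter> V" for r
      using tdiff_chart[OF V(1) _ smooth_fun_mdiff[OF H(5)]] that by (auto simp: o_def)
    have bij: "bij (fd ?f x)" if "x \<in> ?S" for x
    proof -
      obtain r where r: "r \<in> U" "r \<in> V" "x = c r" using \<open>x \<in> ?S\<close> by blast
      have "fd ?f x = tdiff A H r \<circ> inv (tdiff A c r)"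
        using tH[of r] r tdiff_chart_bij(1)[OF V(1) r(2)] by (simp add: o_assoc[symmetric] bij_is_surj surj_iff[THEN iffD1])
      then show ?thesis
        using H(6)[OF r(1)] tdiff_chart_bij(1)[OF V(1) r(2)] by (simp add: bij_comp bij_imp_bij_inv)
    qed
    have "continuous_on (H ` (U \<inter> V)) (c \<circ> inv_into U H)"
      using H(2) by (intro continuous_on_compose continuous_on_subset[OF H(4)]
          continuous_on_subset[OF chart_props(3)[OF V(1)]]) auto
    then have g: "continuous_on (?f ` ?S) ?g" unfolding fS by (simp add: o_def)
    have gf: "?g (?f x) = x" if "x \<in> ?S" for x
      using that H(2) chart_inv[OF V(1)] by auto
    note inverse = smooth_on_inverse[OF S f T bij g gf]
    have eq: "?k (?g y) = (K \<circ> inv_into U H) y" if "y \<in> ?f ` ?S" for y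
      using that H(2) chart_inv[OF V(1)] unfolding fS by auto
    have "smooth_on (?k \<circ> ?g) (?f ` ?S)"
      using inverse(1)[OF _ _] k gf by (intro smooth_on_compose[OF T S]) auto
    then have sm: "smooth_on (K \<circ> inv_into U H) (?f ` ?S)"
      by (rule smooth_on_cong[OF T, rotated]) (use eq in auto)
    have cq: "c q \<in> ?S" "?f (c q) = H q" "?g (H q) = c q"
      using q V(2) chart_inv[OF V] H(2) by auto
    have "(?g has_derivative inv (fd ?f (c q))) (at (H q))"
      using inverse(2)[OF _ _ cq(1)] cq(2) by simp
    from has_derivative_compose[OF this, of ?k] fd_works[OF smooth_on_differentiable[OF k cq(1)]]
    have "((\<lambda>y. ?k (?g y)) has_derivative (\<lambda>v. fd ?k (c q) (inv (fd ?f (c q)) v))) (at (H q))"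
      using cq(3) by simp
    then have "((K \<circ> inv_into U H) has_derivative (\<lambda>v. fd ?k (c q) (inv (fd ?f (c q)) v))) (at (H q))"
      by (rule has_derivative_transform_within_open[OF _ T _ eq]) (use cq in force)
    moreover have "fd ?k (c q) (inv (fd ?f (c q)) v) = tdiff A K q (inv (tdiff A H q) v)" for v
    proof -
      have "inv (fd ?f (c q)) v = tdiff A c q (inv (tdiff A H q) v)"
      proof (rule inv_f_eq)
        show "inj (fd ?f (c q))" using bij[OF cq(1)] by (rule bij_is_inj)
        have "fd ?f (c q) (tdiff A c q (inv (tdiff A H q) v)) = tdiff A H q (inv (tdiff A H q) v)"
          using tH[of q] q V(2) by simp
        also have "\<dots> = v" using H(6)[OF q] by (simp add: bij_is_surj surj_f_inv_f)
        finally show "fd ?f (c q) (tdiff A c q (inv (tdiff A H q) v)) = v" .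
      qed
      then show ?thesis
        using tdiff_chart[OF V smooth_fun_mdiff[OF K q]] by (simp add: o_def)
    qed
    ultimately show ?thesis
      using T sm cq by (intro exI[of _ "?f ` ?S"]) force
  qed
  show "smooth_on (K \<circ> inv_into U H) (H ` U)"
    by (rule smooth_on_local) (use * in blast)
  show "q \<in> U \<Longrightarrow> ((K \<circ> inv_into U H) has_derivative (\<lambda>v. tdiff A K q (inv (tdiff A H q) v))) (at (H q))"
    using * by blast
qed

lemma diffeo_dom_chart:
  assumes U: "diffeo_dom H U" and V: "(V, c) \<in> A"
  shows "smooth_on (c \<circ> inv_into U H) (H ` (U \<inter> V))"
    and "q \<in> U \<inter> V \<Longrightarrow> ((c \<circ> inv_into U H) has_derivative (\<lambda>v. tdiff A c q (inv (tdiff A H q) v))) (at (H q))"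
proof -
  have UV: "diffeo_dom H (U \<inter> V)"
    using U chart_props(1)[OF V] by (intro diffeo_dom_subset[OF U]) (auto simp: diffeo_dom_def)
  have op: "open (H ` (U \<inter> V))" and inj: "inj_on H U" using UV U by (auto simp: diffeo_dom_def)
  have eq: "(c \<circ> inv_into (U \<inter> V) H) y = (c \<circ> inv_into U H) y" if "y \<in> H ` (U \<inter> V)" for y
    using that inv_into_subset_eq[OF inj, of "U \<inter> V"] by auto
  have c: "smooth_fun A (U \<inter> V) c"
    using smooth_fun_subset[OF chart_smooth_fun[OF V]] by simp
  show "smooth_on (c \<circ> inv_into U H) (H ` (U \<inter> V))"
    using smooth_on_cong[OF op eq diffeo_dom_inverse(1)[OF UV c]] .
  show "((c \<circ> inv_into U H) has_derivative (\<lambda>v. tdiff A c q (inv (tdiff A H q) v))) (at (H q))"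
    if "q \<in> U \<inter> V"
    using has_derivative_transform_within_open[OF diffeo_dom_inverse(2)[OF UV c that] op _ eq] that
    by blast
qed

lemma diffeo_dom_smooth_coords:
  assumes "diffeo_dom H U"
  shows "smooth_coords A U H"
proof -
  have H: "open U" "inj_on H U" "open (H ` U)" "continuous_on (H ` U) (inv_into U H)"
    "smooth_fun A U H"
    using assms by (auto simp: diffeo_dom_def)
  then have "homeomorphism U (H ` U) H (inv_into U H)"
    by (simp add: homeomorphism_def smooth_fun_continuous)
  then show ?thesis
    using H diffeo_dom_chart(1)[OF assms] unfolding smooth_coords_def by blast
qed

text \<open>The inverse of a complex linear bijection is complex linear, which upgrades the smooth
  inverse to a holomorphic one.\<close>

lemma diffeo_dom_holo_coords:
  fixes z :: "'m \<Rightarrow> complex ^ 'n"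
  assumes U: "diffeo_dom z U" and z: "holo_fun A Jn U z"
    and J: "\<And>q v. q \<in> U \<Longrightarrow> tdiff A z q (Jn v) = Jn (tdiff A z q v)"
  shows "holo_coords A U z"
proof -
  have "holo_on Jn Jn (c \<circ> inv_into U z) (z ` (U \<inter> V))" if V: "(V, c) \<in> A" for V c
    unfolding holo_on_def
  proof (intro conjI ballI allI)
    show "smooth_on (c \<circ> inv_into U z) (z ` (U \<inter> V))"
      by (rule diffeo_dom_chart(1)[OF U V])
    fix y v assume "y \<in> z ` (U \<inter> V)"
    then obtain q where q: "q \<in> U" "q \<in> V" "y = z q" by auto
    have bij: "bij (tdiff A z q)" using U q by (auto simp: diffeo_dom_def)
    have "inv (tdiff A z q) (Jn v) = Jn (inv (tdiff A z q) v)"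
      by (rule inv_f_eq) (use bij in \<open>simp_all add: bij_is_inj J[OF q(1)] bij_is_surj surj_f_inv_f\<close>)
    then show "fd (c \<circ> inv_into U z) y (Jn v) = Jn (fd (c \<circ> inv_into U z) y v)"
      using fd_eq[OF diffeo_dom_chart(2)[OF U V]] q tdiff_chart_bij(2)[OF V q(2)] by auto
  qed
  then show ?thesis
    using diffeo_dom_smooth_coords[OF U] z unfolding smooth_coords_def holo_coords_def by blast
qed

text \<open>Convexity of coordinate balls turns a zero derivative into local constancy, which
  spreads over the connected set.\<close>

lemma tdiff_zero_constant:
  assumes V: "open V" "connected V" and K: "smooth_fun A V (K :: 'm \<Rightarrow> 'b::euclidean_space)"
    and zero: "\<And>p v. p \<in> V \<Longrightarrow> tdiff A K p v = 0" and pq: "p \<in> V" "q \<in> V"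
  shows "K p = K q"
proof (rule connected_local_const[OF V(2) pq], rule ballI)
  fix r assume r: "r \<in> V"
  let ?c = "coord_at r" and ?S = "coord_at r ` (V \<inter> dom_at r)" and ?k = "\<lambda>x. K (par_at r x)"
  have S: "open ?S" "?c r \<in> ?S"
    using open_chart_image_Int[OF chart_at_in V(1)] r chart_at_mem by auto
  then obtain e where e: "e > 0" "ball (?c r) e \<subseteq> ?S" using open_contains_ball by blast
  have "(?k has_derivative (\<lambda>v. 0)) (at x within ball (?c r) e)" if x: "x \<in> ball (?c r) e" for x
  proof -
    obtain s where s: "s \<in> V" "s \<in> dom_at r" "x = ?c s" using x e(2) by auto
    have "?k differentiable (at x)"
      using smooth_on_differentiable[OF smooth_funD[OF K chart_at_in[of r]]] x e(2)
      by (auto simp: par_at_def)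
    moreover have "fd ?k x v = 0" for v
    proof -
      obtain u where "v = tdiff A ?c s u"
        using tdiff_chart_bij(1)[OF chart_at_in s(2)] by (metis bij_pointE)
      then show ?thesis
        using tdiff_vf_chart[OF chart_at_in _ K, of x r u] zero[OF s(1)] x e(2) s(3)
          chart_inv[OF chart_at_in s(2)] by (auto simp: par_at_def)
    qed
    moreover from this have "fd ?k x = (\<lambda>v. 0)" by (simp add: fun_eq_iff)
    ultimately show ?thesis using fd_works[of ?k x] by (simp add: has_derivative_at_withinI)
  qed
  then have const: "?k x = ?k (?c r)" if "x \<in> ball (?c r) e" for x
    using has_derivative_zero_constant[OF convex_ball, of "?c r" e ?k] that e(1)
    by (metis centre_in_ball)
  have "open (dom_at r \<inter> ?c -` ball (?c r) e)"
    by (rule continuous_open_preimage[OF chart_props(3,1)[OF chart_at_in] open_ball])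
  moreover have "r \<in> dom_at r \<inter> ?c -` ball (?c r) e" using e(1) chart_at_mem by simp
  ultimately have "eventually (\<lambda>s. s \<in> dom_at r \<inter> ?c -` ball (?c r) e) (at r within V)"
    by (metis eventually_at_topological)
  then show "eventually (\<lambda>s. K r = K s) (at r within V)"
  proof eventually_elim
    case (elim s)
    then show ?case using const[of "?c s"] chart_inv[OF chart_at_in, of s r] by (simp add: par_at_def[symmetric])
  qed
qed

end

section \<open>The flat connection defined by a local diffeomorphism into a vector space\<close>

locale etale_map = complex_manifold A
  for A :: "('m::{t2_space,second_countable_topology}, 'n::finite) chart set" +
  fixes F :: "'m \<Rightarrow> 'e::euclidean_space"
  assumes smooth_F: "smooth_fun A UNIV F" and bij_F: "bij (tdiff A F p)"
begin

section \<open>The frame given by the differential\<close>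

lemma mdiff_F: "mdiff F p"
  using smooth_fun_mdiff[OF smooth_F] by simp

lemma linear_frame: "linear (tdiff A F p)"
  by (rule tdiff_linear[OF mdiff_F])

lemma frame_eqD: "tdiff A F p u = tdiff A F p v \<Longrightarrow> u = v"
  using bij_F by (metis bij_pointE)

lemma frame_inv: "tdiff A F p (inv (tdiff A F p) w) = w"
  using bij_F by (simp add: bij_is_surj surj_f_inv_f)

text \<open>Allows frame components to replace chart components. For the converse, the chart
  components are recovered by the inverse of the derivative of F in that chart, a smooth family of
  linear maps.\<close>

lemma smooth_vf_iff:
  assumes U: "open U"
  shows "smooth_vf A U X \<longleftrightarrow> smooth_fun A U (\<lambda>q. tdiff A F q (X q))"
proof
  assume "smooth_vf A U X"
  then show "smooth_fun A U (\<lambda>q. tdiff A F q (X q))"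
    by (rule smooth_fun_tdiff[OF U smooth_fun_subset[OF smooth_F subset_UNIV]])
next
  assume X: "smooth_fun A U (\<lambda>q. tdiff A F q (X q))"
  show "smooth_vf A U X"
    unfolding smooth_vf_def
  proof (intro ballI, unfold split_paired_all, intro case_prodI smooth_funI)
    fix V d V' d' assume V: "(V, d) \<in> A" and V': "(V', d') \<in> A"
    let ?S = "d' ` (U \<inter> V')" and ?T = "d' ` ((U \<inter> V) \<inter> V')" and ?p = "inv_into V' d'"
    let ?f = "\<lambda>x. F (?p x)"
    have S: "open ?S" and T: "open ?T"
      using open_chart_image_Int[OF V'] U chart_props(1)[OF V] by auto
    have f: "smooth_on ?f ?S"
      using smooth_funD[OF smooth_fun_subset[OF smooth_F subset_UNIV] V'] .
    have fd: "tdiff A F (?p x) u = fd ?f x (tdiff A d' (?p x) u)" if "x \<in> ?S" for x u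
      by (rule tdiff_vf_chart[OF V' that smooth_fun_subset[OF smooth_F subset_UNIV]])
    have bij: "bij (fd ?f x)" if "x \<in> ?S" for x
    proof -
      have b: "bij (tdiff A d' (?p x))"
        using tdiff_chart_bij(1)[OF V'] that by (auto simp: inv_into_into)
      have "tdiff A F (?p x) = fd ?f x \<circ> tdiff A d' (?p x)" using fd[OF that] by (auto simp: o_def)
      then have "fd ?f x = tdiff A F (?p x) \<circ> inv (tdiff A d' (?p x))"
        using b by (simp add: o_assoc[symmetric] bij_is_surj surj_iff[THEN iffD1])
      then show ?thesis using bij_F b by (simp add: bij_comp bij_imp_bij_inv)
    qed
    have lin: "linear (fd ?f x)" if "x \<in> ?S" for x
      by (rule linear_frechet_derivative[OF smooth_on_differentiable[OF f that]])
    have "smooth_on (\<lambda>x. inv (fd ?f x) (tdiff A F (?p x) (X (?p x)))) ?S"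
      by (rule smooth_on_inverse_family[OF S lin bij smooth_on_fd[OF f] smooth_funD[OF X V']])
    then have "smooth_on (\<lambda>x. tdiff A d' (?p x) (X (?p x))) ?S"
    proof (rule smooth_on_cong[OF S, rotated])
      show "inv (fd ?f x) (tdiff A F (?p x) (X (?p x))) = tdiff A d' (?p x) (X (?p x))" if "x \<in> ?S" for x
        unfolding fd[OF that] using bij[OF that] by (simp add: bij_is_inj)
    qed
    \<comment> \<open>Up to here the components refer to \<open>d'\<close>; what is required are the
      components in \<open>d\<close>, read in the coordinates \<open>d'\<close>. The transition map
      converts them.\<close>
    then have "smooth_on (\<lambda>x. tdiff A d' (?p x) (X (?p x))) ?T"
      by (rule smooth_on_subset) auto
    moreover have d: "smooth_fun A (U \<inter> V) d"
      using smooth_fun_subset[OF chart_smooth_fun[OF V]] by simp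
    ultimately have "smooth_on (\<lambda>x. fd (\<lambda>x. d (?p x)) x (tdiff A d' (?p x) (X (?p x)))) ?T"
      by (intro smooth_on_fd_apply[OF T smooth_funD[OF d V']])
    then show "smooth_on (\<lambda>x. tdiff A d (?p x) (X (?p x))) ?T"
      by (rule smooth_on_cong[OF T, rotated]) (simp add: tdiff_vf_chart[OF V' _ d])
  qed
qed

section \<open>The pulled back connection\<close>

text \<open>The pull back of the trivial connection of the target space. The \<open>else\<close>
  branch is the junk value that \<open>connection\<close> prescribes.\<close>

definition flat_conn :: "('m, 'n) conn" where
  "flat_conn p v Y = (if \<exists>U. open U \<and> p \<in> U \<and> smooth_vf A U Y
     then inv (tdiff A F p) (tdiff A (\<lambda>q. tdiff A F q (Y q)) p v) else 0)"

text \<open>The working form of the definition: identities between tangent vectors are proved by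
  applying the injective map \<open>tdiff A F p\<close> and rewriting with this rule.\<close>

lemma frame_flat_conn:
  assumes "open U" "p \<in> U" "smooth_vf A U Y"
  shows "tdiff A F p (flat_conn p v Y) = tdiff A (\<lambda>q. tdiff A F q (Y q)) p v"
proof -
  have "\<exists>U. open U \<and> p \<in> U \<and> smooth_vf A U Y" using assms by blast
  then show ?thesis by (simp add: flat_conn_def frame_inv)
qed

lemma mdiff_frame:
  "open U \<Longrightarrow> smooth_vf A U Y \<Longrightarrow> p \<in> U \<Longrightarrow> mdiff (\<lambda>q. tdiff A F q (Y q)) p"
  using smooth_vf_iff smooth_fun_mdiff by blast

lemma smooth_vf_flat_conn:
  assumes U: "open U" and X: "smooth_vf A U X" and Y: "smooth_vf A U Y"
  shows "smooth_vf A U (\<lambda>q. flat_conn q (X q) Y)"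
proof -
  have "smooth_fun A U (\<lambda>q. tdiff A (\<lambda>q. tdiff A F q (Y q)) q (X q))"
    using smooth_fun_tdiff[OF U _ X] Y smooth_vf_iff[OF U] by blast
  then show ?thesis
    unfolding smooth_vf_iff[OF U]
    by (rule smooth_fun_cong[OF U, rotated]) (simp add: frame_flat_conn[OF U _ Y])
qed

lemma connection_flat_conn: "connection A flat_conn"
  unfolding connection_def
proof (intro conjI allI impI ballI)
  fix U Y p assume UY: "open U \<and> smooth_vf A U Y" and p: "p \<in> U"
  then have U: "open U" and Y: "smooth_vf A U Y" by auto
  note mY = mdiff_frame[OF U Y p] and fY = frame_flat_conn[OF U p Y]
  note sY = Y[unfolded smooth_vf_iff[OF U]]
  show "linear (\<lambda>v. flat_conn p v Y)"
    by (rule linearI; rule frame_eqD[of p])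
      (simp_all add: fY linear_add[OF linear_frame] linear_scale[OF linear_frame]
        linear_add[OF tdiff_linear[OF mY]] linear_scale[OF tdiff_linear[OF mY]])
  show "flat_conn p v (\<lambda>q. Y q + Z q) = flat_conn p v Y + flat_conn p v Z"
    if Z: "smooth_vf A U Z" for Z v
  proof -
    have "smooth_vf A U (\<lambda>q. Y q + Z q)"
      unfolding smooth_vf_iff[OF U] linear_add[OF linear_frame]
      using smooth_fun_add[OF U sY] Z smooth_vf_iff[OF U] by blast
    from frame_flat_conn[OF U p this, of v] show ?thesis
      by (intro frame_eqD[of p])
        (simp add: linear_add[OF linear_frame] fY frame_flat_conn[OF U p Z]
          tdiff_add[OF mY mdiff_frame[OF U Z p]])
  qed
  show "flat_conn p v (\<lambda>q. f q *\<^sub>R Y q) = tdiff A f p v *\<^sub>R Y p + f p *\<^sub>R flat_conn p v Y"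
    if f: "smooth_fun A U f" for f :: "'m \<Rightarrow> real" and v
  proof -
    have "smooth_vf A U (\<lambda>q. f q *\<^sub>R Y q)"
      unfolding smooth_vf_iff[OF U] linear_scale[OF linear_frame]
      by (rule smooth_fun_bilinear[OF bounded_bilinear_scaleR U f sY])
    from frame_flat_conn[OF U p this, of v] show ?thesis
      by (intro frame_eqD[of p])
        (simp add: linear_add[OF linear_frame] linear_scale[OF linear_frame] fY
          tdiff_bilinear[OF bounded_bilinear_scaleR smooth_fun_mdiff[OF f p] mY])
  qed
  show "flat_conn p v Z = flat_conn p v Y" if Z: "\<forall>q\<in>U. Z q = Y q" for Z v
  proof -
    have "smooth_vf A U Z"
      unfolding smooth_vf_iff[OF U] by (rule smooth_fun_cong[OF U _ sY]) (simp add: Z)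
    from frame_flat_conn[OF U p this, of v] show ?thesis
      using tdiff_cong[OF U p, of "\<lambda>q. tdiff A F q (Z q)" "\<lambda>q. tdiff A F q (Y q)"] Z
      by (intro frame_eqD[of p]) (simp add: fY)
  qed
next
  fix U Y X assume "open U \<and> smooth_vf A U Y" "smooth_vf A U X"
  then show "smooth_vf A U (\<lambda>p. flat_conn p (X p) Y)"
    by (intro smooth_vf_flat_conn) auto
next
  fix p v Y assume "\<nexists>U. open U \<and> p \<in> U \<and> smooth_vf A U Y"
  then show "flat_conn p v Y = 0" unfolding flat_conn_def by (simp only: if_False)
qed

lemma frame_lie_bracket:
  assumes "open U" "p \<in> U" "smooth_vf A U X" "smooth_vf A U Y"
  shows "tdiff A F p (lie_bracket A X Y p) =
    tdiff A (\<lambda>q. tdiff A F q (Y q)) p (X p) - tdiff A (\<lambda>q. tdiff A F q (X q)) p (Y p)"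
  by (rule tdiff_lie_bracket[OF assms(1,2) smooth_fun_subset[OF smooth_F subset_UNIV] assms(3,4)])

text \<open>Under dF the two covariant derivatives become X(YF) and Y(XF), whose difference is the
  derivative of F along the bracket.\<close>

lemma torsion_free_flat_conn: "torsion_free A flat_conn"
  unfolding torsion_free_def
proof (intro allI impI ballI)
  fix U X Y p assume "open U \<and> smooth_vf A U X \<and> smooth_vf A U Y" and p: "p \<in> U"
  then show "flat_conn p (X p) Y - flat_conn p (Y p) X = lie_bracket A X Y p"
    by (intro frame_eqD[of p])
      (simp add: linear_diff[OF linear_frame] frame_flat_conn[of U] frame_lie_bracket[of U])
qed

text \<open>With z = dF(Z), iterated covariant derivatives become X(Yz) and Y(Xz) under dF, so
  vanishing curvature is the bracket formula for the function z.\<close>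

lemma flat_flat_conn: "flat A flat_conn"
  unfolding flat_def
proof (intro allI impI ballI)
  fix U X Y Z p assume UXYZ: "open U \<and> smooth_vf A U X \<and> smooth_vf A U Y \<and> smooth_vf A U Z" and p: "p \<in> U"
  then have U: "open U" and X: "smooth_vf A U X" and Y: "smooth_vf A U Y" and Z: "smooth_vf A U Z"
    by auto
  let ?z = "\<lambda>q. tdiff A F q (Z q)"
  have "tdiff A F p (flat_conn p v (\<lambda>q. flat_conn q (Y q) Z)) = tdiff A (\<lambda>q. tdiff A ?z q (Y q)) p v"
    if Y: "smooth_vf A U Y" for Y v
    unfolding frame_flat_conn[OF U p smooth_vf_flat_conn[OF U Y Z]]
    using tdiff_cong[OF U p, of "\<lambda>q. tdiff A F q (flat_conn q (Y q) Z)" "\<lambda>q. tdiff A ?z q (Y q)"]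
    by (simp add: frame_flat_conn[OF U _ Z])
  moreover have "smooth_fun A U ?z" using Z smooth_vf_iff[OF U] by blast
  ultimately show "flat_conn p (X p) (\<lambda>q. flat_conn q (Y q) Z) - flat_conn p (Y p) (\<lambda>q. flat_conn q (X q) Z)
      - flat_conn p (lie_bracket A X Y p) Z = 0"
    by (intro frame_eqD[of p])
      (simp add: linear_diff[OF linear_frame] linear_0[OF linear_frame] frame_flat_conn[OF U p Z] X Y
        tdiff_lie_bracket[OF U p _ X Y])
qed

lemma flat_torsion_free_flat_conn: "flat_torsion_free_connection A flat_conn"
  unfolding flat_torsion_free_connection_def
  using connection_flat_conn flat_flat_conn torsion_free_flat_conn by blast

lemma affine_linear_F:
  fixes L :: "'e \<Rightarrow> real"
  assumes L: "linear L" and U: "open U"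
  shows "affine_fun A flat_conn U (\<lambda>q. L (F q))"
  unfolding affine_fun_def
proof (intro conjI allI impI ballI)
  show "smooth_fun A U (\<lambda>q. L (F q))"
    by (rule smooth_fun_linear_compose[OF U L smooth_fun_subset[OF smooth_F subset_UNIV]])
  fix V Y p v assume VY: "open V \<and> V \<subseteq> U \<and> smooth_vf A V Y" and p: "p \<in> V"
  then show "tdiff A (\<lambda>q. tdiff A (\<lambda>q. L (F q)) q (Y q)) p v - tdiff A (\<lambda>q. L (F q)) p (flat_conn p v Y) = 0"
    by (simp add: tdiff_linear_compose[OF L mdiff_F] tdiff_linear_compose[OF L mdiff_frame[of V]]
        frame_flat_conn[of V])
qed

text \<open>Affinity of the functions \<open>L i (F q)\<close> fixes the value of every
  \<open>L i\<close> on dF(D p v Y), and the \<open>L i\<close> separate points.\<close>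

lemma affine_connection_unique:
  fixes L :: "'i \<Rightarrow> 'e \<Rightarrow> real"
  assumes conn: "connection A D" and L: "\<And>i. linear (L i)" "\<And>w. (\<And>i. L i w = 0) \<Longrightarrow> w = 0"
    and aff: "\<And>i. affine_fun A D UNIV (\<lambda>q. L i (F q))"
  shows "D = flat_conn"
proof (intro ext)
  fix p v Y
  show "D p v Y = flat_conn p v Y"
  proof (cases "\<exists>U. open U \<and> p \<in> U \<and> smooth_vf A U Y")
    case True
    then obtain U where U: "open U" "p \<in> U" "smooth_vf A U Y" by blast
    have "L i (tdiff A F p (D p v Y) - tdiff A F p (flat_conn p v Y)) = 0" for i
    proof -
      have "\<forall>V Y. open V \<and> V \<subseteq> UNIV \<and> smooth_vf A V Y \<longrightarrow>
        (\<forall>p\<in>V. \<forall>v. tdiff A (\<lambda>q. tdiff A (\<lambda>q. L i (F q)) q (Y q)) p v - tdiff A (\<lambda>q. L i (F q)) p (D p v Y) = 0)"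
        using aff[of i] unfolding affine_fun_def by (rule conjunct2)
      then have "tdiff A (\<lambda>q. tdiff A (\<lambda>q. L i (F q)) q (Y q)) p v - tdiff A (\<lambda>q. L i (F q)) p (D p v Y) = 0"
        using U by blast
      then show ?thesis
        by (simp add: linear_diff[OF L(1)] frame_flat_conn[OF U] tdiff_linear_compose[OF L(1) mdiff_F]
            tdiff_linear_compose[OF L(1) mdiff_frame[OF U(1,3,2)]])
    qed
    then show ?thesis using L(2) frame_eqD[of p] by (metis right_minus_eq)
  next
    case False
    \<comment> \<open>Where \<open>Y\<close> is not smooth near \<open>p\<close>, both sides are the
      junk value 0.\<close>
    have "\<forall>p v Y. (\<nexists>U. open U \<and> p \<in> U \<and> smooth_vf A U Y) \<longrightarrow> D p v Y = 0"
      using conn unfolding connection_def by (rule conjunct2)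
    then have "D p v Y = 0" using False by blast
    moreover have "flat_conn p v Y = 0" using False unfolding flat_conn_def by (simp only: if_False)
    ultimately show ?thesis by simp
  qed
qed

text \<open>By definition of the connection, dF(X) has zero derivative. The result is used to
  compare a parallel field at a point with its value at the image of that point under the
  action.\<close>

lemma parallel_frame_constant:
  assumes "open V" "connected V" "parallel_vf A flat_conn V X" "p \<in> V" "q \<in> V"
  shows "tdiff A F p (X p) = tdiff A F q (X q)"
proof (rule tdiff_zero_constant[OF assms(1,2) _ _ assms(4,5)])
  have X: "smooth_vf A V X" using assms(3) by (simp add: parallel_vf_def)
  show "smooth_fun A V (\<lambda>q. tdiff A F q (X q))"
    using X smooth_vf_iff[OF assms(1)] by blast
  show "tdiff A (\<lambda>q. tdiff A F q (X q)) p v = 0" if "p \<in> V" for p v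
    using frame_flat_conn[OF assms(1) that X, of v, symmetric] assms(3) that
    by (simp add: parallel_vf_def linear_0[OF linear_frame])
qed

section \<open>Two-forms with constant coefficients in the frame\<close>

lemma parallel_form:
  assumes h: "bounded_bilinear (h :: 'e \<Rightarrow> 'e \<Rightarrow> real)"
  shows "parallel_2form A flat_conn (\<lambda>p u v. h (tdiff A F p u) (tdiff A F p v))"
  unfolding parallel_2form_def
proof (intro allI impI ballI)
  fix U Y Z p v assume "open U \<and> smooth_vf A U Y \<and> smooth_vf A U Z" and p: "p \<in> U"
  then have U: "open U" and Y: "smooth_vf A U Y" and Z: "smooth_vf A U Z" by auto
  show "tdiff A (\<lambda>q. h (tdiff A F q (Y q)) (tdiff A F q (Z q))) p v
      - h (tdiff A F p (flat_conn p v Y)) (tdiff A F p (Z p))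
      - h (tdiff A F p (Y p)) (tdiff A F p (flat_conn p v Z)) = 0"
    unfolding tdiff_bilinear[OF h mdiff_frame[OF U Y p] mdiff_frame[OF U Z p]]
      frame_flat_conn[OF U p Y] frame_flat_conn[OF U p Z] by simp
qed

lemma symplectic_form_frame:
  assumes h: "bounded_bilinear (h :: 'e \<Rightarrow> 'e \<Rightarrow> real)" and alt: "\<And>a. h a a = 0"
    and nondeg: "\<And>a. (\<And>b. h a b = 0) \<Longrightarrow> a = 0"
  shows "symplectic_form A (\<lambda>p u v. h (tdiff A F p u) (tdiff A F p v))"
  unfolding symplectic_form_def
proof (intro conjI)
  interpret h: bounded_bilinear h by (rule h)
  have skew: "h a b = - h b a" for a b
    using alt[of "a + b"] alt[of a] alt[of b] unfolding h.add_left h.add_right by linarith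
  show "smooth_2form A (\<lambda>p u v. h (tdiff A F p u) (tdiff A F p v))"
    unfolding smooth_2form_def
  proof (intro conjI allI impI)
    fix p u
    show "bilinear (\<lambda>u v. h (tdiff A F p u) (tdiff A F p v))"
      unfolding bilinear_def
      by (auto intro!: linearI simp: linear_add[OF linear_frame] linear_scale[OF linear_frame]
         h.add_left h.add_right h.scaleR_left h.scaleR_right)
    show "h (tdiff A F p u) (tdiff A F p u) = 0" by (rule alt)
  next
    fix U X Y assume "open U \<and> smooth_vf A U X \<and> smooth_vf A U Y"
    then show "smooth_fun A U (\<lambda>q. h (tdiff A F q (X q)) (tdiff A F q (Y q)))"
      using smooth_vf_iff by (intro smooth_fun_bilinear[OF h]) auto
  qed
  show "closed_2form A (\<lambda>p u v. h (tdiff A F p u) (tdiff A F p v))"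
    unfolding closed_2form_def
  proof (intro allI impI ballI)
    fix U X Y Z p
    assume UXYZ: "open U \<and> smooth_vf A U X \<and> smooth_vf A U Y \<and> smooth_vf A U Z" and p: "p \<in> U"
    then have U: "open U" and X: "smooth_vf A U X" and Y: "smooth_vf A U Y" and Z: "smooth_vf A U Z"
      by auto
    show "tdiff A (\<lambda>q. h (tdiff A F q (Y q)) (tdiff A F q (Z q))) p (X p)
        + tdiff A (\<lambda>q. h (tdiff A F q (Z q)) (tdiff A F q (X q))) p (Y p)
        + tdiff A (\<lambda>q. h (tdiff A F q (X q)) (tdiff A F q (Y q))) p (Z p)
        - h (tdiff A F p (lie_bracket A X Y p)) (tdiff A F p (Z p))
        - h (tdiff A F p (lie_bracket A Y Z p)) (tdiff A F p (X p))
        - h (tdiff A F p (lie_bracket A Z X p)) (tdiff A F p (Y p)) = 0"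
      \<comment> \<open>Each derivative contributes two terms. Three of the six cancel against
        bracket terms directly, the other three by skew-symmetry of \<open>h\<close>.\<close>
      unfolding frame_lie_bracket[OF U p X Y] frame_lie_bracket[OF U p Y Z] frame_lie_bracket[OF U p Z X]
        tdiff_bilinear[OF h mdiff_frame[OF U X p] mdiff_frame[OF U Y p]]
        tdiff_bilinear[OF h mdiff_frame[OF U Y p] mdiff_frame[OF U Z p]]
        tdiff_bilinear[OF h mdiff_frame[OF U Z p] mdiff_frame[OF U X p]] h.diff_left
      using skew[of "tdiff A F p (X p)"] skew[of "tdiff A F p (Y p)"] skew[of "tdiff A F p (Z p)"]
      by simp
  qed
  show "\<forall>p u. (\<forall>v. h (tdiff A F p u) (tdiff A F p v) = 0) \<longrightarrow> u = 0"
  proof (intro allI impI)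
    fix p u assume "\<forall>v. h (tdiff A F p u) (tdiff A F p v) = 0"
    then have "h (tdiff A F p u) w = 0" for w using frame_inv[of p w] by metis
    then have "tdiff A F p u = 0" by (rule nondeg)
    then show "u = 0" using frame_eqD[of p u 0] by (simp add: linear_0[OF linear_frame])
  qed
qed

section \<open>Uniqueness of lifts\<close>

lemma diffeo_dom_F:
  assumes "DIM(complex ^ 'n) = DIM('e)"
  obtains U where "p \<in> U" "diffeo_dom F U"
  using diffeo_dom_exists[OF smooth_F bij_is_inj[OF bij_F] assms] by blast

text \<open>\<open>F\<close> is locally injective and \<open>'m\<close> is Hausdorff, so agreement of two lifts is locally
  constant.\<close>

lemma lift_unique:
  assumes dim: "DIM(complex ^ 'n) = DIM('e)" and S: "connected S"
    and g: "continuous_on S \<gamma>" "continuous_on S \<delta>" "\<And>t. t \<in> S \<Longrightarrow> F (\<gamma> t) = F (\<delta> t)"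
    and t: "t0 \<in> S" "\<gamma> t0 = \<delta> t0" "t \<in> S"
  shows "\<gamma> t = \<delta> t"
proof -
  have "eventually (\<lambda>r. (\<gamma> s = \<delta> s) = (\<gamma> r = \<delta> r)) (at s within S)" if s: "s \<in> S" for s
  proof -
    have lim: "(\<gamma> \<longlongrightarrow> \<gamma> s) (at s within S)" "(\<delta> \<longlongrightarrow> \<delta> s) (at s within S)"
      using g(1,2) s by (auto simp: continuous_on_def)
    have evS: "eventually (\<lambda>r. r \<in> S) (at s within S)" by (simp add: eventually_at_filter)
    show ?thesis
    proof (cases "\<gamma> s = \<delta> s")
      case True
      obtain U where U: "\<gamma> s \<in> U" "diffeo_dom F U" using diffeo_dom_F[OF dim] by blast
      then have oU: "open U" "inj_on F U" by (auto simp: diffeo_dom_def)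
      have "eventually (\<lambda>r. \<gamma> r \<in> U) (at s within S)" "eventually (\<lambda>r. \<delta> r \<in> U) (at s within S)"
        using topological_tendstoD[OF lim(1) oU(1) U(1)] topological_tendstoD[OF lim(2) oU(1)] U(1) True
        by auto
      with evS show ?thesis
      proof eventually_elim
        case (elim r)
        then show ?case using inj_onD[OF oU(2) g(3)[of r]] True by blast
      qed
    next
      case False
      then obtain N1 N2 where N: "open N1" "open N2" "\<gamma> s \<in> N1" "\<delta> s \<in> N2" "N1 \<inter> N2 = {}"
        using hausdorff by metis
      have "eventually (\<lambda>r. \<gamma> r \<in> N1) (at s within S)" "eventually (\<lambda>r. \<delta> r \<in> N2) (at s within S)"
        using topological_tendstoD[OF lim(1) N(1,3)] topological_tendstoD[OF lim(2) N(2,4)] by auto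
      then show ?thesis
      proof eventually_elim
        case (elim r)
        then show ?case using N(5) False by (metis disjoint_iff)
      qed
    qed
  qed
  then have "(\<gamma> t0 = \<delta> t0) = (\<gamma> t = \<delta> t)"
    using connected_local_const[OF S t(1,3), of "\<lambda>r. \<gamma> r = \<delta> r"] by blast
  then show ?thesis using t(2) by simp
qed

end

section \<open>Conic Lagrangian immersions\<close>

definition ReV :: "'n::finite V \<Rightarrow> (real ^ 'n) \<times> (real ^ 'n)" where
  "ReV a = (Re_vec (fst a), Re_vec (snd a))"

definition sympl :: "(real ^ 'n) \<times> (real ^ 'n) \<Rightarrow> (real ^ 'n::finite) \<times> (real ^ 'n) \<Rightarrow> real" where
  "sympl a b = 2 * (fst a \<bullet> snd b - fst b \<bullet> snd a)"

lemma linear_ReV: "linear ReV"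
  by (rule linearI) (auto simp: ReV_def Re_vec_def vec_eq_iff)

lemma bounded_bilinear_sympl: "bounded_bilinear sympl"
  unfolding bilinear_conv_bounded_bilinear[symmetric] bilinear_def
  by (auto intro!: linearI simp: sympl_def inner_add_left inner_add_right algebra_simps)

lemma sympl_nondegenerate:
  assumes "\<And>b. sympl a b = 0"
  shows "a = 0"
  \<comment> \<open>Up to sign, these test vectors give twice the squared norm of the first and of
    the second component.\<close>
  using assms[of "(0, fst a)"] assms[of "(snd a, 0)"] by (simp add: sympl_def prod_eq_iff)

lemma omegaV_ReV: "omegaV a b = sympl (ReV a) (ReV b)"
  by (simp add: omegaV_def sympl_def ReV_def Re_vec_def inner_vec_def sum_subtractf)

lemma bounded_bilinear_scaleV: "bounded_bilinear (scaleV :: complex \<Rightarrow> 'n::finite V \<Rightarrow> 'n V)"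
  unfolding bilinear_conv_bounded_bilinear[symmetric] bilinear_def
  by (auto intro!: linearI simp: scaleV_def map_prod_def split_beta vec_eq_iff algebra_simps)

lemma fst_scaleV_ii: "fst (scaleV \<i> a) = Jn (fst a)" and snd_scaleV_ii: "snd (scaleV \<i> a) = Jn (snd a)"
  by (simp_all add: scaleV_def Jn_def)

lemma scaleV_scaleV: "scaleV k (scaleV l a) = scaleV (k * l) a"
  by (simp add: scaleV_def map_prod_def split_beta vector_smult_assoc)

lemma scaleV_1 [simp]: "scaleV 1 a = a"
  by (simp add: scaleV_def map_prod_def split_beta)

lemma linear_scaleV: "linear (scaleV k)"
  using bounded_bilinear_scaleV by (rule bounded_linear.linear[OF bounded_bilinear.bounded_linear_right])

lemma vector_smult_Re_Im: "k *s v = Re k *\<^sub>R v + Im k *\<^sub>R Jn v"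
  by (simp add: Jn_def vec_eq_iff complex_eq_iff)

lemma scaleV_Re_Im: "scaleV k a = Re k *\<^sub>R a + Im k *\<^sub>R scaleV \<i> a"
  by (simp add: scaleV_def map_prod_def split_beta prod_eq_iff vec_eq_iff complex_eq_iff)

lemma Omega_tau_tau: "Omega (tau a) (tau b) = cnj (Omega a b)"
  by (simp add: Omega_def tau_def)

lemma gam_fixed_left: "tau a = a \<Longrightarrow> gam a b = \<i> * cnj (Omega a b)"
  using Omega_tau_tau[of a b] by (simp add: gam_def)

lemma gam_scaleV_ii: "gam (scaleV \<i> a) (scaleV \<i> b) = gam a b"
  unfolding gam_def Omega_def tau_def scaleV_def by (simp add: algebra_simps)

text \<open>The subspaces z = 0 and w = 0 are Lagrangian and stable under \<tau>, hence isotropic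
  for \<gamma>. This is what makes a definite metric see both projections as injective.\<close>

lemma gam_zero_fst: "fst a = 0 \<Longrightarrow> gam a a = 0"
  and gam_zero_snd: "snd a = 0 \<Longrightarrow> gam a a = 0"
  by (simp_all add: gam_def Omega_def tau_def)

text \<open>In the sum of Re \<gamma>(a, ib) and Re \<Omega>(a, b) the products of imaginary parts
  cancel and those of real parts double; hence the factor 2 in \<open>omegaV\<close>.\<close>

lemma omegaV_eq_gam:
  assumes "Omega a b = 0"
  shows "omegaV a b = Re (gam a (scaleV \<i> b))"
proof -
  have "omegaV a b = Re (gam a (scaleV \<i> b)) + Re (Omega a b)"
    unfolding omegaV_def gam_def Omega_def tau_def scaleV_def Re_sum sum_distrib_left sum.distrib[symmetric]
    by (intro sum.cong) (simp_all add: algebra_simps)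
  then show ?thesis using assms by simp
qed

locale conic_lagrangian = complex_manifold A
  for A :: "('m::{t2_space,second_countable_topology}, 'n::finite) chart set" +
  fixes \<phi> :: "'m \<Rightarrow> 'n V"
  assumes immersion: "holomorphic_immersion A \<phi>" and nondeg: "nondegenerate A \<phi>"
    and lagr: "lagrangian A \<phi>" and conic: "conic_immersion \<phi>"
begin

section \<open>Total complexity and the induced connection\<close>

lemma smooth_phi: "smooth_fun A UNIV \<phi>" and tdiff_phi_Jn: "tdiff A \<phi> p (Jn v) = scaleV \<i> (tdiff A \<phi> p v)"
  using immersion holo_funD[of "scaleV \<i>" UNIV \<phi>] by (auto simp: holomorphic_immersion_def)

lemma inj_tdiff_phi: "inj (tdiff A \<phi> p)"
  using immersion by (simp add: holomorphic_immersion_def)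

lemma mdiff_phi: "mdiff \<phi> p"
  using smooth_fun_mdiff[OF smooth_phi] by simp

lemma linear_tdiff_phi: "linear (tdiff A \<phi> p)"
  by (rule tdiff_linear[OF mdiff_phi])

lemma tdiff_phi_smult: "tdiff A \<phi> p (k *s v) = scaleV k (tdiff A \<phi> p v)"
  unfolding vector_smult_Re_Im[of k v] scaleV_Re_Im[of k "tdiff A \<phi> p v"]
  by (simp add: linear_add[OF linear_tdiff_phi] linear_scale[OF linear_tdiff_phi] tdiff_phi_Jn)

lemma totally_complex_phi: "totally_complex A \<phi>"
  unfolding totally_complex_def
proof
  fix p
  have "a = 0" if a: "tau a = a" "a = tdiff A \<phi> p u" for a u
  proof -
    have "gam (tdiff A \<phi> p u) (tdiff A \<phi> p v) = 0" for v
      using lagr a gam_fixed_left[of a "tdiff A \<phi> p v"] by (simp add: lagrangian_def)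
    then have "u = 0" using nondeg by (auto simp: nondegenerate_def)
    then show ?thesis using a(2) by (simp add: linear_0[OF linear_tdiff_phi])
  qed
  moreover have "tau 0 = (0 :: 'n V)" by (simp add: tau_def zero_prod_def vec_eq_iff)
  moreover have "0 \<in> range (tdiff A \<phi> p)"
    using linear_0[OF linear_tdiff_phi] by (metis rangeI)
  ultimately show "{a. tau a = a} \<inter> range (tdiff A \<phi> p) = {0}" by auto
qed

definition F :: "'m \<Rightarrow> (real ^ 'n) \<times> (real ^ 'n)" where
  "F p = ReV (\<phi> p)"

lemma smooth_fun_F: "smooth_fun A UNIV F"
  unfolding F_def[abs_def] by (rule smooth_fun_linear_compose[OF open_UNIV linear_ReV smooth_phi])

lemma tdiff_F: "tdiff A F p u = ReV (tdiff A \<phi> p u)"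
  unfolding F_def[abs_def] by (rule tdiff_linear_compose[OF linear_ReV mdiff_phi])

lemma bij_tdiff_F: "bij (tdiff A F p)"
proof (rule linear_inj_bij)
  show lin: "linear (tdiff A F p)"
    using tdiff_linear[OF smooth_fun_mdiff[OF smooth_fun_F]] by simp
  show "inj (tdiff A F p)"
    unfolding linear_injective_0[OF lin]
  proof (intro allI impI)
    fix u assume "tdiff A F p u = 0"
    \<comment> \<open>The vector \<open>tdiff A \<phi> p u\<close> is purely imaginary, so
      multiplication by i, which is \<open>Jn\<close> on the tangent space, makes it real.\<close>
    then have "tau (tdiff A \<phi> p (Jn u)) = tdiff A \<phi> p (Jn u)"
      by (simp add: tdiff_F tdiff_phi_Jn ReV_def Re_vec_def tau_def scaleV_def map_prod_def split_beta
          zero_prod_def vec_eq_iff complex_eq_iff)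
    then have "tdiff A \<phi> p (Jn u) = 0"
      using totally_complex_phi unfolding totally_complex_def by blast
    then have "Jn u = 0"
      using inj_tdiff_phi[of p] linear_0[OF linear_tdiff_phi[of p]] by (metis injD)
    then show "u = 0" by (simp add: Jn_def vec_eq_iff)
  qed
qed simp

sublocale etale_map A F
  by unfold_locales (rule smooth_fun_F bij_tdiff_F)+

lemma dim_eq: "DIM(complex ^ 'n) = DIM((real ^ 'n) \<times> (real ^ 'n))"
  by simp

lemma induced_form_eq: "induced_form A \<phi> = (\<lambda>p u v. sympl (tdiff A F p u) (tdiff A F p v))"
  by (simp add: fun_eq_iff induced_form_def omegaV_ReV tdiff_F)

text \<open>Being an equivalence, it yields existence and uniqueness together, and thereby the value
  of the \<open>THE\<close> in \<open>induced_connection\<close>.\<close>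

lemma is_induced_connection_iff: "is_induced_connection A \<phi> D \<longleftrightarrow> D = flat_conn"
proof -
  \<comment> \<open>Lists the real coordinates as a single family: \<open>True\<close> selects those
    of the first component, \<open>False\<close> those of the second.\<close>
  define L :: "bool \<times> 'n \<Rightarrow> (real ^ 'n) \<times> (real ^ 'n) \<Rightarrow> real"
    where "L i w = (if fst i then fst w $ snd i else snd w $ snd i)" for i w
  have L: "linear (L i)" for i by (rule linearI) (auto simp: L_def)
  have L0: "w = 0" if "\<And>i. L i w = 0" for w
    using that[of "(True, _)"] that[of "(False, _)"] by (simp add: L_def prod_eq_iff vec_eq_iff)
  have LF: "(\<lambda>q. L (True, i) (F q)) = (\<lambda>q. Re (fst (\<phi> q) $ i))"
    "(\<lambda>q. L (False, i) (F q)) = (\<lambda>q. Re (snd (\<phi> q) $ i))" for i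
    by (simp_all add: L_def F_def ReV_def Re_vec_def)
  have aff: "(\<forall>i. affine_fun A D UNIV (\<lambda>p. Re (fst (\<phi> p) $ i)) \<and>
      affine_fun A D UNIV (\<lambda>p. Re (snd (\<phi> p) $ i))) \<longleftrightarrow> (\<forall>i. affine_fun A D UNIV (\<lambda>q. L i (F q)))" for D
    unfolding LF[symmetric] by (auto simp: split_paired_all) (metis (full_types))+
  show ?thesis
    unfolding is_induced_connection_def aff
    using affine_connection_unique[of D L, OF _ L L0] flat_torsion_free_flat_conn
      affine_linear_F[OF L open_UNIV] by (auto simp: flat_torsion_free_connection_def)
qed

lemma induced_connection_eq: "induced_connection A \<phi> = flat_conn"
  unfolding induced_connection_def is_induced_connection_iff by simp

section \<open>Construction of the local action\<close>

text \<open>On \<open>ball 1 s \<times> N\<close> the action will be \<open>box_action U\<close>, the composition of scaling in \<open>V\<close> with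
  the inverse of \<open>F\<close> on \<open>U\<close>.\<close>

definition action_box :: "'m set \<Rightarrow> real \<Rightarrow> 'm set \<Rightarrow> bool" where
  "action_box U s N \<longleftrightarrow> diffeo_dom F U \<and> open N \<and> N \<subseteq> U \<and> s > 0 \<and> 0 \<notin> ball (1::complex) s \<and>
     (\<forall>\<kappa>\<in>ball 1 s. scaleV \<kappa> ` \<phi> ` N \<subseteq> \<phi> ` U)"

definition box_action :: "'m set \<Rightarrow> complex \<Rightarrow> 'm \<Rightarrow> 'm" where
  "box_action U \<kappa> q = inv_into U F (ReV (scaleV \<kappa> (\<phi> q)))"

text \<open>Conicity is applied to a set on which \<open>F\<close> is invertible. The set of scalars
  is shrunk to a disc for the sake of convexity, and \<open>Up\<close> is cut down to
  \<open>U\<close> so that the scalar 1 acts as the identity.\<close>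

lemma action_box_exists: "\<exists>U s N. action_box U s N \<and> p \<in> N"
proof -
  obtain U where U: "p \<in> U" "diffeo_dom F U" using diffeo_dom_F[OF dim_eq] by blast
  then have "open U" by (simp add: diffeo_dom_def)
  then obtain U1 Up where U1: "open U1" "1 \<in> U1" "0 \<notin> U1" "open Up" "p \<in> Up"
    "\<forall>\<kappa>\<in>U1. scaleV \<kappa> ` \<phi> ` Up \<subseteq> \<phi> ` U"
    using conic U(1) unfolding conic_immersion_def by meson
  obtain s where s: "s > 0" "ball 1 s \<subseteq> U1" using U1(1,2) open_contains_ball by blast
  have "action_box U s (Up \<inter> U)"
    unfolding action_box_def using U U1 s \<open>open U\<close> by blast
  then show ?thesis using U(1) U1(5) by blast
qed

text \<open>Conicity supplies a point of \<open>U\<close> over \<kappa>\<phi>(q), and its real part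
  already determines it in \<open>U\<close>. So inverting \<open>F\<close> alone lifts the full
  complex value.\<close>

lemma box_action:
  assumes "action_box U s N" "\<kappa> \<in> ball 1 s" "q \<in> N"
  shows "box_action U \<kappa> q \<in> U" "\<phi> (box_action U \<kappa> q) = scaleV \<kappa> (\<phi> q)"
    "ReV (scaleV \<kappa> (\<phi> q)) \<in> F ` U"
proof -
  have "scaleV \<kappa> (\<phi> q) \<in> \<phi> ` U" using assms unfolding action_box_def by blast
  then obtain r where r: "r \<in> U" "scaleV \<kappa> (\<phi> q) = \<phi> r" by auto
  have "inj_on F U" using assms(1) by (simp add: action_box_def diffeo_dom_def)
  then have "box_action U \<kappa> q = r"
    unfolding box_action_def r(2) F_def[symmetric] using r(1) by simp
  then show "box_action U \<kappa> q \<in> U" "\<phi> (box_action U \<kappa> q) = scaleV \<kappa> (\<phi> q)"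
    using r by auto
  show "ReV (scaleV \<kappa> (\<phi> q)) \<in> F ` U" using r by (simp add: F_def[symmetric])
qed

lemma box_action_1:
  assumes "action_box U s N" "q \<in> N"
  shows "box_action U 1 q = q"
proof -
  have "inj_on F U" "q \<in> U" using assms by (auto simp: action_box_def diffeo_dom_def)
  then show ?thesis by (simp add: box_action_def F_def[symmetric])
qed

lemma continuous_on_box_action:
  assumes "action_box U s N" "q \<in> N"
  shows "continuous_on (ball 1 s) (\<lambda>\<kappa>. box_action U \<kappa> q)"
  unfolding box_action_def
proof (rule continuous_on_compose2[where g = "inv_into U F"])
  show "continuous_on (F ` U) (inv_into U F)" using assms(1) by (simp add: action_box_def diffeo_dom_def)
  have "continuous_on (ball 1 s) (\<lambda>\<kappa>. scaleV \<kappa> (\<phi> q))"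
    by (intro bounded_bilinear.continuous_on[OF bounded_bilinear_scaleV] continuous_intros)
  then show "continuous_on (ball 1 s) (\<lambda>\<kappa>. ReV (scaleV \<kappa> (\<phi> q)))"
    using linear_ReV by (rule linear_continuous_on_compose)
  show "(\<lambda>\<kappa>. ReV (scaleV \<kappa> (\<phi> q))) ` ball 1 s \<subseteq> F ` U" using box_action(3)[OF assms(1) _ assms(2)] by blast
qed

text \<open>Both sides lift \<kappa> \<mapsto> \<kappa>\<phi>(q) over an intersection of discs
  centred at 1, which is connected, and at \<kappa> = 1 both equal \<open>q\<close>.\<close>

lemma box_action_unique:
  assumes "action_box U s N" "\<kappa> \<in> ball 1 s" "q \<in> N" "action_box U' s' N'" "\<kappa> \<in> ball 1 s'" "q \<in> N'"
  shows "box_action U \<kappa> q = box_action U' \<kappa> q"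
proof (rule lift_unique[OF dim_eq, where \<gamma> = "\<lambda>\<kappa>. box_action U \<kappa> q" and \<delta> = "\<lambda>\<kappa>. box_action U' \<kappa> q"])
  let ?S = "ball (1::complex) s \<inter> ball 1 s'"
  show "connected ?S" by (intro convex_connected convex_Int convex_ball)
  show "continuous_on ?S (\<lambda>\<kappa>. box_action U \<kappa> q)" "continuous_on ?S (\<lambda>\<kappa>. box_action U' \<kappa> q)"
    using continuous_on_subset[OF continuous_on_box_action[OF assms(1,3)]]
      continuous_on_subset[OF continuous_on_box_action[OF assms(4,6)]] by auto
  show "F (box_action U k q) = F (box_action U' k q)" if "k \<in> ?S" for k
    using box_action(2)[OF assms(1) _ assms(3), of k] box_action(2)[OF assms(4) _ assms(6), of k] that
    by (simp add: F_def)
  show "1 \<in> ?S" using assms(1,4) by (simp add: action_box_def)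
  show "box_action U 1 q = box_action U' 1 q"
    using box_action_1 assms by metis
  show "\<kappa> \<in> ?S" using assms by simp
qed

definition act_dom :: "(complex \<times> 'm) set" where
  "act_dom = {(\<kappa>, q). \<exists>U s N. action_box U s N \<and> \<kappa> \<in> ball 1 s \<and> q \<in> N}"

text \<open>The chosen \<open>U\<close> depends on \<kappa> and \<open>q\<close>;
  \<open>box_action_unique\<close> makes the choice immaterial, so that \<open>act\<close> has the
  regularity of a fixed \<open>box_action U\<close> on each box.\<close>

definition act :: "complex \<Rightarrow> 'm \<Rightarrow> 'm" where
  "act \<kappa> q = box_action (SOME U. \<exists>s N. action_box U s N \<and> \<kappa> \<in> ball 1 s \<and> q \<in> N) \<kappa> q"

lemma act_eq:
  assumes "action_box U s N" "\<kappa> \<in> ball 1 s" "q \<in> N"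
  shows "act \<kappa> q = box_action U \<kappa> q"
proof -
  have "\<exists>s N. action_box (SOME U. \<exists>s N. action_box U s N \<and> \<kappa> \<in> ball 1 s \<and> q \<in> N) s N \<and> \<kappa> \<in> ball 1 s \<and> q \<in> N"
    by (rule someI) (use assms in blast)
  then show ?thesis unfolding act_def using box_action_unique assms by meson
qed

lemma phi_act: "(\<kappa>, q) \<in> act_dom \<Longrightarrow> \<phi> (act \<kappa> q) = scaleV \<kappa> (\<phi> q)"
  using act_eq box_action(2) unfolding act_dom_def by fastforce

lemma act_dom_boxE:
  assumes "(\<kappa>, q) \<in> act_dom"
  obtains U s N where "action_box U s N" "\<kappa> \<in> ball 1 s" "q \<in> N"
  using assms unfolding act_dom_def by blast

lemma act_dom_1: "(1, p) \<in> act_dom" and act_1: "act 1 p = p"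
proof -
  obtain U s N where b: "action_box U s N" "p \<in> N" using action_box_exists by blast
  then have "1 \<in> ball (1::complex) s" by (simp add: action_box_def)
  then show "(1, p) \<in> act_dom" "act 1 p = p"
    using b act_eq box_action_1 unfolding act_dom_def by auto
qed

lemma open_act_dom: "open act_dom"
proof -
  have "act_dom = \<Union>{ball 1 s \<times> N |U s N. action_box U s N}"
    unfolding act_dom_def by blast
  then show ?thesis
    by (auto simp: action_box_def intro!: open_Union open_Times)
qed

text \<open>The slices of the domain are unions of concentric discs, hence convex.\<close>

lemma act_dom_slice:
  assumes "(\<kappa>, p) \<in> act_dom" "(\<mu>, p) \<in> act_dom"
  obtains S where "convex S" "\<kappa> \<in> S" "\<mu> \<in> S" "\<And>k. k \<in> S \<Longrightarrow> (k, p) \<in> act_dom"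
    "continuous_on S (\<lambda>k. act k p)"
proof -
  obtain U s N where b: "action_box U s N" "\<kappa> \<in> ball 1 s" "p \<in> N"
    using act_dom_boxE[OF assms(1)] .
  obtain U' s' N' where b': "action_box U' s' N'" "\<mu> \<in> ball 1 s'" "p \<in> N'"
    using act_dom_boxE[OF assms(2)] .
  have cont: "continuous_on (ball 1 s) (\<lambda>k. act k p)" if "action_box U s N" "p \<in> N" for U s N
    by (rule continuous_on_eq[OF continuous_on_box_action[OF that]]) (simp add: act_eq[OF that(1) _ that(2)])
  show thesis
  proof (cases "s \<le> s'")
    case True
    show thesis
      by (rule that[of "ball 1 s'"]) (use b b' True cont[OF b'(1,3)] in \<open>auto simp: act_dom_def\<close>)
  next
    case False
    show thesis
      by (rule that[of "ball 1 s"]) (use b b' False cont[OF b(1,3)] in \<open>auto simp: act_dom_def\<close>)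
  qed
qed

text \<open>Along the segment \<open>l\<close> from 1 to \<kappa>, both
  \<open>act (l t) (act \<mu> p)\<close> and \<open>act (l t * \<mu>) p\<close> lift
  \<open>l t * \<mu>\<close> times \<phi>(p), and they agree at \<open>t = 0\<close>. Convexity of
  the two slices keeps both paths inside the domain.\<close>

lemma act_act:
  assumes "(\<mu>, p) \<in> act_dom" "(\<kappa>, act \<mu> p) \<in> act_dom" "(\<kappa> * \<mu>, p) \<in> act_dom"
  shows "act \<kappa> (act \<mu> p) = act (\<kappa> * \<mu>) p"
proof -
  obtain S where S: "convex S" "\<mu> \<in> S" "\<kappa> * \<mu> \<in> S" "\<And>k. k \<in> S \<Longrightarrow> (k, p) \<in> act_dom"
    "continuous_on S (\<lambda>k. act k p)"
    using act_dom_slice[OF assms(1,3)] by blast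
  obtain T where T: "convex T" "1 \<in> T" "\<kappa> \<in> T" "\<And>k. k \<in> T \<Longrightarrow> (k, act \<mu> p) \<in> act_dom"
    "continuous_on T (\<lambda>k. act k (act \<mu> p))"
    using act_dom_slice[OF act_dom_1[of "act \<mu> p"] assms(2)] by blast
  define l where "l t = (1 - t) *\<^sub>R 1 + t *\<^sub>R \<kappa>" for t :: real
  have lT: "l t \<in> T" if "t \<in> {0..1}" for t
    unfolding l_def using T(1-3) that by (intro convexD) auto
  have lS: "l t * \<mu> \<in> S" if "t \<in> {0..1}" for t
  proof -
    have "l t * \<mu> = (1 - t) *\<^sub>R \<mu> + t *\<^sub>R (\<kappa> * \<mu>)" by (simp add: l_def algebra_simps)
    then show ?thesis using convexD[OF S(1-3), of "1 - t" t] that by simp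
  qed
  have cl: "continuous_on {0..1} l" unfolding l_def[abs_def] by (intro continuous_intros)
  have "act (l 1) (act \<mu> p) = act (l 1 * \<mu>) p"
  proof (rule lift_unique[OF dim_eq connected_Icc, where \<gamma> = "\<lambda>t. act (l t) (act \<mu> p)"
        and \<delta> = "\<lambda>t. act (l t * \<mu>) p"])
    show "continuous_on {0..1} (\<lambda>t. act (l t) (act \<mu> p))"
      by (rule continuous_on_compose2[OF T(5) cl]) (use lT in auto)
    show "continuous_on {0..1} (\<lambda>t. act (l t * \<mu>) p)"
      by (rule continuous_on_compose2[OF S(5)]) (use lS in \<open>auto intro!: continuous_intros cl\<close>)
    show "F (act (l t) (act \<mu> p)) = F (act (l t * \<mu>) p)" if "t \<in> {0..1}" for t
      using phi_act[OF T(4)[OF lT[OF that]]] phi_act[OF S(4)[OF lS[OF that]]] phi_act[OF assms(1)]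
      by (simp add: F_def scaleV_scaleV)
    show "act (l 0) (act \<mu> p) = act (l 0 * \<mu>) p" by (simp add: l_def act_1)
  qed auto
  then show ?thesis by (simp add: l_def)
qed

section \<open>Regularity and holomorphy of the action\<close>

lemma tdiff_phi_chart:
  assumes "(V, d) \<in> A" "p \<in> V"
  shows "tdiff A \<phi> p u = fd (\<phi> \<circ> inv_into V d) (d p) (tdiff A d p u)"
  by (rule tdiff_chart[OF assms mdiff_phi])

lemma fd_phi_chart:
  assumes V: "(V, d) \<in> A" and p: "p \<in> V"
  shows "fd (\<phi> \<circ> inv_into V d) (d p) (Jn v) = scaleV \<i> (fd (\<phi> \<circ> inv_into V d) (d p) v)"
    and "inj (fd (\<phi> \<circ> inv_into V d) (d p))"
proof -
  have surj: "\<exists>u. v = tdiff A d p u" for v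
    using tdiff_chart_bij(1)[OF V p] by (metis bij_pointE)
  obtain u where "v = tdiff A d p u" using surj by blast
  then show "fd (\<phi> \<circ> inv_into V d) (d p) (Jn v) = scaleV \<i> (fd (\<phi> \<circ> inv_into V d) (d p) v)"
    using tdiff_phi_Jn[of p u] by (simp add: tdiff_phi_chart[OF V p] tdiff_chart_bij(2)[OF V p])
  show "inj (fd (\<phi> \<circ> inv_into V d) (d p))"
  proof (rule injI)
    fix x y assume eq: "fd (\<phi> \<circ> inv_into V d) (d p) x = fd (\<phi> \<circ> inv_into V d) (d p) y"
    obtain u w where "x = tdiff A d p u" "y = tdiff A d p w" using surj by metis
    moreover from this eq have "u = w"
      using inj_tdiff_phi by (simp add: tdiff_phi_chart[OF V p, symmetric] inj_eq)
    ultimately show "x = y" by simp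
  qed
qed

lemma continuous_on_act: "continuous_on act_dom (\<lambda>(\<kappa>, p). act \<kappa> p)"
proof (rule continuous_at_imp_continuous_on, rule ballI)
  fix x assume "x \<in> act_dom"
  then obtain U s N where b: "action_box U s N" "fst x \<in> ball 1 s" "snd x \<in> N"
    using act_dom_boxE[of "fst x" "snd x"] by auto
  let ?B = "ball 1 s \<times> N"
  have \<phi>: "continuous_on N \<phi>"
    using smooth_fun_continuous[OF open_UNIV smooth_phi] continuous_on_subset by blast
  have "continuous_on ?B (\<lambda>x. inv_into U F (ReV (scaleV (fst x) (\<phi> (snd x)))))"
  proof (rule continuous_on_compose2[where g = "inv_into U F"])
    show "continuous_on (F ` U) (inv_into U F)" using b(1) by (simp add: action_box_def diffeo_dom_def)
    have m: "continuous_on ?B (\<lambda>x. scaleV (fst x) (\<phi> (snd x)))"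
      by (rule bounded_bilinear.continuous_on[OF bounded_bilinear_scaleV])
        (auto intro!: continuous_intros continuous_on_compose2[OF \<phi>])
    have R: "continuous_on UNIV ReV"
      by (rule linear_continuous_on) (use linear_ReV in \<open>simp add: linear_conv_bounded_linear\<close>)
    show "continuous_on ?B (\<lambda>x. ReV (scaleV (fst x) (\<phi> (snd x))))"
      by (rule continuous_on_compose2[OF R m subset_UNIV])
    show "(\<lambda>x. ReV (scaleV (fst x) (\<phi> (snd x)))) ` ?B \<subseteq> F ` U" using box_action(3)[OF b(1)] by auto
  qed
  then have "continuous_on ?B (\<lambda>(\<kappa>, p). act \<kappa> p)"
    by (rule continuous_on_eq) (auto simp: act_eq[OF b(1)] box_action_def)
  moreover have "open ?B" "x \<in> ?B" using b by (auto simp: action_box_def open_Times mem_Times_iff)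
  ultimately show "isCont (\<lambda>(\<kappa>, p). act \<kappa> p) x" using continuous_on_eq_continuous_at by blast
qed

text \<open>On a box the action is the inverse of \<open>F\<close> after scaling and taking real
  parts. Taking real parts destroys complex linearity, so this formula is used for smoothness
  only.\<close>

lemma act_chart_local:
  assumes Uc: "(U0, c) \<in> A" and Vd: "(V, d) \<in> A"
    and p: "(\<kappa>, p) \<in> act_dom" "p \<in> U0" "act \<kappa> p \<in> V"
  obtains T where "open T" "(\<kappa>, c p) \<in> T"
    "smooth_on (\<lambda>(k, x). d (act k (inv_into U0 c x))) T"
    "T \<subseteq> {(k, c q) |k q. (k, q) \<in> act_dom \<and> q \<in> U0 \<and> act k q \<in> V}"
proof -
  obtain U s N where b: "action_box U s N" "\<kappa> \<in> ball 1 s" "p \<in> N"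
    using act_dom_boxE[OF p(1)] .
  have U: "diffeo_dom F U" and N: "open N" using b(1) by (auto simp: action_box_def)
  let ?P = "ball 1 s \<times> c ` (N \<inter> U0)" and ?x = "\<lambda>x. inv_into U0 c (snd x)"
  let ?m = "\<lambda>x. ReV (scaleV (fst x) (\<phi> (?x x)))"
  have oc: "open (c ` (N \<inter> U0))" by (rule open_chart_image_Int[OF Uc N])
  then have P: "open ?P" by (simp add: open_Times)
  have "smooth_on ((\<lambda>x. \<phi> (inv_into U0 c x)) \<circ> snd) ?P"
  proof (rule smooth_on_compose[OF P oc _ smooth_on_linear[OF linear_snd]])
    show "smooth_on (\<lambda>x. \<phi> (inv_into U0 c x)) (c ` (N \<inter> U0))"
      by (rule smooth_on_subset[OF smooth_funD[OF smooth_phi Uc]]) auto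
  qed auto
  then have \<phi>: "smooth_on (\<lambda>x. \<phi> (?x x)) ?P" by (simp add: o_def)
  have m: "smooth_on ?m ?P"
    by (rule smooth_on_linear_compose[OF linear_ReV P
        smooth_on_bilinear[OF bounded_bilinear_scaleV P smooth_on_linear[OF linear_fst] \<phi>]])
  have oV: "open (F ` (U \<inter> V))"
    using diffeo_dom_subset[OF U, of "U \<inter> V"] U chart_props(1)[OF Vd] by (auto simp: diffeo_dom_def)
  \<comment> \<open>The part of the box that the action sends into the chart domain
    \<open>V\<close>; it is open because \<open>?m\<close> is continuous.\<close>
  define T where "T = ?P \<inter> ?m -` (F ` (U \<inter> V))"
  have T: "open T"
    unfolding T_def by (rule continuous_open_preimage[OF smooth_on_continuous[OF m] P oV])
  have inj: "inj_on F U" using U by (simp add: diffeo_dom_def)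
  have act: "act k q = inv_into U F (?m (k, c q))" if "k \<in> ball 1 s" "q \<in> N" "q \<in> U0" for k q
    using that by (simp add: act_eq[OF b(1)] box_action_def chart_inv[OF Uc])
  have "(\<kappa>, c p) \<in> T"
  proof -
    have "act \<kappa> p \<in> U \<inter> V" using box_action(1)[OF b] act_eq[OF b] p(3) by simp
    moreover have "?m (\<kappa>, c p) = F (act \<kappa> p)"
      using phi_act[OF p(1)] by (simp add: F_def chart_inv[OF Uc p(2)])
    ultimately show ?thesis unfolding T_def using b p(2) by auto
  qed
  moreover have "smooth_on (\<lambda>(k, x). d (act k (inv_into U0 c x))) T"
  proof (rule smooth_on_cong[OF T])
    show "smooth_on ((d \<circ> inv_into U F) \<circ> ?m) T"
    proof (rule smooth_on_compose[OF T oV])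
      show "?m ` T \<subseteq> F ` (U \<inter> V)" by (auto simp: T_def)
      show "smooth_on ?m T" by (rule smooth_on_subset[OF m]) (auto simp: T_def)
      show "smooth_on (d \<circ> inv_into U F) (F ` (U \<inter> V))"
        by (rule diffeo_dom_chart(1)[OF U Vd])
    qed
    fix x assume "x \<in> T"
    then obtain k q where x: "x = (k, c q)" "k \<in> ball 1 s" "q \<in> N" "q \<in> U0" unfolding T_def by auto
    then show "((d \<circ> inv_into U F) \<circ> ?m) x = (case x of (k, x) \<Rightarrow> d (act k (inv_into U0 c x)))"
      using act[OF x(2-4)] by (simp add: chart_inv[OF Uc])
  qed
  moreover have "T \<subseteq> {(k, c q) |k q. (k, q) \<in> act_dom \<and> q \<in> U0 \<and> act k q \<in> V}"
  proof
    fix x assume xT: "x \<in> T"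
    then obtain k q where x: "x = (k, c q)" "k \<in> ball 1 s" "q \<in> N" "q \<in> U0" unfolding T_def by auto
    have "act k q \<in> V"
      using xT inj act[OF x(2-4)] unfolding T_def x(1) by auto
    moreover have "(k, q) \<in> act_dom" using b(1) x unfolding act_dom_def by blast
    ultimately show "x \<in> {(k, c q) |k q. (k, q) \<in> act_dom \<and> q \<in> U0 \<and> act k q \<in> V}"
      using x by blast
  qed
  ultimately show thesis using that T by blast
qed

text \<open>Differentiating \<phi>(act k q) = k\<phi>(q) gives a right hand side that is complex
  linear in the variations of k and q jointly. The differential of \<phi> at the image point is
  complex linear and injective, so it can be cancelled on the left.\<close>

lemma holo_on_act:
  assumes Uc: "(U0, c) \<in> A" and Vd: "(V, d) \<in> A"
  shows "holo_on JCn Jn (\<lambda>(k, x). d (act k (inv_into U0 c x)))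
    {(k, c q) |k q. (k, q) \<in> act_dom \<and> q \<in> U0 \<and> act k q \<in> V}" (is "holo_on _ _ ?f ?S")
  unfolding holo_on_def
proof (intro conjI ballI allI)
  show "smooth_on ?f ?S"
  proof (rule smooth_on_local)
    fix x assume "x \<in> ?S"
    then obtain k q where q: "x = (k, c q)" "(k, q) \<in> act_dom" "q \<in> U0" "act k q \<in> V" by blast
    obtain T where "open T" "(k, c q) \<in> T" "smooth_on ?f T"
      by (rule act_chart_local[OF Uc Vd q(2-4)])
    then show "\<exists>T. open T \<and> x \<in> T \<and> smooth_on ?f T" unfolding q(1) by blast
  qed
  fix x v assume "x \<in> ?S"
  then obtain k q where q: "x = (k, c q)" "(k, q) \<in> act_dom" "q \<in> U0" "act k q \<in> V" by blast
  obtain T where T: "open T" "x \<in> T" "smooth_on ?f T" "T \<subseteq> ?S"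
    unfolding q(1) by (rule act_chart_local[OF Uc Vd q(2-4)])
  let ?\<psi> = "\<phi> \<circ> inv_into V d" and ?\<chi> = "\<phi> \<circ> inv_into U0 c"
  have fx: "?f x = d (act k q)" using q by (simp add: chart_inv[OF Uc])
  have f: "(?f has_derivative fd ?f x) (at x)"
    by (rule fd_works[OF smooth_on_differentiable[OF T(3,2)]])
  have \<psi>: "(?\<psi> has_derivative fd ?\<psi> (d (act k q))) (at (?f x))"
    unfolding fx by (rule fd_works[OF mdiff_chart[OF mdiff_phi Vd q(4)]])
  have \<chi>: "(?\<chi> has_derivative fd ?\<chi> (c q)) (at (snd x))"
    using fd_works[OF mdiff_chart[OF mdiff_phi Uc q(3)]] q(1) by simp
  have "((\<lambda>x. scaleV (fst x) (?\<chi> (snd x))) has_derivative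
      (\<lambda>v. scaleV (fst x) (fd ?\<chi> (c q) (snd v)) + scaleV (fst v) (?\<chi> (snd x)))) (at x)"
    by (rule bounded_bilinear.FDERIV[OF bounded_bilinear_scaleV
          has_derivative_fst[OF has_derivative_ident]
          has_derivative_compose[OF has_derivative_snd[OF has_derivative_ident] \<chi>]])
  then have "((\<lambda>x. ?\<psi> (?f x)) has_derivative
      (\<lambda>v. scaleV (fst x) (fd ?\<chi> (c q) (snd v)) + scaleV (fst v) (?\<chi> (snd x)))) (at x)"
  proof (rule has_derivative_transform_within_open[OF _ T(1,2)])
    fix y assume "y \<in> T"
    then obtain l r where r: "y = (l, c r)" "(l, r) \<in> act_dom" "r \<in> U0" "act l r \<in> V"
      using T(4) by blast
    then show "scaleV (fst y) (?\<chi> (snd y)) = ?\<psi> (?f y)"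
      by (simp add: chart_inv[OF Uc] chart_inv[OF Vd] phi_act)
  qed
  from has_derivative_unique[OF this has_derivative_compose[OF f \<psi>]]
  have eq: "fd ?\<psi> (d (act k q)) (fd ?f x v) =
      scaleV k (fd ?\<chi> (c q) (snd v)) + scaleV (fst v) (\<phi> q)" for v
    using q by (simp add: fun_eq_iff chart_inv[OF Uc])
  have "fd ?\<psi> (d (act k q)) (fd ?f x (JCn v)) = scaleV \<i> (fd ?\<psi> (d (act k q)) (fd ?f x v))"
    unfolding eq by (simp add: JCn_def fd_phi_chart(1)[OF Uc q(3)] scaleV_scaleV
        linear_add[OF linear_scaleV] mult.commute)
  then show "fd ?f x (JCn v) = Jn (fd ?f x v)"
    unfolding fd_phi_chart(1)[OF Vd q(4), symmetric] using fd_phi_chart(2)[OF Vd q(4)] by (simp add: inj_eq)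
qed

lemma local_action_act: "local_action A act_dom act"
  unfolding local_action_def
proof (intro conjI allI impI)
  show "act_dom \<subseteq> (- {0}) \<times> UNIV" by (auto simp: act_dom_def action_box_def)
  show "\<forall>(U, c)\<in>A. \<forall>(V, d)\<in>A. holo_on JCn Jn (\<lambda>(\<kappa>, x). d (act \<kappa> (inv_into U c x)))
        {(\<kappa>, c p) |\<kappa> p. (\<kappa>, p) \<in> act_dom \<and> p \<in> U \<and> act \<kappa> p \<in> V}"
    using holo_on_act by blast
qed (auto simp: open_act_dom act_dom_1 continuous_on_act act_1 act_act)

section \<open>The action on parallel fields\<close>

text \<open>The chain rule for \<phi>(act \<kappa> r) = \<kappa>\<phi>(r).\<close>

lemma tdiff_phi_tmap_act:
  assumes dom: "action_domain A act_dom act \<kappa> U" and p: "p \<in> U"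
  shows "tdiff A \<phi> (act \<kappa> p) (tmap A (act \<kappa>) p u) = scaleV \<kappa> (tdiff A \<phi> p u)"
proof -
  let ?q = "act \<kappa> p"
  \<comment> \<open>\<open>tmap\<close> is computed in the chart selected at the image point, so
    \<open>U\<close> is shrunk until its image lies in the domain of that chart.\<close>
  let ?c = "coord_at ?q" and ?N = "U \<inter> act \<kappa> -` dom_at ?q"
  have U: "open U" "{\<kappa>} \<times> U \<subseteq> act_dom" "smooth_map A U (act \<kappa>)"
    using dom by (auto simp: action_domain_def diffeo_onto_image_def)
  have N: "open ?N" "p \<in> ?N"
    using U(3) continuous_open_preimage[OF _ U(1) chart_props(1)[OF chart_at_in]] p chart_at_mem
    by (auto simp: smooth_map_def)
  have "smooth_fun A ?N (\<lambda>r. ?c (act \<kappa> r))"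
    using U(3) chart_at_in[of ?q] unfolding smooth_map_def by (fastforce simp: o_def)
  then have m: "mdiff (\<lambda>r. ?c (act \<kappa> r)) p" using N(2) by (rule smooth_fun_mdiff)
  have "(\<lambda>x. \<phi> (par_at ?q x)) differentiable (at (?c ?q))"
    using has_tdiff[OF mdiff_phi] differentiableI by blast
  from tdiff_compose[OF m this, of u]
  have "tdiff A (\<lambda>r. \<phi> (par_at ?q (?c (act \<kappa> r)))) p u = tdiff A \<phi> ?q (tmap A (act \<kappa>) p u)"
    by (simp add: tdiff_eq[of \<phi>] tmap_def coord_at_def o_def)
  moreover have "tdiff A (\<lambda>r. \<phi> (par_at ?q (?c (act \<kappa> r)))) p = tdiff A (\<lambda>r. scaleV \<kappa> (\<phi> r)) p"
  proof (rule tdiff_cong[OF N])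
    fix r assume "r \<in> ?N"
    then show "\<phi> (par_at ?q (?c (act \<kappa> r))) = scaleV \<kappa> (\<phi> r)"
      using chart_inv[OF chart_at_in, of "act \<kappa> r" ?q] phi_act[of \<kappa> r] U(2) by (auto simp: par_at_def)
  qed
  ultimately show ?thesis
    by (simp add: tdiff_linear_compose[OF linear_scaleV mdiff_phi])
qed

text \<open>The tangent spaces of \<open>\<phi>\<close> at \<open>p\<close> and \<open>act \<kappa> p\<close> are the same complex subspace of \<open>V\<close>, on which
  taking real parts is injective.\<close>

lemma conic_action_act: "conic_action A flat_conn act_dom act"
  unfolding conic_action_def Let_def
proof (intro conjI allI impI ballI local_action_act)
  fix r \<theta> U V X p
  assume *: "r > 0 \<and> action_domain A act_dom act (rcis r \<theta>) U \<and> open V \<and> connected V \<and> U \<subseteq> V \<and>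
    act (rcis r \<theta>) ` U \<subseteq> V \<and> parallel_vf A flat_conn V X" and p: "p \<in> U"
  define \<kappa> where "\<kappa> = rcis r \<theta>"
  have \<kappa>: "\<kappa> \<noteq> 0" using * by (simp add: \<kappa>_def rcis_def)
  let ?q = "act \<kappa> p" and ?t = "tmap A (act \<kappa>) p (X p)"
  have t: "tdiff A \<phi> ?q ?t = scaleV \<kappa> (tdiff A \<phi> p (X p))"
    using tdiff_phi_tmap_act[OF _ p] * unfolding \<kappa>_def by blast
  \<comment> \<open>The factor \<kappa> is removed before real parts are taken, since taking real
    parts does not commute with complex scaling.\<close>
  have "tdiff A \<phi> ?q ((1 / \<kappa>) *s ?t) = tdiff A \<phi> p (X p)"
    using \<kappa> by (simp add: tdiff_phi_smult t scaleV_scaleV)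
  then have "tdiff A F ?q ((1 / \<kappa>) *s ?t) = tdiff A F p (X p)" by (simp add: tdiff_F)
  also have "\<dots> = tdiff A F ?q (X ?q)"
    using * p unfolding \<kappa>_def by (intro parallel_frame_constant[of V]) auto
  finally have "(1 / \<kappa>) *s ?t = X ?q" by (rule frame_eqD)
  then have "?t = \<kappa> *s X ?q" using \<kappa> by (metis divide_self mult.commute times_divide_eq_left mult_1 vector_smult_assoc vector_smult_lid)
  also have "\<dots> = (r * cos \<theta>) *\<^sub>R X ?q + (r * sin \<theta>) *\<^sub>R Jn (X ?q)"
    unfolding vector_smult_Re_Im[of \<kappa>] by (simp add: \<kappa>_def)
  finally show "tmap A (act (rcis r \<theta>)) p (X p) =
    (r * cos \<theta>) *\<^sub>R X (act (rcis r \<theta>) p) + (r * sin \<theta>) *\<^sub>R Jn (X (act (rcis r \<theta>) p))"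
    unfolding \<kappa>_def .
qed

section \<open>The conic Kaehler structure\<close>

lemma induced_form_metric: "induced_form A \<phi> p u v = induced_metric A \<phi> p u (Jn v)"
  using omegaV_eq_gam[of "tdiff A \<phi> p u" "tdiff A \<phi> p v"] lagr
  by (simp add: induced_form_def induced_metric_def tdiff_phi_Jn lagrangian_def)

lemma induced_form_Jn: "induced_form A \<phi> p (Jn u) (Jn v) = induced_form A \<phi> p u v"
  unfolding induced_form_metric induced_metric_def tdiff_phi_Jn gam_scaleV_ii ..

lemma conic_kaehler: "conic_kaehler_manifold A flat_conn (induced_form A \<phi>)"
  unfolding conic_kaehler_manifold_def conic_complex_manifold_def
proof (intro conjI allI)
  show "symplectic_form A (induced_form A \<phi>)"
    unfolding induced_form_eq using bounded_bilinear_sympl _ sympl_nondegenerate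
    by (rule symplectic_form_frame) (simp add: sympl_def)
  show "parallel_2form A flat_conn (induced_form A \<phi>)"
    unfolding induced_form_eq by (rule parallel_form[OF bounded_bilinear_sympl])
qed (use atlas flat_torsion_free_flat_conn conic_action_act induced_form_Jn in auto)

section \<open>Special coordinates\<close>

lemma
  assumes "open U"
  shows holo_fun_fst: "holo_fun A Jn U (fst \<circ> \<phi>)" and holo_fun_snd: "holo_fun A Jn U (snd \<circ> \<phi>)"
  using smooth_fun_linear_compose[OF assms linear_fst smooth_fun_subset[OF smooth_phi subset_UNIV]]
    smooth_fun_linear_compose[OF assms linear_snd smooth_fun_subset[OF smooth_phi subset_UNIV]]
  by (auto intro!: holo_funI simp: o_def tdiff_linear_compose[OF linear_fst mdiff_phi]
      tdiff_linear_compose[OF linear_snd mdiff_phi] tdiff_phi_Jn fst_scaleV_ii snd_scaleV_ii)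

lemma real_special_coords_phi:
  assumes U: "diffeo_dom F U"
  shows "real_special_coords A flat_conn (induced_form A \<phi>) U (Re_vec \<circ> (fst \<circ> \<phi>)) (Re_vec \<circ> (snd \<circ> \<phi>))"
proof -
  have F: "(\<lambda>q. ((Re_vec \<circ> (fst \<circ> \<phi>)) q, (Re_vec \<circ> (snd \<circ> \<phi>)) q)) = F"
    by (simp add: F_def ReV_def fun_eq_iff)
  have xy: "(\<lambda>q. (Re_vec \<circ> (fst \<circ> \<phi>)) q $ i) = (\<lambda>q. fst (F q) $ i)"
    "(\<lambda>q. (Re_vec \<circ> (snd \<circ> \<phi>)) q $ i) = (\<lambda>q. snd (F q) $ i)" for i
    by (simp_all add: F_def ReV_def)
  have L: "linear (\<lambda>w :: (real ^ 'n) \<times> (real ^ 'n). fst w $ i)"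
    "linear (\<lambda>w :: (real ^ 'n) \<times> (real ^ 'n). snd w $ i)" for i
    by (auto intro: linearI)
  have "open U" using U by (simp add: diffeo_dom_def)
  then show ?thesis
    unfolding real_special_coords_def F xy
    using diffeo_dom_smooth_coords[OF U] affine_linear_F[OF L(1)] affine_linear_F[OF L(2)]
    by (simp add: tdiff_linear_compose[OF L(1) mdiff_F] tdiff_linear_compose[OF L(2) mdiff_F]
        induced_form_eq sympl_def inner_vec_def sum_subtractf)
qed

lemma conic_pair_phi: "conic_pair A act_dom act U (fst \<circ> \<phi>) (snd \<circ> \<phi>)"
  unfolding conic_pair_def action_domain_def using phi_act by (auto simp: scaleV_def)

text \<open>A vector killed by one of the two projections of d\<phi> is null for the metric, by
  \<open>gam_zero_fst\<close> or \<open>gam_zero_snd\<close>.\<close>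

lemma definite_imp_regular:
  assumes "definite_at A \<phi> p"
  shows "regular_point A \<phi> p"
proof -
  have t: "tdiff A (fst \<circ> \<phi>) p u = fst (tdiff A \<phi> p u)" "tdiff A (snd \<circ> \<phi>) p u = snd (tdiff A \<phi> p u)" for u
    using tdiff_linear_compose[OF linear_fst mdiff_phi] tdiff_linear_compose[OF linear_snd mdiff_phi]
    by (simp_all add: o_def)
  have "u = 0" if "fst (tdiff A \<phi> p u) = 0 \<or> snd (tdiff A \<phi> p u) = 0" for u
  proof -
    have "induced_metric A \<phi> p u u = 0"
      using that gam_zero_fst gam_zero_snd unfolding induced_metric_def by (metis zero_complex.sel(1))
    then show ?thesis using assms unfolding definite_at_def by force
  qed
  moreover have lin: "linear (tdiff A (fst \<circ> \<phi>) p)" "linear (tdiff A (snd \<circ> \<phi>) p)"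
    using linear_compose[OF linear_tdiff_phi linear_fst, of p] linear_compose[OF linear_tdiff_phi linear_snd, of p]
    unfolding t[abs_def] by (simp_all add: o_def)
  ultimately show ?thesis
    unfolding regular_point_def linear_injective_0[OF lin(1)] linear_injective_0[OF lin(2)] t by blast
qed

lemma special_holo_functions_phi:
  "\<exists>U. p \<in> U \<and> special_holo_functions A flat_conn (induced_form A \<phi>) U (fst \<circ> \<phi>) (snd \<circ> \<phi>)"
proof -
  obtain U where U: "p \<in> U" "diffeo_dom F U" using diffeo_dom_F[OF dim_eq] by blast
  then have "open U" by (simp add: diffeo_dom_def)
  then show ?thesis
    unfolding special_holo_functions_def
    using U real_special_coords_phi holo_fun_fst holo_fun_snd by blast
qed

text \<open>At a regular point the inverse function theorem applies to z and to w separately as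
  well; the three domains are intersected.\<close>

lemma conjugate_pair_phi:
  assumes "regular_point A \<phi> p"
  shows "\<exists>U. p \<in> U \<and> conjugate_pair A flat_conn (induced_form A \<phi>) U (fst \<circ> \<phi>) (snd \<circ> \<phi>)"
proof -
  obtain U where U: "p \<in> U" "diffeo_dom F U" using diffeo_dom_F[OF dim_eq] by blast
  obtain U1 where U1: "p \<in> U1" "diffeo_dom (fst \<circ> \<phi>) U1"
    using diffeo_dom_exists[OF holo_funD(1)[OF holo_fun_fst[OF open_UNIV]]] assms
    unfolding regular_point_def by blast
  obtain U2 where U2: "p \<in> U2" "diffeo_dom (snd \<circ> \<phi>) U2"
    using diffeo_dom_exists[OF holo_funD(1)[OF holo_fun_snd[OF open_UNIV]]] assms
    unfolding regular_point_def by blast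
  let ?U = "U \<inter> (U1 \<inter> U2)"
  have o: "open ?U" using U U1 U2 by (auto simp: diffeo_dom_def)
  have "diffeo_dom F ?U" "diffeo_dom (fst \<circ> \<phi>) ?U" "diffeo_dom (snd \<circ> \<phi>) ?U"
    using diffeo_dom_subset[OF _ o] U U1 U2 by blast+
  then have "conjugate_pair A flat_conn (induced_form A \<phi>) ?U (fst \<circ> \<phi>) (snd \<circ> \<phi>)"
    unfolding conjugate_pair_def
    by (intro conjI diffeo_dom_holo_coords real_special_coords_phi holo_fun_fst[OF o] holo_fun_snd[OF o]
        holo_funD(2)[OF holo_fun_fst[OF o]] holo_funD(2)[OF holo_fun_snd[OF o]])
  then show ?thesis using U(1) U1(1) U2(1) by (intro exI[of _ ?U] conjI IntI)
qed

end

theorem theorem8: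
  fixes A :: "('m::{t2_space,second_countable_topology}, 'n::finite) chart set"
    and \<phi> :: "'m \<Rightarrow> 'n V"
  assumes "complex_atlas A" and "connected (UNIV :: 'm set)"
    and "holomorphic_immersion A \<phi>" and "nondegenerate A \<phi>" and "lagrangian A \<phi>"
    and "conic_immersion \<phi>"
  shows "totally_complex A \<phi> \<and> (\<exists>!D. is_induced_connection A \<phi> D) \<and>
    conic_kaehler_manifold A (induced_connection A \<phi>) (induced_form A \<phi>) \<and>
    (\<forall>p u v. induced_form A \<phi> p u v = induced_metric A \<phi> p u (Jn v)) \<and>
    (\<exists>W \<Phi>. conic_action A (induced_connection A \<phi>) W \<Phi> \<and>
      (\<forall>p. \<exists>U. p \<in> U \<and>
         special_holo_functions A (induced_connection A \<phi>) (induced_form A \<phi>) U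
           (fst \<circ> \<phi>) (snd \<circ> \<phi>) \<and>
         conic_pair A W \<Phi> U (fst \<circ> \<phi>) (snd \<circ> \<phi>)) \<and>
      (\<forall>p. regular_point A \<phi> p \<or> definite_at A \<phi> p \<longrightarrow> (\<exists>U. p \<in> U \<and>
         conjugate_pair A (induced_connection A \<phi>) (induced_form A \<phi>) U
           (fst \<circ> \<phi>) (snd \<circ> \<phi>) \<and>
         conic_pair A W \<Phi> U (fst \<circ> \<phi>) (snd \<circ> \<phi>))))"
proof -
  interpret conic_lagrangian A \<phi>
    using assms by unfold_locales
  show ?thesis
    unfolding induced_connection_eq is_induced_connection_iff
  \<comment> \<open>The same action witnesses the conic structure and the scaling of the coordinates
    around every point.\<close>
  proof (intro conjI exI[of _ act_dom] exI[of _ act] allI impI)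
    fix p
    obtain U where "p \<in> U"
      "special_holo_functions A flat_conn (induced_form A \<phi>) U (fst \<circ> \<phi>) (snd \<circ> \<phi>)"
      using special_holo_functions_phi by blast
    then show "\<exists>U. p \<in> U \<and>
        special_holo_functions A flat_conn (induced_form A \<phi>) U (fst \<circ> \<phi>) (snd \<circ> \<phi>) \<and>
        conic_pair A act_dom act U (fst \<circ> \<phi>) (snd \<circ> \<phi>)"
      by (intro exI[of _ U] conjI conic_pair_phi)
  next
    fix p assume "regular_point A \<phi> p \<or> definite_at A \<phi> p"
    then have "regular_point A \<phi> p" using definite_imp_regular by blast
    then obtain U where "p \<in> U"
      "conjugate_pair A flat_conn (induced_form A \<phi>) U (fst \<circ> \<phi>) (snd \<circ> \<phi>)"
      using conjugate_pair_phi by blast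
    then show "\<exists>U. p \<in> U \<and>
        conjugate_pair A flat_conn (induced_form A \<phi>) U (fst \<circ> \<phi>) (snd \<circ> \<phi>) \<and>
        conic_pair A act_dom act U (fst \<circ> \<phi>) (snd \<circ> \<phi>)"
      by (intro exI[of _ U] conjI conic_pair_phi)
  qed (simp_all add: totally_complex_phi conic_kaehler conic_action_act induced_form_metric)
qed

end
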